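(* For $\mathbf{u}\in[-U,U]^m$ let $g_{\mathbf{u}}(\mathbf{c},A,\mathbf{b})$ be the size of the tree B&C builds on input $(\mathbf{c},A,\mathbf{b})$ after applying the GMI cut defined by $\mathbf{u}$ at the root. The pseudo-dimension of the class of tree-size functions $\{g_{\mathbf{u}}:\mathbf{u}\in[-U,U]^m\}$ on the domain of IPs (with $n$ variables and $m$ constraints) with $\|A\|_1\le a$ and $\|\mathbf{b}\|_1\le b$ is $$O\!\left(m\log(abU)+mn^3\log(m+n)+mn^3\log\tau\right).$$
   Context: An IP $(\mathbf{c},A,\mathbf{b})$ has $\mathbf{c}\in\mathbb{R}^n$, $A\in\mathbb{Z}^{m\times n}$, $\mathbf{b}\in\mathbb{Z}^m$; the feasible region of its LP relaxation is a nonempty rational polytope $\mathcal{P}$. For the GMI cuts the IP is in equality form $A\mathbf{x}=\mathbf{b}$, $\mathbf{x}\ge\mathbf{0}$ (achieved by adding slack variables). $\tau$ is (an upper bound, over the IPs in the domain, on) $\lceil\max_{\mathbf{x}\in\mathcal{P}}\|\mathbf{x}\|_\infty\rceil$. $\|A\|_1=\max_i\|\mathbf{a}_i\|_1$, where $\mathbf{a}_1,\dots,\mathbf{a}_n$ are the columns of $A$. GMI cut: for $\mathbf{u}\in\mathbb{R}^m$ let $f_i=\mathbf{u}^T\mathbf{a}_i-\lfloor\mathbf{u}^T\mathbf{a}_i\rfloor$ and $f_0=\mathbf{u}^T\mathbf{b}-\lfloor\mathbf{u}^T\mathbf{b}\rfloor$. The Gomory mixed integer (GMI) cut parameterized by $\mathbf{u}$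 is $\sum_{i:f_i\le f_0}f_ix_i+\frac{f_0}{1-f_0}\sum_{i:f_i>f_0}(1-f_i)x_i\ge f_0$. Branch-and-cut (B&C): the cut is added at the root and remains in the LP of every node. A node is identified with the set $\sigma$ of branching constraints added on the path from the root. Leaves are chosen by a fixed node selection policy. A node is fathomed if (i) its LP is infeasible, (ii) its LP optimum is integral, or (iii) its LP optimal value is no better than the best integral solution found so far. Otherwise a variable $x_i$ is chosen and two children are created by adding $x_i\le\lfloor\mathbf{x}^*[i]\rfloor$ and $x_i\ge\lceil\mathbf{x}^*[i]\rceil$, where $\mathbf{x}^*$ is the node's LP optimum. The variable is chosen by the product scoring rule: it maximizes over $i\in[n]$ the quantity $\max\{z^*-z^-_i,10^{-6}\}\cdot\max\{z^*-z^+_i,10^{-6}\}$, where $z^*$ is the node's LP value and $z_i^-,z_i^+$ are the LP values after adding $x_i\le\lfloor\mathbf{x}^*[i]\rfloor$, $x_i\ge\lceil\mathbf{x}^*[i]\rceil$ respectively (score ties broken by a fixed order). LP optima are treated as unique; where they are not, the optimum with the cut is the optimum without it if that point satisfies the cut, and otherwise ties among optimal vertices are broken by a fixed rule depending only on which edges of the node's polytope (without the cut) contain an optimal vertex. There is a bound $\kappa$ on the size of the tree B&C is allowed to build before it is terminated. Pseudo-dimension: for a class $\mathcal{G}$ of real-valued functions on a domain, $\mathrm{Pdim}(\mathcal{G})$ is the largest integer $N$ for which there exist $N$ domain points $y_1,\dots,y_N$ and thresholds $r_1,\dots,r_N\in\mathbb{R}$ such that for every $(\sigma_1,\dots,\sigma_N)\in\{0,1\}^N$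 there is $g\in\mathcal{G}$ with $g(y_i)\ge r_i$ if and only if $\sigma_i=1$. *)

theory Defs
  imports
    "HOL-Library.Extended_Real"
    "HOL-Library.Extended_Nat"
    "HOL-Library.While_Combinator"
    "Jordan_Normal_Form.Matrix"
begin

section \<open>Segments, vertices and edges\<close>

text \<open>
  Dimensions have to be quantified inside the theorem, so points of \<open>n\<close>-space are elements of
  \<^term>\<open>carrier_vec n\<close>, to which the convexity notions of HOL-Analysis (over real vector-space
  types) do not apply. The definitions below transcribe \<open>closed_segment\<close>, \<open>open_segment\<close>,
  \<open>extreme_point_of\<close> and \<open>face_of\<close>.
\<close>

definition seg :: "real vec \<Rightarrow> real vec \<Rightarrow> real vec set" where
  "seg p q = {(1 - t) \<cdot>\<^sub>v p + t \<cdot>\<^sub>v q | t. 0 \<le> t \<and> t \<le> 1}"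

definition open_seg :: "real vec \<Rightarrow> real vec \<Rightarrow> real vec set" where
  "open_seg p q = seg p q - {p, q}"

definition vertex_of :: "real vec \<Rightarrow> real vec set \<Rightarrow> bool" where
  "vertex_of x S \<longleftrightarrow> x \<in> S \<and> (\<forall>p\<in>S. \<forall>q\<in>S. x \<notin> open_seg p q)"

text \<open>
  An edge of a polytope is a one-dimensional face; as polytopes are compact, these are the faces
  that are nondegenerate segments.
\<close>

definition edges :: "real vec set \<Rightarrow> real vec set set" where
  "edges S = {e. (\<exists>p q. p \<noteq> q \<and> e = seg p q) \<and> e \<subseteq> S \<and>
     (\<forall>p\<in>S. \<forall>q\<in>S. \<forall>x\<in>e. x \<in> open_seg p q \<longrightarrow> p \<in> e \<and> q \<in> e)}"

section \<open>Integer programs\<close>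

text \<open>Maximize \<open>c \<bullet> x\<close> subject to \<open>A x = b\<close>, \<open>x \<ge> 0\<close>, \<open>x\<close> integral.\<close>

record ip =
  obj :: "real vec"
  cmat :: "int mat"
  rhs :: "int vec"

definition num_vars :: "ip \<Rightarrow> nat" where
  "num_vars P = dim_col (cmat P)"

definition rmat :: "ip \<Rightarrow> real mat" where
  "rmat P = map_mat real_of_int (cmat P)"

definition rrhs :: "ip \<Rightarrow> real vec" where
  "rrhs P = map_vec real_of_int (rhs P)"

definition lp_region :: "ip \<Rightarrow> real vec set" where
  "lp_region P = {x \<in> carrier_vec (num_vars P).
     rmat P *\<^sub>v x = rrhs P \<and> (\<forall>i<num_vars P. 0 \<le> x $ i)}"

definition l1_norm :: "int vec \<Rightarrow> int" where
  "l1_norm v = (\<Sum>i<dim_vec v. \<bar>v $ i\<bar>)"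

definition mat_l1_norm :: "int mat \<Rightarrow> int" where
  "mat_l1_norm A = Max {l1_norm (col A j) | j. j < dim_col A}"

definition linf_norm :: "real vec \<Rightarrow> real" where
  "linf_norm x = Max {\<bar>x $ i\<bar> | i. i < dim_vec x}"

definition ips :: "nat \<Rightarrow> nat \<Rightarrow> real \<Rightarrow> real \<Rightarrow> ip set" where
  "ips m n a b = {P. obj P \<in> carrier_vec n \<and> cmat P \<in> carrier_mat m n \<and> rhs P \<in> carrier_vec m \<and>
     lp_region P \<noteq> {} \<and> bdd_above (linf_norm ` lp_region P) \<and>
     real_of_int (mat_l1_norm (cmat P)) \<le> a \<and> real_of_int (l1_norm (rhs P)) \<le> b}"

definition lp_radius :: "ip \<Rightarrow> int" where
  "lp_radius P = \<lceil>SUP x\<in>lp_region P. linf_norm x\<rceil>"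

section \<open>Gomory mixed integer cuts\<close>

text \<open>The set of points satisfying the cut parameterized by \<open>u\<close>.\<close>

definition gmi_cut :: "ip \<Rightarrow> real vec \<Rightarrow> real vec set" where
  "gmi_cut P u =
    (let f = (\<lambda>i. frac (u \<bullet> col (rmat P) i)); f0 = frac (u \<bullet> rrhs P); n = num_vars P
     in {x \<in> carrier_vec n.
          (\<Sum>i | i < n \<and> f i \<le> f0. f i * x $ i)
          + f0 / (1 - f0) * (\<Sum>i | i < n \<and> f i > f0. (1 - f i) * x $ i) \<ge> f0})"

section \<open>Node LPs\<close>

text \<open>\<open>Le i k\<close> and \<open>Ge i k\<close> are the branching constraints \<open>x\<^sub>i \<le> k\<close> and \<open>x\<^sub>i \<ge> k\<close>.\<close>

datatype branching = Le nat int | Ge nat int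

fun satisfies :: "real vec \<Rightarrow> branching \<Rightarrow> bool" where
  "satisfies x (Le i k) \<longleftrightarrow> x $ i \<le> real_of_int k"
| "satisfies x (Ge i k) \<longleftrightarrow> x $ i \<ge> real_of_int k"

definition node_region :: "ip \<Rightarrow> branching set \<Rightarrow> real vec set" where
  "node_region P \<sigma> = {x \<in> lp_region P. \<forall>\<beta>\<in>\<sigma>. satisfies x \<beta>}"

text \<open>
  Below, \<open>H\<close> is the set of points satisfying the cut (\<^term>\<open>UNIV\<close> for no cut). The value of an
  infeasible LP is \<open>-\<infinity>\<close>.
\<close>

definition lp_value :: "ip \<Rightarrow> real vec set \<Rightarrow> branching set \<Rightarrow> ereal" where
  "lp_value P H \<sigma> = (SUP x\<in>node_region P \<sigma> \<inter> H. ereal (obj P \<bullet> x))"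

definition optimal_vertices :: "ip \<Rightarrow> real vec set \<Rightarrow> branching set \<Rightarrow> real vec set" where
  "optimal_vertices P H \<sigma> =
    {v. vertex_of v (node_region P \<sigma> \<inter> H) \<and> ereal (obj P \<bullet> v) = lp_value P H \<sigma>}"

section \<open>Branch-and-cut\<close>

text \<open>
  A node of the tree is given by the list of branching constraints on the path from the root, most
  recent first; the set of this list is the set \<open>\<sigma>\<close> of branching constraints of the node. The list
  only serves to tell apart nodes with equal \<open>\<sigma>\<close> (branching on a variable that is integral at the
  LP optimum may repeat a constraint).
\<close>

type_synonym node = "branching list"

text \<open>
  The conventions under which branch-and-cut is run:

  \<^item> \<open>opt0 P \<sigma>\<close> is the LP optimum of the node without the cut.

  \<^item> \<open>pick P \<sigma> E\<close> breaks ties between optimal vertices of the LP with the cut, where \<open>E\<close> is the set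
    of edges of the node's polytope without the cut that contain an optimal vertex. It returns the
    two endpoints of an edge in \<open>E\<close>. An edge may contain two optimal vertices (an endpoint and its
    intersection with the cut hyperplane); the one nearer to the first endpoint is taken.

  \<^item> \<open>rank\<close> is the order for breaking score ties.

  \<^item> \<open>select P T L R\<close> is the node selection policy. It chooses one of the unprocessed leaves \<open>L\<close> of
    the tree \<open>T\<close>, and may depend on how the LP values of the nodes of \<open>T\<close> compare (the relation
    \<open>R\<close>), as best-bound selection does, but not otherwise on the cut.
\<close>

record rules =
  opt0 :: "ip \<Rightarrow> branching set \<Rightarrow> real vec"
  pick :: "ip \<Rightarrow> branching set \<Rightarrow> real vec set set \<Rightarrow> real vec \<times> real vec"
  rank :: "nat \<Rightarrow> nat"
  select :: "ip \<Rightarrow> node set \<Rightarrow> node set \<Rightarrow> (node \<times> node) set \<Rightarrow> node"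

definition valid_rules :: "ip set \<Rightarrow> rules \<Rightarrow> bool" where
  "valid_rules D \<rho> \<longleftrightarrow>
     (\<forall>P\<in>D. \<forall>\<sigma>. finite \<sigma> \<and> node_region P \<sigma> \<noteq> {} \<longrightarrow>
        opt0 \<rho> P \<sigma> \<in> optimal_vertices P UNIV \<sigma>) \<and>
     (\<forall>P\<in>D. \<forall>\<sigma> E. finite \<sigma> \<and> E \<noteq> {} \<and> E \<subseteq> edges (node_region P \<sigma>) \<longrightarrow>
        (case pick \<rho> P \<sigma> E of (p, q) \<Rightarrow> seg p q \<in> E)) \<and>
     inj (rank \<rho>) \<and>
     (\<forall>P\<in>D. \<forall>T L R. L \<noteq> {} \<longrightarrow> select \<rho> P T L R \<in> L)"

definition lp_opt :: "rules \<Rightarrow> ip \<Rightarrow> real vec set \<Rightarrow> branching set \<Rightarrow> real vec" where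
  "lp_opt \<rho> P H \<sigma> =
    (if opt0 \<rho> P \<sigma> \<in> H then opt0 \<rho> P \<sigma>
     else
       let V = optimal_vertices P H \<sigma>;
           (p, q) = pick \<rho> P \<sigma> {e \<in> edges (node_region P \<sigma>). e \<inter> V \<noteq> {}}
       in THE v. v \<in> V \<inter> seg p q \<and> (\<forall>w\<in>V \<inter> seg p q. v \<in> seg p w))"

definition score :: "ip \<Rightarrow> real vec set \<Rightarrow> branching set \<Rightarrow> real vec \<Rightarrow> nat \<Rightarrow> ereal" where
  "score P H \<sigma> x i =
     max (lp_value P H \<sigma> - lp_value P H (insert (Le i \<lfloor>x $ i\<rfloor>) \<sigma>)) (ereal (1 / 10 ^ 6)) *
     max (lp_value P H \<sigma> - lp_value P H (insert (Ge i \<lceil>x $ i\<rceil>) \<sigma>)) (ereal (1 / 10 ^ 6))"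

definition branch_var :: "rules \<Rightarrow> ip \<Rightarrow> real vec set \<Rightarrow> branching set \<Rightarrow> real vec \<Rightarrow> nat" where
  "branch_var \<rho> P H \<sigma> x =
     (ARG_MIN (rank \<rho>) i. i < num_vars P \<and>
        (\<forall>j<num_vars P. score P H \<sigma> x j \<le> score P H \<sigma> x i))"

text \<open>
  \<open>incumbent\<close> is the value of the best integral solution found so far, \<open>-\<infinity>\<close> if there is none.
\<close>

record state =
  tree :: "node set"
  leaves :: "node set"
  incumbent :: ereal

text \<open>
  One step processes one leaf. The run is terminated (by emptying the set of leaves to be processed)
  when branching would give the tree more than \<open>\<kappa>\<close> nodes.
\<close>

definition bc_step :: "rules \<Rightarrow> nat \<Rightarrow> ip \<Rightarrow> real vec set \<Rightarrow> state \<Rightarrow> state" where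
  "bc_step \<rho> \<kappa> P H s =
    (let R = {(\<mu>, \<nu>). \<mu> \<in> tree s \<and> \<nu> \<in> tree s \<and> lp_value P H (set \<mu>) \<le> lp_value P H (set \<nu>)};
         \<nu> = select \<rho> P (tree s) (leaves s) R;
         \<sigma> = set \<nu>;
         z = lp_value P H \<sigma>;
         x = lp_opt \<rho> P H \<sigma>;
         s' = s\<lparr>leaves := leaves s - {\<nu>}\<rparr>
     in if node_region P \<sigma> \<inter> H = {} then s'
        else if \<forall>i<num_vars P. x $ i \<in> \<int> then s'\<lparr>incumbent := max (incumbent s) z\<rparr>
        else if z \<le> incumbent s then s'
        else if card (tree s) + 2 > \<kappa> then s\<lparr>leaves := {}\<rparr>
        else
          let i = branch_var \<rho> P H \<sigma> x;
              children = {Le i \<lfloor>x $ i\<rfloor> # \<nu>, Ge i \<lceil>x $ i\<rceil> # \<nu>}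
          in s'\<lparr>tree := tree s \<union> children, leaves := leaves s' \<union> children\<rparr>)"

definition bc_tree :: "rules \<Rightarrow> nat \<Rightarrow> ip \<Rightarrow> real vec set \<Rightarrow> node set" where
  "bc_tree \<rho> \<kappa> P H =
     tree (while (\<lambda>s. leaves s \<noteq> {}) (bc_step \<rho> \<kappa> P H)
             \<lparr>tree = {[]}, leaves = {[]}, incumbent = -\<infinity>\<rparr>)"

definition gmi_tree_size :: "rules \<Rightarrow> nat \<Rightarrow> real vec \<Rightarrow> ip \<Rightarrow> nat" where
  "gmi_tree_size \<rho> \<kappa> u P = card (bc_tree \<rho> \<kappa> P (gmi_cut P u))"

section \<open>Pseudo-dimension\<close>

text \<open>The supremum is \<open>\<infinity>\<close> if there is no largest such \<open>N\<close>.\<close>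

definition pdim :: "'x set \<Rightarrow> ('x \<Rightarrow> real) set \<Rightarrow> enat" where
  "pdim D G = Sup {enat N | N. \<exists>y r. (\<forall>i<N. y i \<in> D) \<and>
     (\<forall>\<sigma> :: nat \<Rightarrow> bool. \<exists>g\<in>G. \<forall>i<N. g (y i) \<ge> (r i :: real) \<longleftrightarrow> \<sigma> i)}"

end

theory Submission
  imports Defs "HOL-Analysis.Function_Topology"
begin

text \<open>
  The tree that branch-and-cut builds on one program is determined by the signs of polynomials in the
  multipliers \<open>u\<close>. On \<open>N\<close> shattered programs \<open>2 ^ N\<close> multipliers have pairwise different signs, and a
  bound on the number of sign patterns bounds \<open>N\<close>.

  Which polynomials are needed: The roundings in the definition of the cut are determined by linear
  conditions in \<open>u\<close>, about \<open>n * (a * b * U)\<close> of them. Once they are fixed, the cut is \<open>G \<ge> 0\<close> for an affine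
  function \<open>G\<close> whose coefficients are quadratic in \<open>u\<close>. The optimum of a node LP with the cut is a vertex
  of the node polytope, or the point where an edge crosses the hyperplane \<open>G = 0\<close>
  (\<open>optimum_on_edge\<close>). The vertices of all node polytopes together are at most \<open>(\<tau> + 2) ^ n\<close> points
  (\<open>card_node_vertices_le\<close>). Naming an optimum by one or two of these points gives names that do not
  depend on \<open>u\<close>, while objective values and coordinates become quotients of polynomials in \<open>u\<close>.
  Feasibility, LP values, ties, scores, roundings of the optimum and pruning are then decided by the
  signs of polynomials of degree at most \<open>16\<close>, whose number has a logarithm of order
  \<open>n * ln (\<tau> + 2)\<close>. If these signs agree for two multipliers, the two runs proceed in parallel
  (\<open>bc_tree_eq\<close>).

  The number of sign patterns: \<open>J\<close> polynomials of degree \<open>d\<close> in \<open>m\<close> variables have at most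
  \<open>(4 * J * d + 1) ^ m\<close> sign patterns (\<open>card_sign_patterns_le\<close>). Every cell contains a critical point of
  the squared product of the polynomials, perturbed by a multiple of \<open>\<Sum>i<m. x i ^ E\<close>. The gradient of the
  perturbed function has pure powers as leading terms, so that a count of monomials bounds the number
  of critical points. This is applied to the linear conditions and, within each of their classes, to the
  conditions of degree \<open>16\<close>. The resulting inequality \<open>2 ^ N \<le> (c * N * \<dots>) ^ (2 * m)\<close> yields the bound.
\<close>

section \<open>Sign patterns of polynomials\<close>

definition power_product :: "nat \<Rightarrow> (nat \<Rightarrow> nat) \<Rightarrow> (nat \<Rightarrow> real) \<Rightarrow> real" where
  "power_product m e x = (\<Prod>i<m. x i ^ e i)"

text \<open>
  The real polynomial functions of degree at most \<open>d\<close> in the first \<open>m\<close> coordinates. The dimension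
  is a natural number and not a type, as the theorem quantifies over it. Generating the functions from
  monomials by addition lets statements that are linear in the polynomial be proved by induction.
\<close>

inductive polyfun :: "nat \<Rightarrow> nat \<Rightarrow> ((nat \<Rightarrow> real) \<Rightarrow> real) \<Rightarrow> bool" for m d where
  monomial: "(\<Sum>i<m. e i) \<le> d \<Longrightarrow> polyfun m d (\<lambda>x. c * power_product m e x)"
| add: "polyfun m d f \<Longrightarrow> polyfun m d g \<Longrightarrow> polyfun m d (\<lambda>x. f x + g x)"

lemma polyfun_mono: "polyfun m d f \<Longrightarrow> d \<le> d' \<Longrightarrow> polyfun m d' f"
  by (induction rule: polyfun.induct) (auto intro: polyfun.intros)

lemma polyfun_const: "polyfun m d (\<lambda>x. c)"
  using polyfun.monomial[of "\<lambda>_. 0" m "d" c] by (simp add: power_product_def)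

lemma polyfun_var:
  assumes "i < m" "1 \<le> d"
  shows "polyfun m d (\<lambda>x. x i)"
proof -
  have "power_product m (\<lambda>j. if j = i then 1 else 0) x = x i" for x
  proof -
    have "power_product m (\<lambda>j. if j = i then 1 else 0) x = (\<Prod>j<m. if j = i then x j else 1)"
      unfolding power_product_def by (intro prod.cong) auto
    then show ?thesis using assms by (simp add: prod.delta)
  qed
  moreover have "(\<Sum>j<m. if j = i then 1 else 0::nat) \<le> d" using assms by (simp add: sum.delta)
  ultimately show ?thesis using polyfun.monomial[of "\<lambda>j. if j = i then 1 else 0" m "d" 1] by simp
qed

lemma polyfun_scale: "polyfun m d f \<Longrightarrow> polyfun m d (\<lambda>x. c * f x)"
proof (induction rule: polyfun.induct)
  case (monomial e c')
  then show ?case using polyfun.monomial[of e m d "c * c'"] by (simp add: mult.assoc)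
next
  case (add f g)
  then show ?case using polyfun.add by (simp add: distrib_left)
qed

lemma polyfun_diff: "polyfun m d f \<Longrightarrow> polyfun m d g \<Longrightarrow> polyfun m d (\<lambda>x. f x - g x)"
  using polyfun.add[of m d f "\<lambda>x. -1 * g x"] polyfun_scale[of m d g "-1"] by simp

lemma polyfun_mult:
  assumes "polyfun m d f" "polyfun m d' g"
  shows "polyfun m (d + d') (\<lambda>x. f x * g x)"
  using assms(1)
proof (induction rule: polyfun.induct)
  case (monomial e c)
  show ?case using assms(2)
  proof (induction rule: polyfun.induct)
    case (monomial e' c')
    have "(\<lambda>x. c * power_product m e x * (c' * power_product m e' x)) = (\<lambda>x. c * c' * power_product m (\<lambda>i. e i + e' i) x)"
      by (simp add: power_product_def power_add prod.distrib fun_eq_iff)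
    moreover have "(\<Sum>i<m. e i + e' i) \<le> d + d'"
      using monomial \<open>(\<Sum>i<m. e i) \<le> d\<close> by (simp add: sum.distrib)
    ultimately show ?case
      using polyfun.monomial[of "\<lambda>i. e i + e' i" m "d + d'" "c * c'"] by simp
  next
    case (add f g)
    then show ?case using polyfun.add by (simp add: distrib_left)
  qed
next
  case (add f h)
  then show ?case using polyfun.add by (simp add: distrib_right)
qed

lemma polyfun_sum:
  assumes "\<And>j. j \<in> J \<Longrightarrow> polyfun m d (f j)"
  shows "polyfun m d (\<lambda>x. \<Sum>j\<in>J. f j x)"
  using assms
proof (induction J rule: infinite_finite_induct)
  case (insert j J)
  then show ?case using polyfun.add[of m d "f j" "\<lambda>x. \<Sum>j\<in>J. f j x"] by simp
qed (auto simp: polyfun_const)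

lemma polyfun_prod:
  assumes "finite J" "\<And>j. j \<in> J \<Longrightarrow> polyfun m d (f j)"
  shows "polyfun m (card J * d) (\<lambda>x. \<Prod>j\<in>J. f j x)"
  using assms
proof (induction J)
  case (insert j J)
  then show ?case using polyfun_mult[of m d "f j" "card J * d" "\<lambda>x. \<Prod>j\<in>J. f j x"] by simp
qed (auto simp: polyfun_const)

lemma polyfun_cong:
  assumes "polyfun m d f" "\<And>i. i < m \<Longrightarrow> x i = y i"
  shows "f x = f y"
  using assms(1)
proof (induction rule: polyfun.induct)
  case (monomial e c)
  have "power_product m e x = power_product m e y" unfolding power_product_def using assms(2) by (intro prod.cong) auto
  then show ?case by simp
qed auto

lemma polyfun_continuous: "polyfun m d f \<Longrightarrow> continuous_on UNIV f"
proof (induction rule: polyfun.induct)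
  case (monomial e c)
  show ?case unfolding power_product_def by (intro continuous_intros) auto
qed (auto intro: continuous_intros)

lemma polyfun_partial_derivative:
  assumes "polyfun m d f" "i < m"
  shows "\<exists>f'. polyfun m d f' \<and>
    (\<forall>x. ((\<lambda>s. f (x(i := s))) has_real_derivative f' x) (at (x i)))"
  using assms(1)
proof (induction rule: polyfun.induct)
  case (monomial e c)
  define e' where "e' = e(i := e i - 1)"
  have "(\<Sum>j<m. e' j) \<le> (\<Sum>j<m. e j)" unfolding e'_def by (intro sum_mono) auto
  then have pf: "polyfun m d (\<lambda>x. (c * real (e i)) * power_product m e' x)"
    using monomial by (intro polyfun.monomial) simp
  have split: "power_product m k x = x i ^ k i * (\<Prod>j\<in>{..<m} - {i}. x j ^ k j)" for k x
    unfolding power_product_def using assms(2) by (subst prod.remove[of _ i]) auto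
  have "((\<lambda>s. c * power_product m e (x(i := s))) has_real_derivative (c * real (e i)) * power_product m e' x)
      (at (x i))" for x
  proof -
    let ?r = "\<Prod>j\<in>{..<m} - {i}. x j ^ e j"
    have *: "power_product m e (x(i := s)) = s ^ e i * ?r" for s
      unfolding split by (auto intro!: arg_cong2[of _ _ _ _ "(*)"] prod.cong)
    have **: "power_product m e' x = x i ^ (e i - 1) * ?r"
      unfolding split e'_def by (auto intro!: arg_cong2[of _ _ _ _ "(*)"] prod.cong)
    show ?thesis unfolding * **
      by (auto intro!: derivative_eq_intros)
  qed
  with pf show ?case by blast
next
  case (add f g)
  then obtain f' g' where "polyfun m d f'" "polyfun m d g'"
    and d: "\<forall>x. ((\<lambda>s. f (x(i := s))) has_real_derivative f' x) (at (x i))"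
      "\<forall>x. ((\<lambda>s. g (x(i := s))) has_real_derivative g' x) (at (x i))" by blast
  then have "polyfun m d (\<lambda>x. f' x + g' x)" by (intro polyfun.add)
  moreover have "\<forall>x. ((\<lambda>s. f (x(i := s)) + g (x(i := s))) has_real_derivative f' x + g' x) (at (x i))"
    using d by (auto intro: DERIV_add)
  ultimately show ?case by blast
qed

text \<open>
  Controls a polynomial at infinity, where it has to be dominated by a sum of higher powers.
\<close>

lemma polyfun_growth:
  assumes "polyfun m d f"
  shows "\<exists>C. \<forall>R\<ge>1. \<forall>x. (\<forall>i<m. \<bar>x i\<bar> \<le> R) \<longrightarrow> \<bar>f x\<bar> \<le> C * R ^ d"
  using assms
proof (induction rule: polyfun.induct)
  case (monomial e c)
  have "\<bar>c * power_product m e x\<bar> \<le> \<bar>c\<bar> * R ^ d" if R: "R \<ge> 1" "\<forall>i<m. \<bar>x i\<bar> \<le> R" for R x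
  proof -
    have "\<bar>power_product m e x\<bar> = (\<Prod>i<m. \<bar>x i\<bar> ^ e i)" by (simp add: power_product_def abs_prod power_abs)
    also have "\<dots> \<le> (\<Prod>i<m. R ^ e i)" using R by (intro prod_mono) (auto intro: power_mono)
    also have "\<dots> = R ^ (\<Sum>i<m. e i)" by (simp add: power_sum)
    also have "\<dots> \<le> R ^ d" using R monomial by (intro power_increasing) auto
    finally show ?thesis by (simp add: abs_mult mult_left_mono)
  qed
  then show ?case by blast
next
  case (add f g)
  then obtain C D where C: "\<forall>R\<ge>1. \<forall>x. (\<forall>i<m. \<bar>x i\<bar> \<le> R) \<longrightarrow> \<bar>f x\<bar> \<le> C * R ^ d"
    and D: "\<forall>R\<ge>1. \<forall>x. (\<forall>i<m. \<bar>x i\<bar> \<le> R) \<longrightarrow> \<bar>g x\<bar> \<le> D * R ^ d" by blast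
  have "\<bar>f x + g x\<bar> \<le> (C + D) * R ^ d" if "R \<ge> 1" "\<forall>i<m. \<bar>x i\<bar> \<le> R" for R x
    using C[rule_format, OF that(1), of x] D[rule_format, OF that(1), of x] that
    by (simp add: distrib_right)
  then show ?case by blast
qed

text \<open>
  A homogeneous linear system with more unknowns than equations has a nonzero solution; Gaussian
  elimination removes one equation and one unknown at a time.
\<close>

lemma nontrivial_annihilator:
  fixes M :: "'b \<Rightarrow> 'z \<Rightarrow> real"
  assumes "finite B" "finite Z" "card B < card Z"
  shows "\<exists>w. (\<exists>z\<in>Z. w z \<noteq> 0) \<and> (\<forall>b\<in>B. (\<Sum>z\<in>Z. w z * M b z) = 0)"
  using assms
proof (induction B arbitrary: Z M)
  case empty
  then have "Z \<noteq> {}" by auto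
  then show ?case by (intro exI[of _ "\<lambda>_. 1"]) auto
next
  case (insert b B)
  show ?case
  proof (cases "\<forall>z\<in>Z. M b z = 0")
    case True
    from insert have "card B < card Z" by simp
    from insert.IH[OF insert.prems(1) this, of M] True show ?thesis by auto
  next
    case False
    then obtain y where y: "y \<in> Z" "M b y \<noteq> 0" by blast
    define Z' where "Z' = Z - {y}"
    have Z': "finite Z'" "y \<notin> Z'" "Z = insert y Z'" using y insert.prems by (auto simp: Z'_def)
    then have "card B < card Z'" using insert by simp
    from insert.IH[OF Z'(1) this, of "\<lambda>b' z. M b' z - M b' y / M b y * M b z"]
    obtain w where w: "\<exists>z\<in>Z'. w z \<noteq> 0"
      "\<And>b'. b' \<in> B \<Longrightarrow> (\<Sum>z\<in>Z'. w z * (M b' z - M b' y / M b y * M b z)) = 0" by blast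
    define s where "s = (\<Sum>z\<in>Z'. w z * M b z)"
    define w' where "w' = w(y := - s / M b y)"
    have sum': "(\<Sum>z\<in>Z. w' z * M b' z) = - s / M b y * M b' y + (\<Sum>z\<in>Z'. w z * M b' z)" for b'
    proof -
      have "(\<Sum>z\<in>Z'. w' z * M b' z) = (\<Sum>z\<in>Z'. w z * M b' z)"
        using Z' by (intro sum.cong) (auto simp: w'_def)
      then show ?thesis using Z' by (simp add: w'_def)
    qed
    have "(\<Sum>z\<in>Z. w' z * M b z) = 0" unfolding sum' using y by (simp add: s_def)
    moreover have "(\<Sum>z\<in>Z. w' z * M b' z) = 0" if "b' \<in> B" for b'
    proof -
      have "0 = (\<Sum>z\<in>Z'. w z * (M b' z - M b' y / M b y * M b z))" using w(2)[OF that] by simp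
      also have "\<dots> = (\<Sum>z\<in>Z'. w z * M b' z - M b' y / M b y * (w z * M b z))"
        by (intro sum.cong) (auto simp: algebra_simps)
      also have "\<dots> = (\<Sum>z\<in>Z'. w z * M b' z) - M b' y / M b y * s"
        by (simp only: sum_subtractf s_def sum_distrib_left)
      finally show ?thesis unfolding sum' by simp
    qed
    moreover have "\<exists>z\<in>Z. w' z \<noteq> 0" using w(1) Z' by (auto simp: w'_def)
    ultimately show ?thesis by (intro exI[of _ w']) auto
  qed
qed

text \<open>
  A Bezout bound for systems whose equations have the leading terms \<open>x\<^sub>1\<^sup>D, \<dots>, x\<^sub>m\<^sup>D\<close>. On the set \<open>Z\<close>
  of solutions every power \<open>x\<^sub>i\<^sup>D\<close> can be replaced by a polynomial of smaller degree, so on \<open>Z\<close> all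
  polynomials are combinations of the \<open>D\<^sup>m\<close> monomials with exponents below \<open>D\<close>. If \<open>Z\<close> had more than
  \<open>D\<^sup>m\<close> points, some nonzero weighting of \<open>Z\<close> would annihilate these monomials, hence all polynomials;
  but an interpolation polynomial singles out any given point of \<open>Z\<close>.
\<close>

lemma card_common_zeros_le:
  assumes fin: "finite Z" and supp: "\<And>x i. x \<in> Z \<Longrightarrow> m \<le> i \<Longrightarrow> x i = 0"
    and D: "1 \<le> D" and h: "\<And>i. i < m \<Longrightarrow> polyfun m (D - 1) (h i)"
    and zero: "\<And>i x. i < m \<Longrightarrow> x \<in> Z \<Longrightarrow> x i ^ D = h i x"
  shows "card Z \<le> D ^ m"
proof (rule ccontr)
  assume "\<not> card Z \<le> D ^ m"
  define B where "B = PiE {..<m} (\<lambda>_. {..<D})"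
  have "finite B" "card B = D ^ m" by (auto simp: B_def finite_PiE card_PiE)
  with \<open>\<not> card Z \<le> D ^ m\<close> have "card B < card Z" by simp
  from nontrivial_annihilator[OF \<open>finite B\<close> fin this, of "power_product m"]
  obtain w z0 where z0: "z0 \<in> Z" "w z0 \<noteq> 0"
    and w: "\<And>e. e \<in> B \<Longrightarrow> (\<Sum>z\<in>Z. w z * power_product m e z) = 0" by blast
  have mons: "(\<Sum>z\<in>Z. w z * power_product m e z) = 0" for e
  proof (induction "\<Sum>i<m. e i" arbitrary: e rule: less_induct)
    case less
    show ?case
    proof (cases "\<forall>i<m. e i < D")
      case True
      have "power_product m e z = power_product m (restrict e {..<m}) z" for z
        unfolding power_product_def by (intro prod.cong) auto
      moreover have "restrict e {..<m} \<in> B" using True by (auto simp: B_def)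
      ultimately show ?thesis using w by simp
    next
      case False
      then obtain i where i: "i < m" "D \<le> e i" by auto
      define e' where "e' = e(i := e i - D)"
      have split: "power_product m k x = x i ^ k i * (\<Prod>j\<in>{..<m} - {i}. x j ^ k j)" for k x
        unfolding power_product_def using i by (subst prod.remove[of _ i]) auto
      have "power_product m e z = power_product m e' z * h i z" if "z \<in> Z" for z
      proof -
        have "power_product m e z = power_product m e' z * z i ^ D"
          unfolding split using i
          by (auto simp: e'_def mult.assoc simp flip: power_add intro!: prod.cong)
        then show ?thesis using zero[OF i(1) that] by simp
      qed
      then have eq: "(\<Sum>z\<in>Z. w z * power_product m e z) = (\<Sum>z\<in>Z. w z * (power_product m e' z * h i z))"
        by (intro sum.cong) auto
      have ssplit: "(\<Sum>j<m. k j) = k i + (\<Sum>j\<in>{..<m} - {i}. k j)" for k :: "nat \<Rightarrow> nat"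
        using i by (subst sum.remove[of _ i]) auto
      have "(\<Sum>j\<in>{..<m} - {i}. e' j) = (\<Sum>j\<in>{..<m} - {i}. e j)"
        by (intro sum.cong) (auto simp: e'_def)
      then have deg: "(\<Sum>j<m. e' j) + (D - 1) < (\<Sum>j<m. e j)"
        unfolding ssplit using i D by (simp add: e'_def)
      have pf: "polyfun m ((\<Sum>j<m. e' j) + (D - 1)) (\<lambda>x. power_product m e' x * h i x)"
        using polyfun_mult[OF polyfun.monomial[of e' m _ 1] h[OF i(1)]] by simp
      have "(\<Sum>z\<in>Z. w z * f z) = 0" if "polyfun m ((\<Sum>j<m. e' j) + (D - 1)) f" for f
        using that
      proof (induction rule: polyfun.induct)
        case (monomial k c)
        have "(\<Sum>z\<in>Z. w z * (c * power_product m k z)) = c * (\<Sum>z\<in>Z. w z * power_product m k z)"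
          by (simp add: sum_distrib_left mult_ac)
        then show ?case using less[of k] deg monomial by simp
      next
        case (add f g)
        then show ?case by (simp add: distrib_left sum.distrib)
      qed
      from this[OF pf] eq show ?thesis by simp
    qed
  qed
  have polys: "(\<Sum>z\<in>Z. w z * f z) = 0" if "polyfun m d f" for d f
    using that
  proof (induction rule: polyfun.induct)
    case (monomial k c)
    have "(\<Sum>z\<in>Z. w z * (c * power_product m k z)) = c * (\<Sum>z\<in>Z. w z * power_product m k z)"
      by (simp add: sum_distrib_left mult_ac)
    then show ?case using mons by simp
  next
    case (add f g)
    then show ?case by (simp add: distrib_left sum.distrib)
  qed
  (* The interpolation polynomial: the product of the squared distances to the other points. *)
  define I where "I = (\<lambda>x. \<Prod>y\<in>Z - {z0}. \<Sum>i<m. (x i - y i) * (x i - y i))"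
  have "polyfun m (card (Z - {z0}) * (1 + 1)) I" unfolding I_def
    using fin by (intro polyfun_prod polyfun_sum polyfun_mult polyfun_diff polyfun_var polyfun_const) auto
  from polys[OF this] have "(\<Sum>z\<in>Z. w z * I z) = 0" .
  moreover have "(\<Sum>z\<in>Z. w z * I z) = w z0 * I z0"
  proof -
    have "I z = 0" if "z \<in> Z - {z0}" for z
      unfolding I_def using that fin by (intro prod_zero bexI[of _ z]) auto
    then show ?thesis using fin z0 by (subst sum.remove[of _ z0]) auto
  qed
  moreover have "I z0 \<noteq> 0"
  proof -
    have "(\<Sum>i<m. (z0 i - y i) * (z0 i - y i)) \<noteq> 0" if "y \<in> Z - {z0}" for y
    proof
      assume "(\<Sum>i<m. (z0 i - y i) * (z0 i - y i)) = 0"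
      then have "\<forall>i<m. z0 i = y i" by (subst (asm) sum_nonneg_eq_0_iff) auto
      moreover have "\<forall>i\<ge>m. z0 i = y i" using supp[of z0] supp[of y] that z0 by simp
      ultimately have "z0 = y" by (metis ext not_le)
      with that show False by simp
    qed
    then show ?thesis unfolding I_def using fin by (simp add: prod_zero_iff)
  qed
  ultimately show False using z0 by simp
qed

text \<open>
  The bound of Warren and Milnor-Thom type on the number of sign vectors. The square \<open>f\<close> of the product
  of all \<open>p j\<close> vanishes on the boundary of every sign cell and is positive at the given points. For
  small \<open>\<epsilon>\<close> the function \<open>F x = f x - \<epsilon> * (\<Sum>i<m. x i ^ E)\<close> is still positive there, is at most \<open>0\<close> on the
  boundaries, and is negative far out as \<open>E\<close> exceeds the degree of \<open>f\<close>. So it has a maximum inside each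
  cell, and this is a critical point. The equations \<open>\<partial>F/\<partial>x\<^sub>i = 0\<close> have the pure powers \<open>x i ^ (E - 1)\<close> as
  leading terms, so that \<open>card_common_zeros_le\<close> bounds the number of critical points, and thereby of
  cells.
\<close>

lemma card_strict_sign_patterns_le:
  fixes p :: "'j \<Rightarrow> (nat \<Rightarrow> real) \<Rightarrow> real"
  assumes J: "finite J" and p: "\<And>j. j \<in> J \<Longrightarrow> polyfun m d (p j)"
    and X: "finite X" and nz: "\<And>x j. x \<in> X \<Longrightarrow> j \<in> J \<Longrightarrow> p j x \<noteq> 0"
    and inj: "\<And>x y. x \<in> X \<Longrightarrow> y \<in> X \<Longrightarrow> (\<And>j. j \<in> J \<Longrightarrow> p j x > 0 \<longleftrightarrow> p j y > 0) \<Longrightarrow> x = y"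
  shows "card X \<le> (2 * card J * d + 1) ^ m"
proof -
  define N where "N = card J * (d + d)"
  define f where "f = (\<lambda>x. \<Prod>j\<in>J. p j x * p j x)"
  have pf: "polyfun m N f" unfolding f_def N_def
    using J p by (intro polyfun_prod polyfun_mult) auto
  (* Even, as N is, and large enough for E - 1 to exceed the degree of the derivatives of f. *)
  define E where "E = N + 2"
  define q where "q = (\<lambda>x :: nat \<Rightarrow> real. \<Sum>i<m. x i ^ E)"
  have evenE: "even E" by (simp add: E_def N_def flip: mult_2)
  have q0: "q x \<ge> 0" for x unfolding q_def using evenE by (intro sum_nonneg) (simp add: zero_le_even_power)
  have fpos: "f x > 0" if "x \<in> X" for x
    unfolding f_def using nz[OF that] by (intro prod_pos) (simp add: zero_less_mult_iff, meson linorder_neqE)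
  obtain \<epsilon> where \<epsilon>: "\<epsilon> > 0" "\<And>x. x \<in> X \<Longrightarrow> \<epsilon> * q x < f x"
  proof -
    define \<epsilon> where "\<epsilon> = Min (insert 1 ((\<lambda>x. f x / (q x + 1)) ` X))"
    have "\<epsilon> > 0" unfolding \<epsilon>_def using X fpos q0
      by (subst Min_gr_iff) (auto intro!: divide_pos_pos add_nonneg_pos)
    moreover have "\<epsilon> * q x < f x" if "x \<in> X" for x
    proof -
      have "\<epsilon> \<le> f x / (q x + 1)" unfolding \<epsilon>_def using X that by (intro Min_le) auto
      then have "\<epsilon> * (q x + 1) \<le> f x" using q0[of x] by (simp add: pos_le_divide_eq)
      then show ?thesis using \<open>\<epsilon> > 0\<close> by (simp add: distrib_left)
    qed
    ultimately show ?thesis using that by blast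
  qed
  define F where "F = (\<lambda>x. f x - \<epsilon> * q x)"
  obtain C where C: "\<And>R x. R \<ge> 1 \<Longrightarrow> (\<And>i. i < m \<Longrightarrow> \<bar>x i\<bar> \<le> R) \<Longrightarrow> \<bar>f x\<bar> \<le> C * R ^ N"
    using polyfun_growth[OF pf] by blast
  obtain R where R: "R \<ge> 1" "C < \<epsilon> * R ^ 2" "\<And>x i. x \<in> X \<Longrightarrow> i < m \<Longrightarrow> \<bar>x i\<bar> \<le> R"
  proof -
    define S where "S = {1, \<bar>C\<bar> / \<epsilon> + 1} \<union> (\<lambda>(x, i). \<bar>x i\<bar>) ` (X \<times> {..<m})"
    have fS: "finite S" unfolding S_def using X by auto
    have "1 \<in> S" "\<bar>C\<bar> / \<epsilon> + 1 \<in> S" by (simp_all add: S_def)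
    then have "Max S \<ge> 1" and S2: "Max S \<ge> \<bar>C\<bar> / \<epsilon> + 1" using fS by (simp_all add: Max_ge)
    moreover have "C < \<epsilon> * (Max S)\<^sup>2"
    proof -
      have "C < \<epsilon> * (\<bar>C\<bar> / \<epsilon> + 1)" using \<epsilon>(1) by (simp add: distrib_left)
      also have "\<dots> \<le> \<epsilon> * Max S" using \<epsilon>(1) S2 by (intro mult_left_mono) auto
      also have "\<dots> \<le> \<epsilon> * (Max S)\<^sup>2"
        using \<epsilon>(1) \<open>Max S \<ge> 1\<close> by (intro mult_left_mono) (auto simp: power2_eq_square)
      finally show ?thesis .
    qed
    moreover have "\<bar>x i\<bar> \<le> Max S" if "x \<in> X" "i < m" for x i
    proof -
      have "(\<lambda>(x, i). \<bar>x i\<bar>) (x, i) \<in> S" unfolding S_def using that by blast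
      then show ?thesis using fS by auto
    qed
    ultimately show ?thesis using that by blast
  qed
  (* good x z: the point z is a critical point of F in the sign cell of x. *)
  define good where "good = (\<lambda>x z. (\<forall>i\<ge>m. z i = 0) \<and> (\<forall>j\<in>J. p j z \<noteq> 0 \<and> (p j z > 0 \<longleftrightarrow> p j x > 0)) \<and>
      (\<forall>i<m. \<forall>D. ((\<lambda>s. F (z(i := s))) has_real_derivative D) (at (z i)) \<longrightarrow> D = 0))"
  have "\<exists>z. good x z"
    if x: "x \<in> X" for x
  proof -
    define box where "box = PiE UNIV (\<lambda>i. if i < m then {-R..R} else {0::real})"
    define cell where "cell = {y. \<forall>j\<in>J. p j y * p j x \<ge> 0}"
    have "compact box" unfolding box_def
      using compactin_PiE[of "\<lambda>_. euclidean" UNIV "\<lambda>i. if i < m then {-R..R} else {0::real}"]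
      by (auto simp: euclidean_product_topology)
    moreover have "closed cell"
    proof -
      have "closed {y. p j y * p j x \<ge> 0}" if "j \<in> J" for j
        using polyfun_continuous[OF p[OF that]]
        by (intro closed_Collect_le continuous_intros) auto
      moreover have "cell = (\<Inter>j\<in>J. {y. p j y * p j x \<ge> 0})" by (auto simp: cell_def)
      ultimately show ?thesis by auto
    qed
    ultimately have "compact (box \<inter> cell)" by (rule compact_Int_closed)
    define x0 where "x0 = (\<lambda>i. if i < m then x i else 0)"
    have x0: "x0 i = x i" if "i < m" for i using that by (simp add: x0_def)
    have px0: "p j x0 = p j x" if "j \<in> J" for j
      using polyfun_cong[OF p[OF that], of x0 x] x0 by simp
    have Fx0: "F x0 = F x"
      unfolding F_def q_def using polyfun_cong[OF pf, of x0 x] x0 by simp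
    have "x0 \<in> box \<inter> cell" using R(3)[OF x] px0
      by (auto simp: box_def cell_def x0_def abs_le_iff minus_le_iff)
    have pfq: "polyfun m (m * E) q" unfolding q_def
    proof (intro polyfun_sum)
      fix i assume "i \<in> {..<m}"
      have "polyfun m (card {..<E} * 1) (\<lambda>x. \<Prod>j\<in>{..<E}. x i)"
        using \<open>i \<in> {..<m}\<close> by (intro polyfun_prod polyfun_var) auto
      then have "polyfun m E (\<lambda>x. x i ^ E)" by simp
      then show "polyfun m (m * E) (\<lambda>x. x i ^ E)"
        by (rule polyfun_mono) (use \<open>i \<in> {..<m}\<close> in auto)
    qed
    have "continuous_on (box \<inter> cell) F" unfolding F_def
      using polyfun_continuous[OF pf] polyfun_continuous[OF pfq]
      by (intro continuous_intros) (auto intro: continuous_on_subset)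
    then obtain z where z: "z \<in> box \<inter> cell" "\<And>y. y \<in> box \<inter> cell \<Longrightarrow> F y \<le> F z"
      using continuous_attains_sup[OF \<open>compact (box \<inter> cell)\<close>] \<open>x0 \<in> box \<inter> cell\<close> by blast
    have "F z > 0" using z(2)[OF \<open>x0 \<in> box \<inter> cell\<close>] \<epsilon>(2)[OF x] Fx0 by (simp add: F_def)
    then have "f z > 0" using q0[of z] \<epsilon>(1)
      by (smt (verit) F_def mult_nonneg_nonneg)
    then have pz: "p j z \<noteq> 0" if "j \<in> J" for j
      using that J unfolding f_def by (metis (no_types, lifting) mult_zero_left prod_zero less_irrefl)
    have zsign: "p j z * p j x > 0" if "j \<in> J" for j
      using z(1) pz[OF that] nz[OF x that] that by (auto simp: cell_def less_le)
    have zR: "\<bar>z i\<bar> \<le> R" if "i < m" for i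
      using z(1) that by (auto simp: box_def PiE_iff abs_le_iff dest!: spec[of _ i])
    have z0: "z i = 0" if "m \<le> i" for i using z(1) that by (auto simp: box_def PiE_iff dest!: spec[of _ i])
    have zlt: "\<bar>z i\<bar> < R" if "i < m" for i
    proof (rule ccontr)
      assume "\<not> \<bar>z i\<bar> < R"
      then have "\<bar>z i\<bar> = R" using zR[OF that] by simp
      have "R ^ E = z i ^ E" using \<open>\<bar>z i\<bar> = R\<close> evenE by (metis power_even_abs)
      also have "\<dots> \<le> q z" unfolding q_def using that evenE
        by (intro member_le_sum) (auto simp: zero_le_even_power)
      finally have "\<epsilon> * R ^ E \<le> \<epsilon> * q z" using \<epsilon>(1) by simp
      moreover have "f z \<le> C * R ^ N" using C[OF R(1), of z] zR by fastforce
      moreover have "C * R ^ N < \<epsilon> * R ^ E"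
        using R by (simp add: E_def power_add power2_eq_square flip: mult.assoc)
      ultimately show False using \<open>F z > 0\<close> by (simp add: F_def)
    qed
    have "D = 0" if i: "i < m" and D: "((\<lambda>s. F (z(i := s))) has_real_derivative D) (at (z i))" for i D
    proof -
      have contj: "isCont (\<lambda>s. p j (z(i := s))) (z i)" if "j \<in> J" for j
        using polyfun_partial_derivative[OF p[OF that] i] DERIV_isCont by blast
      have "\<forall>\<^sub>F s in nhds (z i). p j (z(i := s)) * p j x > 0" if "j \<in> J" for j
      proof -
        have "isCont (\<lambda>s. p j (z(i := s)) * p j x) (z i)" using contj[OF that] by (intro continuous_intros)
        then have "((\<lambda>s. p j (z(i := s)) * p j x) \<longlongrightarrow> p j z * p j x) (at (z i))"
          by (simp add: isCont_def)
        then have "\<forall>\<^sub>F s in at (z i). p j (z(i := s)) * p j x > 0"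
          using zsign[OF that] by (rule order_tendstoD)
        then show ?thesis using zsign[OF that] by (simp add: eventually_nhds_conv_at)
      qed
      then have "\<forall>\<^sub>F s in nhds (z i). \<forall>j\<in>J. p j (z(i := s)) * p j x > 0"
        using J by (simp add: eventually_ball_finite)
      moreover have "\<forall>\<^sub>F s in nhds (z i). s \<in> {-R<..<R}"
        using zlt[OF i] by (intro eventually_nhds_in_open) auto
      ultimately have "\<forall>\<^sub>F s in nhds (z i). F (z(i := s)) \<le> F z"
      proof eventually_elim
        case (elim s)
        have "\<forall>j. (z(i := s)) j \<in> (if j < m then {-R..R} else {0})"
          using zR z0 i elim by (auto simp: abs_le_iff minus_le_iff)
        then have "z(i := s) \<in> box \<inter> cell" using elim
          by (auto simp: box_def cell_def PiE_iff less_imp_le)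
        then show ?case by (rule z(2))
      qed
      then obtain \<delta> where \<delta>: "\<delta> > 0" "\<And>s. dist s (z i) < \<delta> \<Longrightarrow> F (z(i := s)) \<le> F z"
        unfolding eventually_nhds_metric by blast
      show "D = 0"
        by (rule DERIV_local_max[OF D \<delta>(1)]) (use \<delta>(2) in \<open>auto simp: dist_real_def abs_minus_commute\<close>)
    qed
    moreover have "\<forall>j\<in>J. p j z \<noteq> 0 \<and> (p j z > 0 \<longleftrightarrow> p j x > 0)"
      using zsign by (force simp: zero_less_mult_iff)
    ultimately show ?thesis using z0 unfolding good_def by blast
  qed
  then obtain crit where "\<And>x. x \<in> X \<Longrightarrow> good x (crit x)"
    using bchoice[of X good] by blast
  then have crit: "\<And>x i. x \<in> X \<Longrightarrow> m \<le> i \<Longrightarrow> crit x i = 0"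
    "\<And>x j. x \<in> X \<Longrightarrow> j \<in> J \<Longrightarrow> p j (crit x) > 0 \<longleftrightarrow> p j x > 0"
    "\<And>x i D. x \<in> X \<Longrightarrow> i < m \<Longrightarrow> ((\<lambda>s. F ((crit x)(i := s))) has_real_derivative D) (at (crit x i)) \<Longrightarrow> D = 0"
    unfolding good_def by blast+
  have "inj_on crit X"
  proof (rule inj_onI)
    fix x y assume xy: "x \<in> X" "y \<in> X" "crit x = crit y"
    have "p j x > 0 \<longleftrightarrow> p j y > 0" if "j \<in> J" for j
      using crit(2)[OF xy(1) that] crit(2)[OF xy(2) that] xy(3) by simp
    then show "x = y" by (rule inj[OF xy(1,2)])
  qed
  obtain f' where f': "\<And>i. i < m \<Longrightarrow> polyfun m N (f' i)"
    "\<And>i x. i < m \<Longrightarrow> ((\<lambda>s. f (x(i := s))) has_real_derivative f' i x) (at (x i))"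
    using polyfun_partial_derivative[OF pf] by metis
  have critical: "z i ^ (N + 1) = 1 / (\<epsilon> * real E) * f' i z" if "z \<in> crit ` X" "i < m" for z i
  proof -
    have "((\<lambda>s. q (z(i := s))) has_real_derivative real E * z i ^ (E - 1)) (at (z i))"
    proof -
      have "q (z(i := s)) = s ^ E + (\<Sum>j\<in>{..<m} - {i}. z j ^ E)" for s
        unfolding q_def using that by (subst sum.remove[of _ i]) auto
      then show ?thesis by (auto intro!: derivative_eq_intros)
    qed
    then have "((\<lambda>s. F (z(i := s))) has_real_derivative f' i z - \<epsilon> * (real E * z i ^ (E - 1))) (at (z i))"
      unfolding F_def using f'(2)[OF that(2)] by (auto intro!: derivative_eq_intros)
    then have "f' i z - \<epsilon> * (real E * z i ^ (E - 1)) = 0"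
      using crit(3) that by blast
    moreover have "E - 1 = N + 1" "real E > 0" by (simp_all add: E_def)
    ultimately show ?thesis using \<epsilon>(1) by (simp add: field_simps)
  qed
  have "card (crit ` X) \<le> (N + 1) ^ m"
  proof (rule card_common_zeros_le[where h = "\<lambda>i x. 1 / (\<epsilon> * real E) * f' i x"])
    show "polyfun m (N + 1 - 1) (\<lambda>x. 1 / (\<epsilon> * real E) * f' i x)" if "i < m" for i
      using polyfun_scale[OF f'(1)[OF that], of "1 / (\<epsilon> * real E)"] by (simp only: add_diff_cancel_right')
    show "z i ^ (N + 1) = 1 / (\<epsilon> * real E) * f' i z" if "i < m" "z \<in> crit ` X" for i z
      using critical that by blast
  qed (use X crit(1) in auto)
  moreover have "N = 2 * card J * d" by (simp add: N_def)
  ultimately show ?thesis using card_image[OF \<open>inj_on crit X\<close>] by simp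
qed

text \<open>
  Signs in \<open>{-1, 0, 1}\<close> reduce to strict ones: if \<open>\<delta>\<close> is smaller than the nonzero \<open>\<bar>p j x\<bar>\<close> at
  the finitely many points, the strict signs of \<open>p j + \<delta>\<close> and \<open>p j - \<delta>\<close> determine the sign
  of \<open>p j\<close>.
\<close>

lemma card_sign_patterns_le:
  fixes p :: "'j \<Rightarrow> (nat \<Rightarrow> real) \<Rightarrow> real"
  assumes J: "finite J" and p: "\<And>j. j \<in> J \<Longrightarrow> polyfun m d (p j)"
    and X: "finite X"
    and inj: "\<And>x y. x \<in> X \<Longrightarrow> y \<in> X \<Longrightarrow> (\<And>j. j \<in> J \<Longrightarrow> sgn (p j x) = sgn (p j y)) \<Longrightarrow> x = y"
  shows "card X \<le> (4 * card J * d + 1) ^ m"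
proof -
  define V where "V = (\<lambda>(j, x). \<bar>p j x\<bar>) ` (J \<times> X) - {0}"
  define \<delta> where "\<delta> = Min (insert 1 V) / 2"
  have fV: "finite V" using J X by (auto simp: V_def)
  then have "Min (insert 1 V) > 0" by (subst Min_gr_iff) (auto simp: V_def)
  then have \<delta>: "\<delta> > 0" by (simp add: \<delta>_def)
  have small: "\<delta> < \<bar>p j x\<bar>" if "j \<in> J" "x \<in> X" "p j x \<noteq> 0" for j x
  proof -
    have "(\<lambda>(j, x). \<bar>p j x\<bar>) (j, x) \<in> V" unfolding V_def using that by force
    then have "Min (insert 1 V) \<le> \<bar>p j x\<bar>" using fV by (intro Min_le) auto
    then show ?thesis using \<open>Min (insert 1 V) > 0\<close> by (simp add: \<delta>_def)
  qed
  define p' where "p' = (\<lambda>(j, up) x. if up then p j x + \<delta> else p j x - \<delta>)"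
  have "card X \<le> (2 * card (J \<times> (UNIV :: bool set)) * d + 1) ^ m"
  proof (rule card_strict_sign_patterns_le[where p = p'])
    show "polyfun m d (p' j)" if "j \<in> J \<times> (UNIV :: bool set)" for j
      using that p by (cases j; cases "snd j") (auto simp: p'_def intro!: polyfun.add polyfun_diff polyfun_const)
    show "p' j x \<noteq> 0" if "x \<in> X" "j \<in> J \<times> (UNIV :: bool set)" for x j
      using that small[of "fst j" x] \<delta> by (cases j) (auto simp: p'_def split: if_splits)
    fix x y assume xy: "x \<in> X" "y \<in> X"
      and s: "\<And>j. j \<in> J \<times> (UNIV :: bool set) \<Longrightarrow> p' j x > 0 \<longleftrightarrow> p' j y > 0"
    show "x = y"
    proof (rule inj[OF xy])
      fix j assume j: "j \<in> J"
      have "p j x = 0 \<or> \<delta> < \<bar>p j x\<bar>" "p j y = 0 \<or> \<delta> < \<bar>p j y\<bar>"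
        using small[OF j] xy by blast+
      then show "sgn (p j x) = sgn (p j y)"
        using s[of "(j, True)"] s[of "(j, False)"] j \<delta>
        by (auto simp: p'_def sgn_real_def split: if_splits)
    qed
  qed (use J X in auto)
  then show ?thesis by (simp add: card_cartesian_product)
qed

section \<open>Affine geometry of polytopes\<close>

text \<open>
  Points are affine combinations here, also with \<open>t\<close> outside the unit interval, so that lines and rays
  are covered.
\<close>

definition lin :: "real \<Rightarrow> real vec \<Rightarrow> real vec \<Rightarrow> real vec" where
  "lin t p q = (1 - t) \<cdot>\<^sub>v p + t \<cdot>\<^sub>v q"

lemma lin_carrier [simp, intro]: "p \<in> carrier_vec n \<Longrightarrow> q \<in> carrier_vec n \<Longrightarrow> lin t p q \<in> carrier_vec n"
  by (auto simp: lin_def)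

lemma lin_index [simp]:
  "p \<in> carrier_vec n \<Longrightarrow> q \<in> carrier_vec n \<Longrightarrow> i < n \<Longrightarrow> lin t p q $ i = (1 - t) * p $ i + t * q $ i"
  by (auto simp: lin_def)

lemma lin_eqI:
  assumes "x \<in> carrier_vec n" "y \<in> carrier_vec n" "\<And>i. i < n \<Longrightarrow> x $ i = y $ i"
  shows "x = y"
  using assms by (intro eq_vecI) auto

lemma lin_0 [simp]: "p \<in> carrier_vec n \<Longrightarrow> q \<in> carrier_vec n \<Longrightarrow> lin 0 p q = p"
  and lin_1 [simp]: "p \<in> carrier_vec n \<Longrightarrow> q \<in> carrier_vec n \<Longrightarrow> lin 1 p q = q"
  and lin_same: "p \<in> carrier_vec n \<Longrightarrow> lin t p p = p"
  by (auto intro!: lin_eqI[of _ n] simp: algebra_simps)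

lemma lin_swap: "p \<in> carrier_vec n \<Longrightarrow> q \<in> carrier_vec n \<Longrightarrow> lin t q p = lin (1 - t) p q"
  by (rule lin_eqI[of _ n]) auto

lemma lin_lin:
  assumes "p \<in> carrier_vec n" "q \<in> carrier_vec n"
  shows "lin s (lin a p q) (lin b p q) = lin ((1 - s) * a + s * b) p q"
  using assms by (intro lin_eqI[of _ n]) (auto simp: lin_index[of _ n] algebra_simps)

lemma lin_inj:
  assumes "p \<in> carrier_vec n" "q \<in> carrier_vec n" "p \<noteq> q" "lin s p q = lin t p q"
  shows "s = t"
proof (rule ccontr)
  assume "s \<noteq> t"
  have "p $ i = q $ i" if "i < n" for i
  proof -
    have "(1 - s) * p $ i + s * q $ i = (1 - t) * p $ i + t * q $ i"
      using assms that by (metis lin_index)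
    then have "(s - t) * (q $ i - p $ i) = 0" by (simp add: algebra_simps)
    then show ?thesis using \<open>s \<noteq> t\<close> by simp
  qed
  then show False using assms lin_eqI by blast
qed

lemma seg_lin: "seg p q = {lin t p q | t. 0 \<le> t \<and> t \<le> 1}"
  by (simp add: seg_def lin_def)

lemma seg_carrier: "p \<in> carrier_vec n \<Longrightarrow> q \<in> carrier_vec n \<Longrightarrow> x \<in> seg p q \<Longrightarrow> x \<in> carrier_vec n"
  by (auto simp: seg_lin)

lemma seg_ends: "p \<in> carrier_vec n \<Longrightarrow> q \<in> carrier_vec n \<Longrightarrow> p \<in> seg p q \<and> q \<in> seg p q"
  unfolding seg_lin by (force intro: exI[of _ 0] exI[of _ 1])

lemma seg_sym:
  assumes "p \<in> carrier_vec n" "q \<in> carrier_vec n"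
  shows "seg p q = seg q p"
proof -
  have "seg x y \<subseteq> seg y x" if "x \<in> carrier_vec n" "y \<in> carrier_vec n" for x y
  proof
    fix z assume "z \<in> seg x y"
    then obtain t where "z = lin t x y" "0 \<le> t" "t \<le> 1" by (auto simp: seg_lin)
    moreover from this have "z = lin (1 - t) y x" using that by (simp add: lin_swap[of y n x])
    ultimately have "z = lin (1 - t) y x" "0 \<le> t" "t \<le> 1" by blast+
    then show "z \<in> seg y x" unfolding seg_lin by (intro CollectI exI[of _ "1 - t"]) auto
  qed
  then show ?thesis using assms by blast
qed

lemma open_seg_lin:
  assumes "p \<in> carrier_vec n" "q \<in> carrier_vec n" "p \<noteq> q"
  shows "x \<in> open_seg p q \<longleftrightarrow> (\<exists>t. 0 < t \<and> t < 1 \<and> x = lin t p q)" (is "?l \<longleftrightarrow> ?r")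
proof
  assume ?l
  then obtain t where t: "x = lin t p q" "0 \<le> t" "t \<le> 1" "x \<noteq> p" "x \<noteq> q"
    by (auto simp: open_seg_def seg_lin)
  then have "t \<noteq> 0" "t \<noteq> 1" using assms by auto
  with t show ?r by (intro exI[of _ t]) auto
next
  assume ?r
  then obtain t where t: "x = lin t p q" "0 < t" "t < 1" by blast
  have "x \<noteq> p" using lin_inj[OF assms, of t 0] t assms by auto
  moreover have "x \<noteq> q" using lin_inj[OF assms, of t 1] t assms by auto
  ultimately show ?l using t by (auto simp: open_seg_def seg_lin)
qed

lemma open_segD:
  assumes "p \<in> carrier_vec n" "q \<in> carrier_vec n" "x \<in> open_seg p q"
  obtains t where "0 < t" "t < 1" "x = lin t p q" "x \<noteq> p" "x \<noteq> q" "p \<noteq> q"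
proof -
  have "p \<noteq> q" using assms lin_same[of p n] by (auto simp: open_seg_def seg_lin)
  then obtain t where "0 < t" "t < 1" "x = lin t p q" using open_seg_lin assms by blast
  with \<open>p \<noteq> q\<close> assms(3) that show ?thesis by (auto simp: open_seg_def)
qed

definition affine_fun :: "nat \<Rightarrow> (real vec \<Rightarrow> real) \<Rightarrow> bool" where
  "affine_fun n f \<longleftrightarrow> (\<forall>p\<in>carrier_vec n. \<forall>q\<in>carrier_vec n. \<forall>t. f (lin t p q) = (1 - t) * f p + t * f q)"

lemma affine_funD:
  "affine_fun n f \<Longrightarrow> p \<in> carrier_vec n \<Longrightarrow> q \<in> carrier_vec n \<Longrightarrow> f (lin t p q) = (1 - t) * f p + t * f q"
  by (simp add: affine_fun_def)

lemma affine_fun_uminus: "affine_fun n f \<Longrightarrow> affine_fun n (\<lambda>x. - f x)"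
  by (simp add: affine_fun_def algebra_simps)

lemma affine_fun_const: "affine_fun n (\<lambda>x. k)"
  by (simp add: affine_fun_def algebra_simps)

lemma affine_fun_diff: "affine_fun n f \<Longrightarrow> affine_fun n g \<Longrightarrow> affine_fun n (\<lambda>x. f x - g x)"
  by (simp add: affine_fun_def algebra_simps)

lemma affine_fun_sum:
  assumes "\<And>f. f \<in> F \<Longrightarrow> affine_fun n f"
  shows "affine_fun n (\<lambda>x. \<Sum>f\<in>F. f x)"
  using assms
proof (induction F rule: infinite_finite_induct)
  case (insert f F)
  then show ?case by (simp add: affine_fun_def algebra_simps)
qed (auto simp: affine_fun_def)

lemma affine_fun_coord: "i < n \<Longrightarrow> affine_fun n (\<lambda>x. x $ i)"
  by (simp add: affine_fun_def)

lemma affine_fun_scalar_prod: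
  assumes "c \<in> carrier_vec n"
  shows "affine_fun n (\<lambda>x. c \<bullet> x)"
  using assms unfolding affine_fun_def lin_def
  by (auto simp: scalar_prod_add_distrib[of _ n])

text \<open>
  A polytope cut out by finitely many affine inequalities. Boundedness is used in the form that no ray
  stays inside. An equation is a pair of opposite inequalities.
\<close>

locale polytope =
  fixes n :: nat and \<Phi> :: "(real vec \<Rightarrow> real) set" and Q :: "real vec set"
  assumes fin: "finite \<Phi>" and aff: "\<And>\<phi>. \<phi> \<in> \<Phi> \<Longrightarrow> affine_fun n \<phi>"
    and Q_def: "Q = {x \<in> carrier_vec n. \<forall>\<phi>\<in>\<Phi>. \<phi> x \<ge> 0}"
    and no_ray: "\<And>p q. p \<in> Q \<Longrightarrow> q \<in> carrier_vec n \<Longrightarrow> p \<noteq> q \<Longrightarrow> \<exists>t\<ge>0. lin t p q \<notin> Q"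
begin


text \<open>
  The affine hull of the smallest face containing \<open>w\<close>: the constraints that are tight at \<open>w\<close> are made
  equations. A point with \<open>flat w = {w}\<close> is a basic solution in the sense of linear programming.
\<close>

definition flat :: "real vec \<Rightarrow> real vec set" where
  "flat w = {y \<in> carrier_vec n. \<forall>\<phi>\<in>\<Phi>. \<phi> w = 0 \<longrightarrow> \<phi> y = 0}"

lemma Q_carrier: "x \<in> Q \<Longrightarrow> x \<in> carrier_vec n"
  by (simp add: Q_def)

lemma flat_carrier: "x \<in> flat w \<Longrightarrow> x \<in> carrier_vec n"
  by (simp add: flat_def)

lemma self_in_flat: "w \<in> Q \<Longrightarrow> w \<in> flat w"
  by (simp add: flat_def Q_def)

lemma flat_subset: "y \<in> flat w \<Longrightarrow> flat y \<subseteq> flat w"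
  by (auto simp: flat_def)

lemma flat_lin: "x \<in> flat w \<Longrightarrow> y \<in> flat w \<Longrightarrow> lin t x y \<in> flat w"
  by (auto simp: flat_def affine_funD[OF aff])

lemma Q_convex: "x \<in> Q \<Longrightarrow> y \<in> Q \<Longrightarrow> 0 \<le> t \<Longrightarrow> t \<le> 1 \<Longrightarrow> lin t x y \<in> Q"
  by (auto simp: Q_def affine_funD[OF aff])

lemma open_seg_in_flat:
  assumes "p \<in> Q" "q \<in> Q" "w \<in> open_seg p q"
  shows "p \<in> flat w \<and> q \<in> flat w"
proof -
  have c: "p \<in> carrier_vec n" "q \<in> carrier_vec n" using assms Q_carrier by auto
  obtain t where t: "0 < t" "t < 1" "w = lin t p q" using open_segD[OF c assms(3)] by metis
  have "\<phi> p = 0 \<and> \<phi> q = 0" if "\<phi> \<in> \<Phi>" "\<phi> w = 0" for \<phi>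
  proof -
    have "\<phi> p \<ge> 0" "\<phi> q \<ge> 0" using assms that by (auto simp: Q_def)
    moreover have "(1 - t) * \<phi> p + t * \<phi> q = 0" using that t affine_funD[OF aff[OF that(1)] c] by simp
    ultimately show ?thesis using t
      by (simp add: add_nonneg_eq_0_iff)
  qed
  then show ?thesis using c by (auto simp: flat_def)
qed

text \<open>
  From \<open>x\<close> the polytope can be traversed in any direction of its flat until a further constraint
  becomes tight; this is the ratio test of the simplex method.
\<close>

lemma push:
  assumes x: "x \<in> Q" and y: "y \<in> flat x" "y \<noteq> x"
  obtains t where "t > 0" "lin t x y \<in> Q" "\<exists>\<phi>\<in>\<Phi>. \<phi> x \<noteq> 0 \<and> \<phi> (lin t x y) = 0"
proof -
  have c: "x \<in> carrier_vec n" "y \<in> carrier_vec n" using x y Q_carrier flat_carrier by auto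
  define \<Psi> where "\<Psi> = {\<phi> \<in> \<Phi>. \<phi> y < \<phi> x}"
  define T where "T = (\<lambda>\<phi> :: real vec \<Rightarrow> real. \<phi> x / (\<phi> x - \<phi> y))"
  have val: "\<phi> (lin t x y) = \<phi> x - t * (\<phi> x - \<phi> y)" if "\<phi> \<in> \<Phi>" for \<phi> t
    using affine_funD[OF aff[OF that] c] by (simp add: algebra_simps)
  have x0: "\<phi> x \<ge> 0" if "\<phi> \<in> \<Phi>" for \<phi> using x that by (auto simp: Q_def)
  have pos: "\<phi> x > 0" if "\<phi> \<in> \<Psi>" for \<phi>
    using that y(1) x0[of \<phi>] by (cases "\<phi> x = 0") (auto simp: \<Psi>_def flat_def)
  obtain t0 where t0: "t0 \<ge> 0" "lin t0 x y \<notin> Q" using no_ray[OF x c(2)] y(2) by blast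
  then obtain \<phi>0 where "\<phi>0 \<in> \<Phi>" "\<phi>0 (lin t0 x y) < 0" using c by (auto simp: Q_def not_le)
  with x0[of \<phi>0] t0 have "0 < t0 * (\<phi>0 x - \<phi>0 y)" by (simp add: val)
  then have "\<phi>0 \<in> \<Psi>" using \<open>\<phi>0 \<in> \<Phi>\<close> t0 by (simp add: \<Psi>_def zero_less_mult_iff)
  have f\<Psi>: "finite \<Psi>" using fin by (simp add: \<Psi>_def)
  define t where "t = Min (T ` \<Psi>)"
  have tle: "t \<le> T \<phi>" if "\<phi> \<in> \<Psi>" for \<phi> using that f\<Psi> by (simp add: t_def)
  have "t \<in> T ` \<Psi>" unfolding t_def using f\<Psi> \<open>\<phi>0 \<in> \<Psi>\<close> by (intro Min_in) auto
  then obtain \<phi>1 where \<phi>1: "\<phi>1 \<in> \<Psi>" "t = T \<phi>1" by blast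
  have "t > 0" using pos[OF \<phi>1(1)] \<phi>1 by (auto simp: T_def \<Psi>_def)
  moreover have "lin t x y \<in> Q"
  proof -
    have "\<phi> (lin t x y) \<ge> 0" if "\<phi> \<in> \<Phi>" for \<phi>
    proof (cases "\<phi> \<in> \<Psi>")
      case True
      then have "t * (\<phi> x - \<phi> y) \<le> \<phi> x"
        using tle[OF True] by (simp add: T_def \<Psi>_def pos_le_divide_eq)
      then show ?thesis using val[OF that] by simp
    next
      case False
      then have "\<phi> x \<le> \<phi> y" using that by (simp add: \<Psi>_def)
      then have "t * (\<phi> x - \<phi> y) \<le> 0" using \<open>t > 0\<close> by (simp add: mult_le_0_iff)
      then show ?thesis using val[OF that] x0[OF that] by simp
    qed
    then show ?thesis using c by (auto simp: Q_def)
  qed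
  moreover have "\<phi>1 (lin t x y) = 0" "\<phi>1 x \<noteq> 0" "\<phi>1 \<in> \<Phi>"
    using \<phi>1 pos[OF \<phi>1(1)] by (auto simp: val \<Psi>_def T_def)
  ultimately show ?thesis using that by blast
qed

text \<open>
  As long as the flat of \<open>x\<close> contains a second point, \<open>x\<close> can be pushed without decreasing \<open>c\<close>, and the
  number of constraints that are not tight decreases. Together with \<open>finite_basic\<close> this shows that
  affine functionals attain their maximum.
\<close>

lemma purify:
  assumes "affine_fun n c" "x \<in> Q"
  shows "\<exists>w\<in>Q. flat w = {w} \<and> w \<in> flat x \<and> c w \<ge> c x"
  using assms(2)
proof (induction "card {\<phi> \<in> \<Phi>. \<phi> x \<noteq> 0}" arbitrary: x rule: less_induct)
  case less
  show ?case
  proof (cases "flat x = {x}")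
    case True
    then show ?thesis using less self_in_flat by blast
  next
    case False
    have xc: "x \<in> carrier_vec n" using less Q_carrier by blast
    from False obtain y0 where y0: "y0 \<in> flat x" "y0 \<noteq> x" using self_in_flat[OF less.prems] by blast
    have y0c: "y0 \<in> carrier_vec n" using y0 flat_carrier by blast
    define y where "y = (if c x \<le> c y0 then y0 else lin (-1) x y0)"
    have "y \<in> flat x" using y0 flat_lin self_in_flat[OF less.prems] by (simp add: y_def)
    moreover have "y \<noteq> x"
      using y0 lin_inj[OF xc y0c _, of "-1" 0] xc y0c by (auto simp: y_def)
    moreover have cy: "c x \<le> c y" using affine_funD[OF assms(1) xc y0c, of "-1"] by (simp add: y_def)
    ultimately obtain t where t: "t > 0" "lin t x y \<in> Q" "\<exists>\<phi>\<in>\<Phi>. \<phi> x \<noteq> 0 \<and> \<phi> (lin t x y) = 0"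
      using push[OF less.prems] by blast
    have yc: "y \<in> carrier_vec n" using \<open>y \<in> flat x\<close> flat_carrier by blast
    have tf: "lin t x y \<in> flat x" using flat_lin self_in_flat[OF less.prems] \<open>y \<in> flat x\<close> by blast
    have "card {\<phi> \<in> \<Phi>. \<phi> (lin t x y) \<noteq> 0} < card {\<phi> \<in> \<Phi>. \<phi> x \<noteq> 0}"
      using fin t(3) tf by (intro psubset_card_mono) (auto simp: flat_def)
    from less.hyps[OF this t(2)] obtain w where w: "w \<in> Q" "flat w = {w}" "w \<in> flat (lin t x y)"
      "c (lin t x y) \<le> c w" by blast
    have "c (lin t x y) = c x + t * (c y - c x)"
      using affine_funD[OF assms(1) xc yc] by (simp add: algebra_simps)
    moreover have "t * (c y - c x) \<ge> 0" using cy t(1) by simp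
    ultimately have "c x \<le> c w" using w(4) by simp
    then show ?thesis using w(1,2) subsetD[OF flat_subset[OF tf] w(3)] by blast
  qed
qed

lemma finite_basic: "finite {w \<in> Q. flat w = {w}}"
proof (rule inj_on_finite)
  show "inj_on (\<lambda>w. {\<phi> \<in> \<Phi>. \<phi> w = 0}) {w \<in> Q. flat w = {w}}"
  proof (rule inj_onI)
    fix v w assume *: "v \<in> {w \<in> Q. flat w = {w}}" "w \<in> {w \<in> Q. flat w = {w}}"
      "{\<phi> \<in> \<Phi>. \<phi> v = 0} = {\<phi> \<in> \<Phi>. \<phi> w = 0}"
    then have "w \<in> flat v" using Q_carrier by (auto simp: flat_def)
    then show "v = w" using * by auto
  qed
  show "(\<lambda>w. {\<phi> \<in> \<Phi>. \<phi> w = 0}) ` {w \<in> Q. flat w = {w}} \<subseteq> Pow \<Phi>" by auto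
qed (use fin in auto)

lemma basic_imp_vertex:
  assumes "w \<in> Q" "flat w = {w}"
  shows "vertex_of w Q"
  unfolding vertex_of_def
proof (intro conjI ballI notI)
  fix p q assume "p \<in> Q" "q \<in> Q" "w \<in> open_seg p q"
  then show False using open_seg_in_flat[of p q w] assms by (auto simp: open_seg_def)
qed fact

lemma vertex_imp_basic:
  assumes "vertex_of w Q"
  shows "flat w = {w}"
proof (rule ccontr)
  assume "flat w \<noteq> {w}"
  have w: "w \<in> Q" using assms by (simp add: vertex_of_def)
  then have wc: "w \<in> carrier_vec n" by (rule Q_carrier)
  obtain y where y: "y \<in> flat w" "y \<noteq> w" using self_in_flat[OF w] \<open>flat w \<noteq> {w}\<close> by blast
  have yc: "y \<in> carrier_vec n" using y flat_carrier by blast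
  obtain t where t: "t > 0" "lin t w y \<in> Q" using push[OF w y] by blast
  have "lin (-1) w y \<in> flat w" "lin (-1) w y \<noteq> w"
    using y flat_lin[OF self_in_flat[OF w]] lin_inj[OF wc yc, of "-1" 0] wc yc by auto
  then obtain s where s: "s > 0" "lin s w (lin (-1) w y) \<in> Q" using push[OF w] by blast
  have eq: "lin s w (lin (-1) w y) = lin (- s) w y"
    using lin_lin[OF wc yc, of s 0 "-1"] wc yc by simp
  have "w = lin (s / (s + t)) (lin (- s) w y) (lin t w y)"
    unfolding lin_lin[OF wc yc] using s t wc yc lin_0[OF wc yc] by (simp add: field_simps)
  moreover have "lin (- s) w y \<noteq> lin t w y" using lin_inj[OF wc yc, of "-s" t] y s t by auto
  moreover have "0 < s / (s + t)" "s / (s + t) < 1" using s t by auto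
  ultimately have "w \<in> open_seg (lin (- s) w y) (lin t w y)"
    using open_seg_lin[of "lin (- s) w y" n "lin t w y" w] wc yc by blast
  then show False using assms s t eq by (auto simp: vertex_of_def)
qed

lemma vertex_iff: "vertex_of w Q \<longleftrightarrow> w \<in> Q \<and> flat w = {w}"
  using basic_imp_vertex vertex_imp_basic by (auto simp: vertex_of_def)

text \<open>
  A section with a hyperplane is a polytope again, so that all facts about polytopes apply to it.
\<close>

lemma section_polytope:
  assumes "affine_fun n K"
  shows "polytope n (insert K (insert (\<lambda>x. - K x) \<Phi>)) (Q \<inter> {x. K x = 0})"
proof
  show "Q \<inter> {x. K x = 0} =
      {x \<in> carrier_vec n. \<forall>\<phi>\<in>insert K (insert (\<lambda>x. - K x) \<Phi>). 0 \<le> \<phi> x}"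
    by (auto simp: Q_def)
  show "\<exists>t\<ge>0. lin t p q \<notin> Q \<inter> {x. K x = 0}"
    if "p \<in> Q \<inter> {x. K x = 0}" "q \<in> carrier_vec n" "p \<noteq> q" for p q
    using no_ray[of p q] that by blast
qed (use fin aff assms affine_fun_uminus in auto)

lemma section_flat:
  assumes "affine_fun n K" "K w = 0"
  shows "polytope.flat n (insert K (insert (\<lambda>x. - K x) \<Phi>)) w = flat w \<inter> {x. K x = 0}"
  using assms unfolding polytope.flat_def[OF section_polytope[OF assms(1)]] flat_def by auto

text \<open>
  If a hyperplane meets the flat of \<open>w\<close> only in \<open>w\<close>, the flat is at most a line. When it is a line,
  \<open>K\<close> is a coordinate on it, and the part inside the polytope is an edge whose ends are found by
  maximizing and minimizing \<open>K\<close>.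
\<close>

lemma edge_through:
  assumes K: "affine_fun n K" and w: "w \<in> Q" "K w = 0"
    and iso: "flat w \<inter> {x. K x = 0} = {w}" and nb: "flat w \<noteq> {w}"
  obtains p q where "vertex_of p Q" "vertex_of q Q" "K p < 0" "0 < K q" "seg p q \<in> edges Q" "w \<in> seg p q"
proof -
  have uniq: "x = y" if "x \<in> flat w" "y \<in> flat w" "K x = K y" for x y
  proof -
    have c: "x \<in> carrier_vec n" "y \<in> carrier_vec n" "w \<in> carrier_vec n"
      using that w flat_carrier Q_carrier by auto
    (* This is the point w + y - x of the flat, on which K vanishes. *)
    let ?z = "lin 2 x (lin (1/2) w y)"
    have "?z \<in> flat w" using that flat_lin self_in_flat[OF w(1)] by blast
    moreover have "K ?z = 0" using c w that by (simp add: affine_funD[OF K, of _ _])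
    ultimately have "?z = w" using iso by blast
    have "x $ i = y $ i" if "i < n" for i
    proof -
      have "?z $ i = (1 - 2) * x $ i + 2 * ((1 - 1/2) * w $ i + 1/2 * y $ i)"
        using c that by (simp only: lin_index[of _ n] lin_carrier)
      then show ?thesis using \<open>?z = w\<close> by simp
    qed
    then show ?thesis using c lin_eqI by blast
  qed
  obtain q where q: "q \<in> Q" "flat q = {q}" "q \<in> flat w" "K q \<ge> K w"
    using purify[OF K w(1)] by blast
  obtain p where p: "p \<in> Q" "flat p = {p}" "p \<in> flat w" "- K p \<ge> - K w"
    using purify[OF affine_fun_uminus[OF K] w(1)] by blast
  have "q \<noteq> w" "p \<noteq> w" using nb p q by auto
  then have Kq: "0 < K q" and Kp: "K p < 0"
    using uniq[OF q(3) self_in_flat[OF w(1)]] uniq[OF p(3) self_in_flat[OF w(1)]] p q w by force+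
  have vp: "vertex_of p Q" "vertex_of q Q" using p q basic_imp_vertex by auto
  have pc: "p \<in> carrier_vec n" "q \<in> carrier_vec n" using p q Q_carrier by auto
  have pq: "p \<noteq> q" using Kp Kq by auto
  have face: "flat w \<inter> Q \<subseteq> seg p q"
  proof
    fix x assume x: "x \<in> flat w \<inter> Q"
    have xc: "x \<in> carrier_vec n" using x Q_carrier by auto
    define s where "s = (K x - K p) / (K q - K p)"
    have "lin s p q \<in> flat w" using p q flat_lin by auto
    moreover have "K (lin s p q) = K x"
    proof -
      have "K (lin s p q) = K p + s * (K q - K p)"
        using affine_funD[OF K pc] by (simp add: algebra_simps)
      then show ?thesis using Kp Kq by (simp add: s_def)
    qed
    ultimately have xs: "x = lin s p q" using uniq[of x "lin s p q"] x by simp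
    have "s \<le> 1"
    proof (rule ccontr)
      assume "\<not> s \<le> 1"
      have "q = lin (1 / s) p x"
      proof -
        have "lin (1 / s) (lin 0 p q) (lin s p q) = lin 1 p q"
          unfolding lin_lin[OF pc] using \<open>\<not> s \<le> 1\<close> by simp
        then show ?thesis using xs pc by simp
      qed
      moreover have "p \<noteq> x" using xs lin_inj[OF pc pq, of s 0] pc \<open>\<not> s \<le> 1\<close> by auto
      ultimately have "q \<in> open_seg p x"
        using open_seg_lin[OF pc(1) xc] \<open>\<not> s \<le> 1\<close> by (auto intro!: exI[of _ "1 / s"])
      then show False using vp p x by (auto simp: vertex_of_def)
    qed
    moreover have "0 \<le> s"
    proof (rule ccontr)
      assume "\<not> 0 \<le> s"
      have "p = lin (1 / (1 - s)) q x"
      proof -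
        have "lin (1 / (1 - s)) (lin 1 p q) (lin s p q) = lin 0 p q"
          unfolding lin_lin[OF pc] using \<open>\<not> 0 \<le> s\<close> by (simp add: field_simps)
        then show ?thesis using xs pc by simp
      qed
      moreover have "q \<noteq> x" using xs lin_inj[OF pc pq, of s 1] pc \<open>\<not> 0 \<le> s\<close> by auto
      ultimately have "p \<in> open_seg q x"
        using open_seg_lin[OF pc(2) xc] \<open>\<not> 0 \<le> s\<close> by (auto intro!: exI[of _ "1 / (1 - s)"])
      then show False using vp q x by (auto simp: vertex_of_def)
    qed
    ultimately show "x \<in> seg p q" using xs by (auto simp: seg_lin)
  qed
  have sub: "seg p q \<subseteq> flat w \<inter> Q"
    using p q flat_lin Q_convex by (auto simp: seg_lin)
  have "seg p q \<in> edges Q"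
    unfolding edges_def
  proof (intro CollectI conjI ballI impI)
    show "\<exists>p' q'. p' \<noteq> q' \<and> seg p q = seg p' q'" using pq by blast
    show "seg p q \<subseteq> Q" using sub by blast
    fix r s x assume *: "r \<in> Q" "s \<in> Q" "x \<in> seg p q" "x \<in> open_seg r s"
    then have "r \<in> flat x" "s \<in> flat x" using open_seg_in_flat by blast+
    then show "r \<in> seg p q" "s \<in> seg p q" using * sub flat_subset face by blast+
  qed
  moreover have "w \<in> seg p q" using face w self_in_flat by blast
  ultimately show ?thesis using that vp Kp Kq by blast
qed

lemma exists_section_basic:
  assumes K: "affine_fun n K" and c: "affine_fun n c" and x: "x \<in> Q" "K x = 0"
  obtains w where "w \<in> Q" "K w = 0" "flat w \<inter> {x. K x = 0} = {w}" "c x \<le> c w"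
proof -
  interpret S: polytope n "insert K (insert (\<lambda>x. - K x) \<Phi>)" "Q \<inter> {x. K x = 0}"
    by (rule section_polytope[OF K])
  obtain w where "w \<in> Q" "K w = 0" "S.flat w = {w}" "c x \<le> c w" using S.purify[OF c, of x] x by blast
  then show ?thesis using that section_flat[OF K] by auto
qed

text \<open>
  The vertex figure. The sum \<open>h\<close> of the constraints that are tight at \<open>w\<close> vanishes on \<open>Q\<close> in \<open>w\<close> only. A section
  with a level of \<open>h\<close> that separates \<open>w\<close> from all other vertices has a vertex, and this lies on an edge
  that ends in \<open>w\<close>.
\<close>

lemma edge_at_vertex:
  assumes w: "vertex_of w Q" and y: "y \<in> Q" "y \<noteq> w"
  obtains q where "vertex_of q Q" "w \<noteq> q" "seg w q \<in> edges Q"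
proof -
  have wQ: "w \<in> Q" and bw: "flat w = {w}" using w vertex_iff by auto
  define T where "T = {\<phi> \<in> \<Phi>. \<phi> w = 0}"
  define h where "h = (\<lambda>x. \<Sum>\<phi>\<in>T. \<phi> x)"
  have h: "affine_fun n h" unfolding h_def using aff by (intro affine_fun_sum) (auto simp: T_def)
  have hw: "h w = 0" by (simp add: h_def T_def)
  have hpos: "h x > 0" if "x \<in> Q" "x \<noteq> w" for x
  proof -
    have nn: "\<phi> x \<ge> 0" if "\<phi> \<in> T" for \<phi> using that \<open>x \<in> Q\<close> by (auto simp: T_def Q_def)
    have "h x \<noteq> 0"
    proof
      assume "h x = 0"
      then have "\<forall>\<phi>\<in>T. \<phi> x = 0" unfolding h_def
        using nn fin by (subst (asm) sum_nonneg_eq_0_iff) (auto simp: T_def)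
      then have "x \<in> flat w" using that Q_carrier by (auto simp: flat_def T_def)
      then show False using bw that by auto
    qed
    moreover have "h x \<ge> 0" unfolding h_def using nn by (intro sum_nonneg) auto
    ultimately show ?thesis by simp
  qed
  define \<eta> where "\<eta> = Min (insert (h y) (h ` ({v \<in> Q. flat v = {v}} - {w})))"
  have \<eta>: "\<eta> > 0" "\<eta> \<le> h y" "\<And>v. v \<in> Q \<Longrightarrow> flat v = {v} \<Longrightarrow> v \<noteq> w \<Longrightarrow> \<eta> \<le> h v"
    unfolding \<eta>_def using finite_basic hpos y
    by (auto simp: Min_gr_iff intro!: Min_le)
  define K where "K = (\<lambda>x. h x - \<eta> / 2)"
  have K: "affine_fun n K" unfolding K_def using h by (intro affine_fun_diff affine_fun_const)
  define t where "t = \<eta> / 2 / h y"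
  have t: "0 \<le> t" "t \<le> 1" using \<eta> hpos[OF y] by (auto simp: t_def)
  have "lin t w y \<in> Q" using Q_convex wQ y t by blast
  moreover have "K (lin t w y) = 0"
    using affine_funD[OF h Q_carrier[OF wQ] Q_carrier[OF y(1)]] hpos[OF y] hw by (simp add: K_def t_def)
  ultimately obtain v where v: "v \<in> Q" "K v = 0" "flat v \<inter> {x. K x = 0} = {v}"
    using exists_section_basic[OF K K] by blast
  have "flat v \<noteq> {v}"
  proof
    assume "flat v = {v}"
    moreover have "v \<noteq> w" using v hw \<eta> by (auto simp: K_def)
    ultimately show False using \<eta>(1) \<eta>(3)[of v] v by (simp add: K_def)
  qed
  then obtain p q where pq: "vertex_of p Q" "vertex_of q Q" "K p < 0" "0 < K q" "seg p q \<in> edges Q"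
    using edge_through[OF K v(1-3)] by metis
  have "p = w" using \<eta>(1) \<eta>(3)[of p] pq(1,3) by (force simp: vertex_iff K_def)
  moreover have "p \<noteq> q" using pq by auto
  ultimately show ?thesis using that pq by blast
qed

text \<open>
  When the cut \<open>G \<ge> 0\<close> removes an optimum \<open>z\<close>, walking from any point that is kept towards \<open>z\<close> does not
  decrease the objective until the hyperplane \<open>G = 0\<close> is met. So the new optimum is attained in that
  hyperplane, at a vertex of the section, and such a vertex lies on an edge of the polytope.
\<close>

lemma optimum_on_edge:
  assumes G: "affine_fun n G" and c: "affine_fun n c"
    and o: "z \<in> Q" "\<And>x. x \<in> Q \<Longrightarrow> c x \<le> c z" "G z < 0"
    and feas: "x0 \<in> Q" "0 \<le> G x0"
  obtains w p q where "vertex_of p Q" "vertex_of q Q" "p \<noteq> q" "seg p q \<in> edges Q" "w \<in> seg p q"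
    "w \<in> Q" "G w = 0" "\<And>x. x \<in> Q \<Longrightarrow> 0 \<le> G x \<Longrightarrow> c x \<le> c w" 
    "(w = p \<or> w = q) \<or> (G p < 0 \<and> 0 < G q)"
proof -
  define B where "B = {w \<in> Q. G w = 0 \<and> flat w \<inter> {x. G x = 0} = {w}}"
  interpret S: polytope n "insert G (insert (\<lambda>x. - G x) \<Phi>)" "Q \<inter> {x. G x = 0}"
    by (rule section_polytope[OF G])
  have "B = {w \<in> Q \<inter> {x. G x = 0}. S.flat w = {w}}" using section_flat[OF G] by (auto simp: B_def)
  then have fB: "finite B" using S.finite_basic by simp
  have reach: "\<exists>w\<in>B. c x \<le> c w" if x: "x \<in> Q" "0 \<le> G x" for x
  proof -
    have cr: "x \<in> carrier_vec n" "z \<in> carrier_vec n" using x o Q_carrier by auto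
    define t where "t = G x / (G x - G z)"
    have t: "0 \<le> t" "t \<le> 1" using x o(3) by (auto simp: t_def)
    have "G (lin t x z) = G x - t * (G x - G z)"
      using affine_funD[OF G cr] by (simp add: algebra_simps)
    then have G0: "G (lin t x z) = 0" using x o(3) by (simp add: t_def)
    have "lin t x z \<in> Q" using Q_convex x o t by blast
    from exists_section_basic[OF G c this G0] obtain w where "w \<in> B" "c (lin t x z) \<le> c w"
      unfolding B_def by blast
    moreover have "c x \<le> c (lin t x z)"
    proof -
      have "c (lin t x z) = c x + t * (c z - c x)"
        using affine_funD[OF c cr] by (simp add: algebra_simps)
      moreover have "t * (c z - c x) \<ge> 0" using t o(2)[OF x(1)] by simp
      ultimately show ?thesis by simp
    qed
    ultimately show ?thesis using order_trans by blast
  qed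
  have "B \<noteq> {}" using reach[OF feas] by blast
  have "Max (c ` B) \<in> c ` B" using fB \<open>B \<noteq> {}\<close> by (intro Max_in) auto
  then obtain w where w: "w \<in> B" "c w = Max (c ` B)" by auto
  have wmax: "c x \<le> c w" if x: "x \<in> Q" "0 \<le> G x" for x
  proof -
    obtain w' where w': "w' \<in> B" "c x \<le> c w'" using reach[OF x] by blast
    have "c w' \<le> Max (c ` B)" using w' fB by (intro Max_ge) auto
    then show ?thesis using w' w by simp
  qed
  have wQ: "w \<in> Q" "G w = 0" "flat w \<inter> {x. G x = 0} = {w}" using w by (auto simp: B_def)
  show ?thesis
  proof (cases "flat w = {w}")
    case True
    then have v: "vertex_of w Q" using basic_imp_vertex wQ by blast
    have "z \<noteq> w" using wQ o by auto
    then obtain q where q: "vertex_of q Q" "w \<noteq> q" "seg w q \<in> edges Q" using edge_at_vertex[OF v o(1)] by blast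
    have "w \<in> carrier_vec n" "q \<in> carrier_vec n" using wQ q(1) Q_carrier by (auto simp: vertex_of_def)
    then have "w \<in> seg w q" using seg_ends by blast
    then show ?thesis using that[OF v q(1,2,3)] wQ wmax by blast
  next
    case False
    then obtain p q where "vertex_of p Q" "vertex_of q Q" "G p < 0" "0 < G q" "seg p q \<in> edges Q" "w \<in> seg p q"
      using edge_through[OF G wQ] by metis
    moreover from this have "p \<noteq> q" by auto
    ultimately show ?thesis using that wQ wmax by metis
  qed
qed

end

section \<open>Node polytopes\<close>

text \<open>
  Entries outside the dimension are unspecified, but the same for all vectors of one dimension. Hence
  also branching constraints on nonexistent variables are affine.
\<close>

lemma index_outside:
  "x \<in> carrier_vec n \<Longrightarrow> y \<in> carrier_vec n \<Longrightarrow> n \<le> i \<Longrightarrow> x $ i = y $ i"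
  unfolding carrier_vec_def by (auto, transfer) (auto simp: mk_vec_def)

lemma affine_fun_index: "affine_fun n (\<lambda>x. x $ i)"
proof (cases "i < n")
  case False
  have "lin t p q $ i = (1 - t) * p $ i + t * q $ i" if "p \<in> carrier_vec n" "q \<in> carrier_vec n" for p q t
    using index_outside[of "lin t p q" n p i] index_outside[of q n p i] that False
    by (simp add: algebra_simps)
  then show ?thesis by (simp add: affine_fun_def)
qed (rule affine_fun_coord)

fun slack :: "branching \<Rightarrow> real vec \<Rightarrow> real" where
  "slack (Le i k) x = real_of_int k - x $ i"
| "slack (Ge i k) x = x $ i - real_of_int k"

lemma satisfies_slack: "satisfies x \<beta> \<longleftrightarrow> 0 \<le> slack \<beta> x"
  by (cases \<beta>) auto

lemma affine_fun_slack: "affine_fun n (slack \<beta>)"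
proof -
  have "affine_fun n (\<lambda>x. slack \<beta> x)"
    by (cases \<beta>) (auto intro!: affine_fun_diff affine_fun_const affine_fun_index)
  then show ?thesis .
qed

definition node_constraints :: "ip \<Rightarrow> branching set \<Rightarrow> (real vec \<Rightarrow> real) set" where
  "node_constraints P \<sigma> =
     (\<lambda>r x. row (rmat P) r \<bullet> x - rrhs P $ r) ` {..<dim_row (cmat P)} \<union>
     (\<lambda>r x. rrhs P $ r - row (rmat P) r \<bullet> x) ` {..<dim_row (cmat P)} \<union>
     (\<lambda>i x. x $ i) ` {..<num_vars P} \<union> slack ` \<sigma>"

text \<open>
  The vertices of all conceivable nodes at once. Only these points enter the sign conditions,
  which is essential as the number of sets of branching constraints is exponential in \<open>\<tau>\<close>.
\<close>

definition node_vertices :: "ip \<Rightarrow> real vec set" where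
  "node_vertices P = {w. \<exists>\<sigma>. finite \<sigma> \<and> vertex_of w (node_region P \<sigma>)}"

locale bounded_ip =
  fixes P :: ip and m n :: nat
  assumes obj: "obj P \<in> carrier_vec n" and cmat: "cmat P \<in> carrier_mat m n"
    and rhs: "rhs P \<in> carrier_vec m" and bdd: "bdd_above (linf_norm ` lp_region P)"
begin

lemma num_vars [simp]: "num_vars P = n"
  using cmat by (simp add: num_vars_def)

lemma rmat: "rmat P \<in> carrier_mat m n" and rrhs: "rrhs P \<in> carrier_vec m"
  using cmat rhs by (auto simp: rmat_def rrhs_def)

lemma node_region_carrier: "x \<in> node_region P \<sigma> \<Longrightarrow> x \<in> carrier_vec n"
  by (simp add: node_region_def lp_region_def)

lemma node_region_constraints:
  "node_region P \<sigma> = {x \<in> carrier_vec n. \<forall>\<phi>\<in>node_constraints P \<sigma>. 0 \<le> \<phi> x}"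
proof -
  have "rmat P *\<^sub>v x = rrhs P \<longleftrightarrow>
      (\<forall>r<m. 0 \<le> row (rmat P) r \<bullet> x - rrhs P $ r) \<and> (\<forall>r<m. 0 \<le> rrhs P $ r - row (rmat P) r \<bullet> x)" for x
  proof -
    have "rmat P *\<^sub>v x = rrhs P \<longleftrightarrow> (\<forall>r<m. row (rmat P) r \<bullet> x = rrhs P $ r)"
      using rmat rrhs by (auto simp: vec_eq_iff)
    then show ?thesis by (auto simp: order_antisym)
  qed
  moreover have "(\<forall>\<phi>\<in>node_constraints P \<sigma>. 0 \<le> \<phi> x) \<longleftrightarrow>
      (\<forall>r<m. 0 \<le> row (rmat P) r \<bullet> x - rrhs P $ r) \<and> (\<forall>r<m. 0 \<le> rrhs P $ r - row (rmat P) r \<bullet> x) \<and>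
      (\<forall>i<n. 0 \<le> x $ i) \<and> (\<forall>\<beta>\<in>\<sigma>. 0 \<le> slack \<beta> x)" for x
    using cmat unfolding node_constraints_def ball_Un by auto
  ultimately show ?thesis
    by (auto simp: node_region_def lp_region_def satisfies_slack)
qed

lemma linf_norm_ge:
  assumes "x \<in> carrier_vec n" "i < n"
  shows "\<bar>x $ i\<bar> \<le> linf_norm x"
  unfolding linf_norm_def
proof (rule Max_ge)
  have "{\<bar>x $ i\<bar> |i. i < dim_vec x} = (\<lambda>i. \<bar>x $ i\<bar>) ` {..<n}" using assms by auto
  then show "finite {\<bar>x $ i\<bar> |i. i < dim_vec x}" by simp
qed (use assms in auto)

lemma polytope_node_region:
  assumes "finite \<sigma>"
  shows "polytope n (node_constraints P \<sigma>) (node_region P \<sigma>)"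
proof
  show "finite (node_constraints P \<sigma>)" using assms by (simp add: node_constraints_def)
  show "affine_fun n \<phi>" if "\<phi> \<in> node_constraints P \<sigma>" for \<phi>
  proof -
    have row: "row (rmat P) r \<in> carrier_vec n" for r using rmat by auto
    show ?thesis using that unfolding node_constraints_def
      by (auto intro!: affine_fun_diff affine_fun_const affine_fun_scalar_prod row affine_fun_index affine_fun_slack)
  qed
  show "node_region P \<sigma> = {x \<in> carrier_vec n. \<forall>\<phi>\<in>node_constraints P \<sigma>. 0 \<le> \<phi> x}"
    by (rule node_region_constraints)
  fix p q assume p: "p \<in> node_region P \<sigma>" and q: "q \<in> carrier_vec n" and "p \<noteq> q"
  have pc: "p \<in> carrier_vec n" using p node_region_carrier by blast
  obtain i where i: "i < n" "p $ i \<noteq> q $ i" using lin_eqI[OF pc q] \<open>p \<noteq> q\<close> by blast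
  obtain B where B: "\<And>x. x \<in> lp_region P \<Longrightarrow> linf_norm x \<le> B"
    using bdd by (auto simp: bdd_above_def)
  have "0 \<le> \<bar>p $ i\<bar>" "\<bar>p $ i\<bar> \<le> B"
    using B[of p] p linf_norm_ge[OF pc i(1)] by (auto simp: node_region_def)
  define t where "t = (B + \<bar>p $ i\<bar> + 1) / \<bar>q $ i - p $ i\<bar>"
  have t0: "t \<ge> 0" using \<open>0 \<le> \<bar>p $ i\<bar>\<close> \<open>\<bar>p $ i\<bar> \<le> B\<close> by (simp add: t_def)
  have "lin t p q \<notin> node_region P \<sigma>"
  proof
    assume "lin t p q \<in> node_region P \<sigma>"
    then have "linf_norm (lin t p q) \<le> B" using B by (simp add: node_region_def)
    then have "\<bar>lin t p q $ i\<bar> \<le> B" using linf_norm_ge[of "lin t p q" i] pc q i by fastforce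
    moreover have "lin t p q $ i = p $ i + t * (q $ i - p $ i)"
      using pc q i by (simp add: algebra_simps)
    moreover have "\<bar>t * (q $ i - p $ i)\<bar> = B + \<bar>p $ i\<bar> + 1"
      using i t0 by (simp add: abs_mult) (simp add: t_def)
    ultimately show False by linarith
  qed
  with t0 show "\<exists>t\<ge>0. lin t p q \<notin> node_region P \<sigma>" by blast
qed

lemma node_vertices_lp: "w \<in> node_vertices P \<Longrightarrow> w \<in> lp_region P"
  by (auto simp: node_vertices_def vertex_of_def node_region_def)

lemma node_vertices_carrier: "w \<in> node_vertices P \<Longrightarrow> w \<in> carrier_vec n"
  using node_vertices_lp by (auto simp: lp_region_def)

lemma lp_region_coord_le:
  assumes "lp_radius P \<le> int \<tau>" "x \<in> lp_region P" "i < n"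
  shows "0 \<le> x $ i" "x $ i \<le> real \<tau>"
proof -
  show "0 \<le> x $ i" using assms by (simp add: lp_region_def)
  have "x $ i \<le> linf_norm x" using linf_norm_ge[of x i] assms by (simp add: lp_region_def)
  also have "\<dots> \<le> (SUP x\<in>lp_region P. linf_norm x)" using bdd assms by (intro cSUP_upper) auto
  also have "\<dots> \<le> real \<tau>" using assms(1) by (simp add: lp_radius_def ceiling_le_iff)
  finally show "x $ i \<le> real \<tau>" .
qed

text \<open>
  A vertex is determined by the variables at which it is integral and their values: all branching
  constraints and bounds that are tight at it concern such variables, so a second point of the region
  with the same integral entries lies in its flat. Each variable has \<open>\<tau> + 1\<close> integral values, and
  \<open>-1\<close> encodes that it is fractional.
\<close>

lemma card_node_vertices_le:
  assumes "lp_radius P \<le> int \<tau>"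
  shows "finite (node_vertices P)" "card (node_vertices P) \<le> (\<tau> + 2) ^ n"
proof -
  define code where "code = (\<lambda>x :: real vec. \<lambda>i\<in>{..<n}. if x $ i \<in> \<int> then \<lfloor>x $ i\<rfloor> else -1)"
  define T where "T = PiE {..<n} (\<lambda>_. {-1..int \<tau>})"
  have "finite T" "card T = (\<tau> + 2) ^ n" by (auto simp: T_def finite_PiE card_PiE nat_add_distrib)
  moreover have "code ` node_vertices P \<subseteq> T"
  proof
    fix c assume "c \<in> code ` node_vertices P"
    then obtain x where x: "c = code x" "x \<in> lp_region P" using node_vertices_lp by blast
    then show "c \<in> T" using lp_region_coord_le[OF assms x(2)]
      by (auto simp: T_def code_def le_floor_iff floor_le_iff intro: order_trans[of _ 0]) 
         (smt (verit))+
  qed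
  moreover have "inj_on code (node_vertices P)"
  proof (rule inj_onI)
    fix x y assume xy: "x \<in> node_vertices P" "y \<in> node_vertices P" "code x = code y"
    then have c: "x \<in> carrier_vec n" "y \<in> carrier_vec n" using node_vertices_carrier by auto
    have same: "x $ i = y $ i" if "x $ i \<in> \<int>" for i
    proof (cases "i < n")
      case True
      then have "(if x $ i \<in> \<int> then \<lfloor>x $ i\<rfloor> else -1) = (if y $ i \<in> \<int> then \<lfloor>y $ i\<rfloor> else -1)"
        using fun_cong[OF xy(3), of i] by (simp add: code_def)
      moreover have "0 \<le> x $ i" using node_vertices_lp[OF xy(1)] True by (simp add: lp_region_def)
      then have "0 \<le> \<lfloor>x $ i\<rfloor>" by simp
      ultimately have "\<lfloor>x $ i\<rfloor> = \<lfloor>y $ i\<rfloor>" "y $ i \<in> \<int>" using that by (auto split: if_splits)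
      then show ?thesis using that by (auto elim!: Ints_cases)
    next
      case False
      then show ?thesis using index_outside[OF c, of i] by simp
    qed
    obtain \<sigma> where \<sigma>: "finite \<sigma>" "vertex_of x (node_region P \<sigma>)" using xy by (auto simp: node_vertices_def)
    interpret polytope n "node_constraints P \<sigma>" "node_region P \<sigma>" using polytope_node_region \<sigma> by blast
    have "y \<in> flat x"
    proof -
      have "\<phi> y = 0" if "\<phi> \<in> node_constraints P \<sigma>" "\<phi> x = 0" for \<phi>
      proof -
        have "row (rmat P) r \<bullet> y = rrhs P $ r" if "r < m" for r
          using node_vertices_lp[OF xy(2)] that rmat by (auto simp: lp_region_def vec_eq_iff)
        moreover have "slack \<beta> y = 0" if "slack \<beta> x = 0" for \<beta>
          using that
        proof (cases \<beta>)
          case (Le i k)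
          then have "x $ i = real_of_int k" using that by simp
          then show ?thesis using same[of i] Le by simp
        next
          case (Ge i k)
          then have "x $ i = real_of_int k" using that by simp
          then show ?thesis using same[of i] Ge by simp
        qed
        ultimately show ?thesis using that same cmat by (auto simp: node_constraints_def)
      qed
      then show ?thesis using c by (auto simp: flat_def)
    qed
    then show "x = y" using vertex_imp_basic[OF \<sigma>(2)] by auto
  qed
  ultimately show "finite (node_vertices P)" "card (node_vertices P) \<le> (\<tau> + 2) ^ n"
    by (metis inj_on_finite, metis card_inj_on_le)
qed

end

section \<open>Optima of a node LP with a cut\<close>

definition cut_region :: "nat \<Rightarrow> (real vec \<Rightarrow> real) \<Rightarrow> real vec set" where
  "cut_region n G = {x \<in> carrier_vec n. 0 \<le> G x}"

text \<open>
  A pair of vertices is a symbolic name of a point that depends on the cut: \<open>(p, p)\<close> names \<open>p\<close>, and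
  \<open>(p, q)\<close> with \<open>p\<close> cut off and \<open>q\<close> kept names the point where the segment crosses the cut hyperplane. Two
  cuts are compared by means of the symbols, not of the points.
\<close>

fun pt :: "(real vec \<Rightarrow> real) \<Rightarrow> real vec \<times> real vec \<Rightarrow> real vec" where
  "pt G (p, q) = (if p = q then p else lin (G p / (G p - G q)) p q)"

definition symbols :: "ip \<Rightarrow> (real vec \<Rightarrow> real) \<Rightarrow> (real vec \<times> real vec) set" where
  "symbols P G = {(p, q). p \<in> node_vertices P \<and> q \<in> node_vertices P \<and> (p = q \<or> G p < 0 \<and> 0 \<le> G q)}"

definition candidates :: "ip \<Rightarrow> (real vec \<Rightarrow> real) \<Rightarrow> branching set \<Rightarrow> (real vec \<times> real vec) set" where
  "candidates P G \<sigma> = {(p, q). vertex_of p (node_region P \<sigma>) \<and> vertex_of q (node_region P \<sigma>) \<and>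
     (p = q \<and> 0 \<le> G p \<or> G p < 0 \<and> 0 \<le> G q)}"

definition best :: "ip \<Rightarrow> (real vec \<Rightarrow> real) \<Rightarrow> branching set \<Rightarrow> (real vec \<times> real vec) set" where
  "best P G \<sigma> = {y \<in> candidates P G \<sigma>. \<forall>y'\<in>candidates P G \<sigma>. obj P \<bullet> pt G y' \<le> obj P \<bullet> pt G y}"

definition on_edge :: "'a \<Rightarrow> 'a \<Rightarrow> ('a \<times> 'a) set" where
  "on_edge p q = {(p, p), (q, q), (p, q), (q, p)}"

text \<open>
  Among the optimal points on the edge from \<open>p\<close> to \<open>q\<close> the one nearest to \<open>p\<close>. For
  \<open>p \<noteq> q\<close> the symbols \<open>(p, q)\<close> and \<open>(q, p)\<close> exclude each other, as do \<open>(q, p)\<close> and \<open>(q, q)\<close>, so a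
  fixed order of preference suffices.
\<close>

definition nearest_symbol :: "'a \<Rightarrow> 'a \<Rightarrow> ('a \<times> 'a) set \<Rightarrow> 'a \<times> 'a" where
  "nearest_symbol p q B = (if (p, p) \<in> B then (p, p) else if (p, q) \<in> B then (p, q)
     else if (q, p) \<in> B then (q, p) else (q, q))"

lemma seg_antisym:
  assumes "p \<in> carrier_vec n" "v \<in> carrier_vec n" "w \<in> carrier_vec n" "v \<in> seg p w" "w \<in> seg p v"
  shows "v = w"
proof (rule ccontr)
  assume "v \<noteq> w"
  obtain s t where s: "v = lin s p w" "0 \<le> s" "s \<le> 1" and t: "w = lin t p v" "0 \<le> t" "t \<le> 1"
    using assms by (auto simp: seg_lin)
  have "p \<noteq> w" using \<open>v \<noteq> w\<close> s(1) lin_same[OF assms(3), of s] by metis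
  have "lin t p (lin s p w) = lin (t * s) p w"
    using lin_lin[OF assms(1,3), of t 0 s] assms by simp
  then have "lin 1 p w = lin (t * s) p w"
    unfolding s(1)[symmetric] t(1)[symmetric] using assms by simp
  then have "t * s = 1" using lin_inj[OF assms(1,3) \<open>p \<noteq> w\<close>] by metis
  moreover have "t * s \<le> s" using s(2) t(2,3) by (simp add: mult_left_le_one_le)
  ultimately have "s = 1" using s(3) by simp
  then have "v = w" using s(1) assms by simp
  then show False using \<open>v \<noteq> w\<close> by simp
qed

text \<open>
  The sum of two vectors has the dimension of the second one, so \<open>lin t p q\<close> makes sense when the
  dimension of \<open>p\<close> differs from \<open>n\<close>. The definition of \<open>edges\<close> and the results of \<open>pick\<close> allow such
  representations of a segment; they are normalized by the following lemmas.
\<close>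

lemma lin_index_gen:
  assumes "q \<in> carrier_vec n" "i < n"
  shows "lin t p q $ i = (if i < dim_vec p then (1 - t) * p $ i else p $ i) + t * q $ i"
proof -
  have "((1 - t) \<cdot>\<^sub>v p) $ i = p $ i" if "\<not> i < dim_vec p"
    using that by (intro index_outside[of _ "dim_vec p"]) auto
  then show ?thesis using assms by (auto simp: lin_def)
qed

lemma lin_carrier_iff: "lin t p q \<in> carrier_vec n \<longleftrightarrow> q \<in> carrier_vec n"
  unfolding carrier_dim_vec lin_def by simp

lemma lin_normalize:
  assumes "q \<in> carrier_vec n"
  shows "lin t p q = lin t (lin 0 p q) (lin 1 p q)"
  using assms
  by (intro lin_eqI[of _ n]) (auto simp: lin_carrier_iff lin_index[of _ n] lin_index_gen[of _ n] algebra_simps)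

definition is_face :: "real vec set \<Rightarrow> real vec set \<Rightarrow> bool" where
  "is_face e S \<longleftrightarrow> e \<subseteq> S \<and> (\<forall>r\<in>S. \<forall>s\<in>S. \<forall>x\<in>e. x \<in> open_seg r s \<longrightarrow> r \<in> e \<and> s \<in> e)"

lemma edges_face:
  assumes "e \<in> edges S" "S \<subseteq> carrier_vec n"
  obtains p q where "p \<in> carrier_vec n" "q \<in> carrier_vec n" "e = seg p q" "is_face e S"
proof -
  obtain p q where e: "e = seg p q" and f: "is_face e S" using assms(1) by (auto simp: edges_def is_face_def)
  then have "lin 0 p q \<in> S" by (force simp: is_face_def seg_lin)
  then have q: "q \<in> carrier_vec n" using assms(2) lin_carrier_iff by blast
  moreover have "e = seg (lin 0 p q) (lin 1 p q)"
    unfolding e seg_lin by (simp only: lin_normalize[OF q, of _ p, symmetric])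
  moreover have "lin 0 p q \<in> carrier_vec n" "lin 1 p q \<in> carrier_vec n"
    using q by (simp_all add: lin_carrier_iff)
  ultimately show ?thesis using that f by metis
qed

lemma face_ends:
  assumes f: "is_face (seg p q) S" and S: "S \<subseteq> carrier_vec n"
    and pq: "p \<in> carrier_vec n" "q \<in> carrier_vec n"
  shows "vertex_of p S" "vertex_of q S"
proof -
  have end_vertex: "vertex_of u S" if uv: "u \<in> carrier_vec n" "v \<in> carrier_vec n" "seg p q = seg u v" for u v
    unfolding vertex_of_def
  proof (intro conjI ballI notI)
    have uS: "u \<in> seg p q" using uv seg_ends by blast
    then show "u \<in> S" using f by (auto simp: is_face_def)
    fix r s assume rs: "r \<in> S" "s \<in> S" "u \<in> open_seg r s"
    then have "r \<in> seg u v" "s \<in> seg u v" using f uS rs unfolding is_face_def uv(3) by blast+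
    then obtain a b where a: "r = lin a u v" "0 \<le> a" and b: "s = lin b u v" "0 \<le> b" by (auto simp: seg_lin)
    obtain t where t: "0 < t" "t < 1" "u = lin t r s" "u \<noteq> r"
      using open_segD[of r n s u] rs S by blast
    have "u \<noteq> v" using t(4) a uv by (auto simp: lin_same)
    have "lin 0 u v = lin ((1 - t) * a + t * b) u v"
      using lin_lin[OF uv(1,2), of t a b] unfolding a(1)[symmetric] b(1)[symmetric] t(3)[symmetric]
      using uv by simp
    then have "0 = (1 - t) * a + t * b" using lin_inj[OF uv(1,2) \<open>u \<noteq> v\<close>] by blast
    moreover have "0 \<le> (1 - t) * a" "0 \<le> t * b" using a(2) b(2) t(1,2) by auto
    ultimately have "(1 - t) * a = 0" by linarith
    then have "a = 0" using t(2) by simp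
    then have "r = u" using a(1) uv by simp
    then show False using t(4) by simp
  qed
  show "vertex_of p S" using end_vertex[OF pq] by simp
  show "vertex_of q S" using end_vertex[OF pq(2,1)] seg_sym[OF pq] by simp
qed

lemma face_swap:
  "is_face (seg p q) S \<Longrightarrow> p \<in> carrier_vec n \<Longrightarrow> q \<in> carrier_vec n \<Longrightarrow> is_face (seg q p) S"
  using seg_sym by metis

lemma vertex_of_subset: "vertex_of x S \<Longrightarrow> T \<subseteq> S \<Longrightarrow> x \<in> T \<Longrightarrow> vertex_of x T"
  by (auto simp: vertex_of_def)

lemma affine_cross:
  assumes "affine_fun n f" "p \<in> carrier_vec n" "q \<in> carrier_vec n" "G p < 0" "0 \<le> G q"
  shows "f (pt G (p, q)) = (f p * G q - f q * G p) / (G q - G p)"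
proof -
  have "p \<noteq> q" using assms by auto
  then show ?thesis using affine_funD[OF assms(1-3)] assms(4,5)
    by (auto simp: divide_simps) (auto simp: algebra_simps)
qed

lemma cross_param:
  assumes "G p < 0" "0 \<le> G q"
  shows "0 < G p / (G p - G q)" "G p / (G p - G q) \<le> 1" "p \<noteq> q"
    "pt G (p, q) = lin (G p / (G p - G q)) p q"
  using assms by (auto simp: divide_simps)

lemma cross_value:
  assumes "affine_fun n G" "p \<in> carrier_vec n" "q \<in> carrier_vec n" "G p < 0" "0 \<le> G q"
  shows "G (lin a p q) = (a - G p / (G p - G q)) * (G q - G p)"
proof -
  have "G p / (G p - G q) * (G q - G p) = - G p" using assms(4,5) by (simp add: field_simps)
  then show ?thesis using affine_funD[OF assms(1-3), of a] by (simp add: algebra_simps)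
qed

text \<open>
  Along a face that is a segment everything is one-dimensional: the crossing point has the smallest
  parameter among the points that the cut keeps, so it is no proper combination of two of them. The
  face property reduces combinations of points of \<open>S\<close> to combinations of points of the segment.
\<close>

lemma cross_vertex:
  assumes f: "is_face (seg p q) S" and S: "S \<subseteq> carrier_vec n"
    and pq: "p \<in> carrier_vec n" "q \<in> carrier_vec n"
    and G: "affine_fun n G" "G p < 0" "0 \<le> G q"
  shows "pt G (p, q) \<in> seg p q" "vertex_of (pt G (p, q)) (S \<inter> cut_region n G)"
proof -
  define t where "t = G p / (G p - G q)"
  have t: "0 < t" "t \<le> 1" "p \<noteq> q" "pt G (p, q) = lin t p q"
    using cross_param[OF G(2,3)] by (auto simp: t_def)
  have val: "G (lin a p q) = (a - t) * (G q - G p)" for a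
    using cross_value[OF G(1) pq G(2,3)] by (simp add: t_def)
  show in_seg: "pt G (p, q) \<in> seg p q" using t by (auto simp: seg_lin)
  show "vertex_of (pt G (p, q)) (S \<inter> cut_region n G)"
    unfolding vertex_of_def
  proof (intro conjI ballI notI)
    have "G (pt G (p, q)) = 0" unfolding t(4) val by simp
    then show "pt G (p, q) \<in> S \<inter> cut_region n G"
      using in_seg f S by (auto simp: is_face_def cut_region_def)
    fix r s assume rs: "r \<in> S \<inter> cut_region n G" "s \<in> S \<inter> cut_region n G" "pt G (p, q) \<in> open_seg r s"
    then have "r \<in> seg p q" "s \<in> seg p q" using f in_seg by (auto simp: is_face_def)
    then obtain a b where ab: "r = lin a p q" "s = lin b p q" by (auto simp: seg_lin)
    have "0 \<le> (a - t) * (G q - G p)" "0 \<le> (b - t) * (G q - G p)"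
      using rs(1,2) val ab by (auto simp: cut_region_def)
    then have ge: "t \<le> a" "t \<le> b" using G by (auto simp: zero_le_mult_iff)
    obtain k where k: "0 < k" "k < 1" "pt G (p, q) = lin k r s" "pt G (p, q) \<noteq> r"
      using open_segD[of r n s] rs S by blast
    have "lin t p q = lin ((1 - k) * a + k * b) p q"
      using k(3) t(4) lin_lin[OF pq, of k a b] ab by simp
    then have "t = (1 - k) * a + k * b" using lin_inj[OF pq t(3)] by blast
    then have "(1 - k) * (a - t) + k * (b - t) = 0" by (simp add: algebra_simps)
    moreover have "0 \<le> (1 - k) * (a - t)" "0 \<le> k * (b - t)" using ge k by auto
    ultimately have "a = t" using k by (simp add: add_nonneg_eq_0_iff)
    then show False using k(4) t(4) ab by simp
  qed
qed

text \<open>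
  Conversely, a kept point strictly between the crossing point and \<open>q\<close> is a proper combination of them.
\<close>

lemma cut_face_vertex:
  assumes f: "is_face (seg p q) S" and S: "S \<subseteq> carrier_vec n"
    and pq: "p \<in> carrier_vec n" "q \<in> carrier_vec n"
    and G: "affine_fun n G" "G p < 0" and x: "x \<in> seg p q" "vertex_of x (S \<inter> cut_region n G)"
  shows "0 \<le> G q \<and> (x = pt G (p, q) \<or> x = q)"
proof -
  obtain a where a: "x = lin a p q" "0 \<le> a" "a \<le> 1" using x by (auto simp: seg_lin)
  have vx: "G x = (1 - a) * G p + a * G q" using affine_funD[OF G(1) pq] a by simp
  have Gx: "0 \<le> G x" using x by (auto simp: vertex_of_def cut_region_def)
  have Gq: "0 \<le> G q"
  proof (rule ccontr)
    assume "\<not> 0 \<le> G q"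
    then have "(1 - a) * G p \<le> 0" "a * G q \<le> 0" using G a by (auto simp: mult_le_0_iff)
    then have "(1 - a) * G p = 0" "a * G q = 0" using Gx vx by linarith+
    then show False using G \<open>\<not> 0 \<le> G q\<close> by auto
  qed
  define t where "t = G p / (G p - G q)"
  have t: "0 < t" "t \<le> 1" "p \<noteq> q" "pt G (p, q) = lin t p q"
    using cross_param[OF G(2) Gq] by (auto simp: t_def)
  have val: "G (lin a p q) = (a - t) * (G q - G p)" for a
    using cross_value[OF G(1) pq G(2) Gq] by (simp add: t_def)
  have "t \<le> a" using Gx val[of a] a(1) G Gq by (auto simp: zero_le_mult_iff)
  have "x = pt G (p, q) \<or> x = q"
  proof (rule ccontr)
    assume n: "\<not> (x = pt G (p, q) \<or> x = q)"
    then have "a \<noteq> t" "a \<noteq> 1" using a t pq by auto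
    then have lt: "t < a" "a < 1" using \<open>t \<le> a\<close> a by auto
    define k where "k = (a - t) / (1 - t)"
    have k: "0 < k" "k < 1" using lt by (auto simp: k_def)
    have "lin k (lin t p q) (lin 1 p q) = lin a p q"
    proof -
      have "k * (1 - t) = a - t" using lt by (simp add: k_def)
      then have "(1 - k) * t + k * 1 = a" by (simp add: algebra_simps)
      then show ?thesis unfolding lin_lin[OF pq] by simp
    qed
    then have "x = lin k (pt G (p, q)) q" using t(4) a pq by simp
    moreover have "pt G (p, q) \<noteq> q" using t lt lin_inj[OF pq t(3), of t 1] pq by auto
    moreover have "pt G (p, q) \<in> carrier_vec n" using t pq by auto
    ultimately have "x \<in> open_seg (pt G (p, q)) q" using open_seg_lin[of "pt G (p, q)" n q] pq k by blast
    moreover have "pt G (p, q) \<in> S \<inter> cut_region n G"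
      using cross_vertex[OF f S pq G Gq] by (simp add: vertex_of_def)
    moreover have "q \<in> S \<inter> cut_region n G"
      using Gq pq seg_ends[OF pq] f by (auto simp: is_face_def cut_region_def)
    ultimately show False using x by (auto simp: vertex_of_def)
  qed
  with Gq show ?thesis by blast
qed

text \<open>
  A node LP with the cut \<open>G \<ge> 0\<close>, where \<open>z\<close> is its optimum without the cut.
\<close>

locale cut_node = bounded_ip P m n for P m n +
  fixes G :: "real vec \<Rightarrow> real" and \<sigma> :: "branching set" and z :: "real vec"
  assumes G: "affine_fun n G" and fin\<sigma>: "finite \<sigma>"
    and z: "node_region P \<sigma> \<noteq> {} \<Longrightarrow> z \<in> optimal_vertices P UNIV \<sigma>"
begin

abbreviation "Q \<equiv> node_region P \<sigma>"
abbreviation "H \<equiv> cut_region n G"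
abbreviation "c x \<equiv> obj P \<bullet> x"

sublocale poly: polytope n "node_constraints P \<sigma>" Q
  using polytope_node_region[OF fin\<sigma>] .

lemma affine_obj: "affine_fun n (\<lambda>x. c x)"
  using affine_fun_scalar_prod[OF obj] .

lemma Q_carrier: "Q \<subseteq> carrier_vec n"
  using poly.Q_carrier by blast

lemma candidate_feasible:
  assumes "y \<in> candidates P G \<sigma>"
  shows "pt G y \<in> Q \<inter> H"
proof -
  obtain p q where y: "y = (p, q)" "vertex_of p Q" "vertex_of q Q" "p = q \<and> 0 \<le> G p \<or> G p < 0 \<and> 0 \<le> G q"
    using assms by (auto simp: candidates_def)
  then have pq: "p \<in> Q" "q \<in> Q" by (auto simp: vertex_of_def)
  then have pc: "p \<in> carrier_vec n" "q \<in> carrier_vec n" using Q_carrier by auto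
  show ?thesis
  proof (cases "p = q")
    case True
    then show ?thesis using y pq pc by (auto simp: cut_region_def)
  next
    case False
    then have g: "G p < 0" "0 \<le> G q" using y by auto
    note t = cross_param[of G, OF g]
    have "pt G (p, q) \<in> Q" unfolding t(4) using poly.Q_convex pq t(1,2) by simp
    moreover have "G (pt G (p, q)) = 0" unfolding affine_cross[OF G pc g] by simp
    ultimately show ?thesis using y pc by (auto simp: cut_region_def simp del: pt.simps intro: subsetD[OF Q_carrier])
  qed
qed

lemma value_ge: "x \<in> Q \<inter> H \<Longrightarrow> ereal (c x) \<le> lp_value P H \<sigma>"
  unfolding lp_value_def by (rule SUP_upper)

lemma value_eqI:
  assumes "w \<in> Q \<inter> H" "\<And>x. x \<in> Q \<Longrightarrow> 0 \<le> G x \<Longrightarrow> c x \<le> c w"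
  shows "lp_value P H \<sigma> = ereal (c w)"
  using assms unfolding lp_value_def
  by (intro antisym SUP_least SUP_upper2[of w]) (auto simp: cut_region_def)

lemma z_optimal:
  assumes "Q \<noteq> {}"
  shows "vertex_of z Q" "x \<in> Q \<Longrightarrow> c x \<le> c z"
proof -
  have z': "vertex_of z Q" "ereal (c z) = lp_value P UNIV \<sigma>" using z[OF assms] by (auto simp: optimal_vertices_def)
  show "vertex_of z Q" by fact
  show "c x \<le> c z" if "x \<in> Q"
  proof -
    have "ereal (c x) \<le> lp_value P UNIV \<sigma>" unfolding lp_value_def using that by (intro SUP_upper) auto
    then show ?thesis unfolding z'(2)[symmetric] by simp
  qed
qed

text \<open>
  The candidates are feasible points, and one of them is optimal. So comparing the finitely many
  candidates with each other decides which of them are optimal.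
\<close>

lemma best_optimal:
  assumes "\<exists>y\<in>candidates P G \<sigma>. lp_value P H \<sigma> = ereal (c (pt G y))"
  shows "y \<in> candidates P G \<sigma> \<Longrightarrow> lp_value P H \<sigma> = ereal (c (pt G y)) \<longleftrightarrow> y \<in> best P G \<sigma>"
proof -
  obtain y0 where y0: "y0 \<in> candidates P G \<sigma>" "lp_value P H \<sigma> = ereal (c (pt G y0))" using assms by blast
  have le: "c (pt G y) \<le> c (pt G y0)" if "y \<in> candidates P G \<sigma>" for y
    using value_ge[OF candidate_feasible[OF that]] unfolding y0(2) by simp
  assume y: "y \<in> candidates P G \<sigma>"
  show "lp_value P H \<sigma> = ereal (c (pt G y)) \<longleftrightarrow> y \<in> best P G \<sigma>"
  proof
    assume "lp_value P H \<sigma> = ereal (c (pt G y))"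
    then show "y \<in> best P G \<sigma>" using y le y0(2) by (simp add: best_def del: pt.simps)
  next
    assume "y \<in> best P G \<sigma>"
    then have "c (pt G y0) \<le> c (pt G y)" using y0(1) unfolding best_def by blast
    then show "lp_value P H \<sigma> = ereal (c (pt G y))" using le[OF y] y0(2) by simp
  qed
qed

lemma optimal_edge:
  assumes feas: "Q \<inter> H \<noteq> {}" and zH: "z \<notin> H"
  obtains e where "e \<in> edges Q" "e \<inter> optimal_vertices P H \<sigma> \<noteq> {}"
    "\<exists>y\<in>candidates P G \<sigma>. lp_value P H \<sigma> = ereal (c (pt G y))"
proof -
  have "Q \<noteq> {}" using feas by blast
  note zo = z_optimal[OF this]
  have zQ: "z \<in> Q" using zo by (simp add: vertex_of_def)
  then have "G z < 0" using zH Q_carrier by (auto simp: cut_region_def)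
  obtain x0 where "x0 \<in> Q" "0 \<le> G x0" using feas by (auto simp: cut_region_def)
  then obtain w p q where w: "vertex_of p Q" "vertex_of q Q" "p \<noteq> q" "seg p q \<in> edges Q" "w \<in> seg p q"
    "w \<in> Q" "G w = 0" "\<And>x. x \<in> Q \<Longrightarrow> 0 \<le> G x \<Longrightarrow> c x \<le> c w"
    "(w = p \<or> w = q) \<or> (G p < 0 \<and> 0 < G q)"
    using poly.optimum_on_edge[OF G affine_obj zQ zo(2) \<open>G z < 0\<close>] by metis
  have wH: "w \<in> Q \<inter> H" using w Q_carrier by (auto simp: cut_region_def)
  have val: "lp_value P H \<sigma> = ereal (c w)" using value_eqI[OF wH w(8)] .
  have pc: "p \<in> carrier_vec n" "q \<in> carrier_vec n" using w(1,2) Q_carrier by (auto simp: vertex_of_def)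
  have f: "is_face (seg p q) Q" using w(4) by (auto simp: edges_def is_face_def)
  have "\<exists>y\<in>candidates P G \<sigma>. w = pt G y \<and> vertex_of w (Q \<inter> H)"
  proof (cases "w = p \<or> w = q")
    case True
    then have "vertex_of w Q" using w by blast
    moreover from this have "vertex_of w (Q \<inter> H)" using wH vertex_of_subset by blast
    ultimately show ?thesis using w(7) by (intro bexI[of _ "(w, w)"]) (auto simp: candidates_def)
  next
    case False
    then have g: "G p < 0" "0 \<le> G q" using w by auto
    obtain a where a: "w = lin a p q" using w(5) by (auto simp: seg_lin)
    have "(1 - a) * G p + a * G q = 0" using affine_funD[OF G pc] w(7) a by simp
    then have "a = G p / (G p - G q)" using g by (simp add: field_simps)
    then have "w = pt G (p, q)" using a w(3) by simp
    then show ?thesis using cross_vertex[OF f Q_carrier pc G g] w(1,2) g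
      by (intro bexI[of _ "(p, q)"]) (auto simp: candidates_def)
  qed
  then show ?thesis using that w(4,5) val by (auto simp: optimal_vertices_def)
qed

lemma value_attained:
  assumes "Q \<inter> H \<noteq> {}"
  shows "\<exists>y\<in>candidates P G \<sigma>. lp_value P H \<sigma> = ereal (c (pt G y))"
proof (cases "z \<in> H")
  case True
  have "Q \<noteq> {}" using assms by blast
  note zo = z_optimal[OF this]
  have "z \<in> Q \<inter> H" using zo True by (auto simp: vertex_of_def)
  moreover have "(z, z) \<in> candidates P G \<sigma>" using zo True by (auto simp: candidates_def cut_region_def)
  ultimately show ?thesis using value_eqI[of z] zo by (intro bexI[of _ "(z, z)"]) auto
next
  case False
  then show ?thesis using optimal_edge[OF assms] by metis
qed

lemma feasible_iff: "Q \<inter> H \<noteq> {} \<longleftrightarrow> candidates P G \<sigma> \<noteq> {}"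
  using value_attained candidate_feasible by blast

lemma value_infeasible: "candidates P G \<sigma> = {} \<Longrightarrow> lp_value P H \<sigma> = -\<infinity>"
  using feasible_iff by (simp add: lp_value_def bot_ereal_def)

lemma value_best: "y \<in> best P G \<sigma> \<Longrightarrow> lp_value P H \<sigma> = ereal (c (pt G y))"
  using best_optimal value_attained feasible_iff by (metis (no_types, lifting) best_def empty_iff mem_Collect_eq)

lemma best_nonempty: "candidates P G \<sigma> \<noteq> {} \<Longrightarrow> best P G \<sigma> \<noteq> {}"
  using best_optimal value_attained feasible_iff by blast

text \<open>
  The optimal vertices on an edge are named by at most four symbols, whatever the cut is.
\<close>

lemma optimal_on_face:
  assumes f: "is_face (seg p q) Q" and pq: "p \<in> carrier_vec n" "q \<in> carrier_vec n"
  shows "optimal_vertices P H \<sigma> \<inter> seg p q = pt G ` (best P G \<sigma> \<inter> on_edge p q)" (is "?l = ?r")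
proof
  have vpq: "vertex_of p Q" "vertex_of q Q" using face_ends[OF f Q_carrier pq] by auto
  note fs = face_swap[OF f pq]
  show "?r \<subseteq> ?l"
  proof
    fix x assume "x \<in> ?r"
    then obtain y where y: "x = pt G y" "y \<in> best P G \<sigma>" "y \<in> on_edge p q" by blast
    have yc: "y \<in> candidates P G \<sigma>" using y by (simp add: best_def)
    have "x \<in> seg p q \<and> vertex_of x (Q \<inter> H)"
    proof (cases "fst y = snd y")
      case True
      then have "x = p \<or> x = q" "x = fst y" using y by (auto simp: on_edge_def)
      moreover from this have "vertex_of x Q" using vpq by blast
      ultimately show ?thesis using candidate_feasible[OF yc] y(1) vertex_of_subset[of x Q "Q \<inter> H"] seg_ends[OF pq] by auto
    next
      case False
      then have g: "G (fst y) < 0" "0 \<le> G (snd y)" using yc by (auto simp: candidates_def)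
      have "y = (p, q) \<or> y = (q, p)" using False y(3) by (auto simp: on_edge_def)
      then show ?thesis
      proof
        assume "y = (p, q)"
        then show ?thesis using cross_vertex[OF f Q_carrier pq G] g y(1) by (simp del: pt.simps)
      next
        assume "y = (q, p)"
        then show ?thesis using cross_vertex[OF fs Q_carrier pq(2,1) G] g y(1) seg_sym[OF pq] by (simp del: pt.simps)
      qed
    qed
    then show "x \<in> ?l" using value_best[OF y(2)] y(1) by (simp add: optimal_vertices_def del: pt.simps)
  qed
  show "?l \<subseteq> ?r"
  proof
    fix x assume x: "x \<in> ?l"
    then have xv: "x \<in> seg p q" "vertex_of x (Q \<inter> H)" "lp_value P H \<sigma> = ereal (c x)"
      by (auto simp: optimal_vertices_def)
    have "\<exists>y\<in>candidates P G \<sigma> \<inter> on_edge p q. x = pt G y"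
    proof (cases "G p < 0")
      case True
      then have *: "0 \<le> G q \<and> (x = pt G (p, q) \<or> x = q)"
        using cut_face_vertex[OF f Q_carrier pq G _ xv(1,2)] by blast
      then have "(p, q) \<in> candidates P G \<sigma> \<inter> on_edge p q" "(q, q) \<in> candidates P G \<sigma> \<inter> on_edge p q"
        using True vpq by (auto simp: candidates_def on_edge_def)
      moreover have "x = pt G (p, q) \<or> x = pt G (q, q)" using * by simp
      ultimately show ?thesis by blast
    next
      case Gp: False
      show ?thesis
      proof (cases "G q < 0")
        case True
        then have *: "0 \<le> G p \<and> (x = pt G (q, p) \<or> x = p)"
          using cut_face_vertex[OF fs Q_carrier pq(2,1) G True] xv seg_sym[OF pq] by blast
        then have "(q, p) \<in> candidates P G \<sigma> \<inter> on_edge p q" "(p, p) \<in> candidates P G \<sigma> \<inter> on_edge p q"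
          using True vpq by (auto simp: candidates_def on_edge_def)
        moreover have "x = pt G (q, p) \<or> x = pt G (p, p)" using * by simp
        ultimately show ?thesis by blast
      next
        case False
        then have "p \<in> Q \<inter> H" "q \<in> Q \<inter> H" using Gp vpq pq by (auto simp: vertex_of_def cut_region_def)
        then have "x \<notin> open_seg p q" using xv(2) by (auto simp: vertex_of_def)
        then have "x = p \<or> x = q" using xv(1) by (auto simp: open_seg_def)
        then have "x = pt G (p, p) \<or> x = pt G (q, q)" by simp
        moreover have "(p, p) \<in> candidates P G \<sigma> \<inter> on_edge p q" "(q, q) \<in> candidates P G \<sigma> \<inter> on_edge p q"
          using False Gp vpq by (auto simp: candidates_def on_edge_def)
        ultimately show ?thesis by blast
      qed
    qed
    then obtain y where y: "y \<in> candidates P G \<sigma>" "y \<in> on_edge p q" "x = pt G y" by blast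
    moreover have "y \<in> best P G \<sigma>"
      using best_optimal[OF value_attained y(1)] xv y vertex_of_def by fastforce
    ultimately show "x \<in> ?r" by blast
  qed
qed

lemma nearest_on_face:
  assumes f: "is_face (seg p q) Q" and pq: "p \<in> carrier_vec n" "q \<in> carrier_vec n"
    and ne: "best P G \<sigma> \<inter> on_edge p q \<noteq> {}"
  defines "S \<equiv> optimal_vertices P H \<sigma> \<inter> seg p q"
  shows "nearest_symbol p q (best P G \<sigma>) \<in> best P G \<sigma>"
    "(THE v. v \<in> S \<and> (\<forall>w\<in>S. v \<in> seg p w)) = pt G (nearest_symbol p q (best P G \<sigma>))"
proof -
  let ?B = "best P G \<sigma>"
  let ?y = "nearest_symbol p q ?B"
  show yB: "?y \<in> ?B" using ne by (auto simp: nearest_symbol_def on_edge_def)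
  have yo: "?y \<in> on_edge p q" by (auto simp: nearest_symbol_def on_edge_def)
  have S: "S = pt G ` (?B \<inter> on_edge p q)" unfolding S_def by (rule optimal_on_face[OF f pq])
  have yS: "pt G ?y \<in> S" unfolding S using yB yo by blast
  have Sc: "w \<in> carrier_vec n" "w \<in> seg p q" if "w \<in> S" for w
    using that seg_carrier[OF pq] by (auto simp: S_def)
  have near: "pt G ?y \<in> seg p w" if w: "w \<in> S" for w
  proof -
    obtain y' where y': "w = pt G y'" "y' \<in> ?B" "y' \<in> on_edge p q" using w S by blast
    have cand: "y \<in> candidates P G \<sigma>" if "y \<in> ?B" for y using that by (simp add: best_def)
    show ?thesis
    proof (cases "(p, p) \<in> ?B")
      case True
      then have "pt G ?y = p" by (simp add: nearest_symbol_def)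
      then show ?thesis using seg_ends[OF pq(1) Sc(1)[OF w]] by simp
    next
      case pp: False
      have "(p, q) \<notin> ?B \<or> (q, p) \<notin> ?B \<or> p = q"
        using cand[of "(p, q)"] cand[of "(q, p)"] by (auto simp: candidates_def)
      moreover have "(q, p) \<notin> ?B \<or> (q, q) \<notin> ?B \<or> p = q"
        using cand[of "(q, q)"] cand[of "(q, p)"] by (auto simp: candidates_def)
      ultimately have "y' = ?y \<or> y' = (q, q)"
        using y'(2,3) pp by (auto simp: on_edge_def nearest_symbol_def split: if_splits)
      then have "w = pt G ?y \<or> w = q" using y'(1) by auto
      then show ?thesis using Sc(2)[OF yS] seg_ends[OF pq(1) Sc(1)[OF w]] by auto
    qed
  qed
  show "(THE v. v \<in> S \<and> (\<forall>w\<in>S. v \<in> seg p w)) = pt G ?y"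
  proof (rule the_equality)
    show "pt G ?y \<in> S \<and> (\<forall>w\<in>S. pt G ?y \<in> seg p w)" using yS near by blast
    fix v assume "v \<in> S \<and> (\<forall>w\<in>S. v \<in> seg p w)"
    then show "v = pt G ?y" using seg_antisym[OF pq(1)] Sc near yS by blast
  qed
qed

end

section \<open>Cuts that are indistinguishable to branch-and-cut\<close>

text \<open>
  A symbolic factor of a branching score: a difference of two objective values, or a constant. The
  constants \<open>0\<close> and \<open>1\<close> are there to express comparisons of single values as comparisons of products.
\<close>

datatype gap = Const real | Diff "real vec \<times> real vec" "real vec \<times> real vec"

fun gap_value :: "ip \<Rightarrow> (real vec \<Rightarrow> real) \<Rightarrow> gap \<Rightarrow> real" where
  "gap_value P G (Const r) = r"
| "gap_value P G (Diff y y') = obj P \<bullet> pt G y - obj P \<bullet> pt G y'"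

definition gaps :: "ip \<Rightarrow> (real vec \<Rightarrow> real) \<Rightarrow> gap set" where
  "gaps P G = {Const 0, Const 1, Const (1 / 10 ^ 6)} \<union> {Diff y y' | y y'. y \<in> symbols P G \<and> y' \<in> symbols P G}"

text \<open>
  Everything that branch-and-cut can learn about the cut \<open>G \<ge> 0\<close>: which vertices it removes, how the
  crossing points are rounded, and how products of objective differences compare.
\<close>

definition similar :: "ip \<Rightarrow> (real vec \<Rightarrow> real) \<Rightarrow> (real vec \<Rightarrow> real) \<Rightarrow> bool" where
  "similar P G G' \<longleftrightarrow>
     (\<forall>w\<in>node_vertices P. 0 \<le> G w \<longleftrightarrow> 0 \<le> G' w) \<and>
     (\<forall>y\<in>symbols P G. \<forall>i<num_vars P. \<lfloor>pt G y $ i\<rfloor> = \<lfloor>pt G' y $ i\<rfloor> \<and> \<lceil>pt G y $ i\<rceil> = \<lceil>pt G' y $ i\<rceil>) \<and>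
     (\<forall>d1\<in>gaps P G. \<forall>d2\<in>gaps P G. \<forall>d3\<in>gaps P G. \<forall>d4\<in>gaps P G.
        gap_value P G d1 * gap_value P G d2 \<le> gap_value P G d3 * gap_value P G d4 \<longleftrightarrow>
        gap_value P G' d1 * gap_value P G' d2 \<le> gap_value P G' d3 * gap_value P G' d4)"

context bounded_ip
begin

lemma lp_region_iff:
  "x \<in> lp_region P \<longleftrightarrow> x \<in> carrier_vec n \<and> (\<forall>r<m. row (rmat P) r \<bullet> x = rrhs P $ r) \<and> (\<forall>i<n. 0 \<le> x $ i)"
proof -
  have "rmat P *\<^sub>v x = rrhs P \<longleftrightarrow> (\<forall>r<m. row (rmat P) r \<bullet> x = rrhs P $ r)"
    using rmat rrhs by (auto simp: vec_eq_iff)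
  then show ?thesis by (auto simp: lp_region_def)
qed

text \<open>
  A bounded region contains no ray, hence no nonnegative direction in the kernel of the constraint
  matrix.
\<close>

lemma no_recession_direction:
  assumes a: "a \<in> lp_region P" and dc: "d \<in> carrier_vec n"
    and row: "\<And>r. r < m \<Longrightarrow> row (rmat P) r \<bullet> d = 0" and nonneg: "\<And>i. i < n \<Longrightarrow> 0 \<le> d $ i"
  shows "d = 0\<^sub>v n"
proof (rule ccontr)
  assume d: "d \<noteq> 0\<^sub>v n"
  have ac: "a \<in> carrier_vec n" using a by (simp add: lp_region_iff)
  interpret polytope n "node_constraints P {}" "node_region P {}" by (rule polytope_node_region) simp
  have "a \<noteq> a + d"
  proof
    assume "a = a + d"
    then have "a $ i = a $ i + d $ i" if "i < n" for i
      using that ac dc by (metis carrier_vecD index_add_vec(1))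
    then have "d = 0\<^sub>v n" using dc by (intro lin_eqI[of _ n]) auto
    then show False using d by simp
  qed
  then obtain s where s: "0 \<le> s" "lin s a (a + d) \<notin> node_region P {}"
    using no_ray[of a "a + d"] a ac dc by (auto simp: node_region_def)
  have "row (rmat P) r \<bullet> lin s a (a + d) = rrhs P $ r" if r: "r < m" for r
  proof -
    let ?r = "row (rmat P) r"
    have rc: "?r \<in> carrier_vec n" using rmat by auto
    have "?r \<bullet> lin s a (a + d) = (1 - s) * (?r \<bullet> a) + s * (?r \<bullet> a + ?r \<bullet> d)"
      using affine_funD[OF affine_fun_scalar_prod[OF rc]] ac dc scalar_prod_add_distrib[OF rc ac dc] by simp
    then show ?thesis using row[OF r] a r by (simp add: lp_region_iff algebra_simps)
  qed
  moreover have "0 \<le> lin s a (a + d) $ i" if i: "i < n" for i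
  proof -
    have "lin s a (a + d) $ i = a $ i + s * d $ i"
      using ac dc i by (simp add: lin_index[of _ n] algebra_simps)
    then show ?thesis using a i s nonneg[OF i] by (simp add: lp_region_iff)
  qed
  ultimately show False using s ac dc by (simp add: node_region_def lp_region_iff)
qed

text \<open>
  Here \<open>p\<close> may have a smaller dimension than \<open>n\<close>; let \<open>d\<close> consist of its unspecified entries. Then
  \<open>seg p w\<close> is the segment from \<open>a\<close> to \<open>w + d\<close>, and it misses all points of the region but \<open>a\<close> unless
  \<open>d = 0\<close>: otherwise \<open>d\<close>, which shares its nonzero entries with \<open>a \<ge> 0\<close>, would be a recession direction. So the choice of
  the nearest optimal vertex either works as on the segment from \<open>a\<close>, or it can only select \<open>a\<close>.
\<close>

lemma edge_orientation:
  assumes e: "seg p q \<in> edges (node_region P \<sigma>)"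
  obtains a b where "a \<in> carrier_vec n" "b \<in> carrier_vec n" "seg p q = seg a b" "is_face (seg a b) (node_region P \<sigma>)"
    "(\<forall>w\<in>carrier_vec n. seg p w = seg a w) \<or> (\<forall>v\<in>lp_region P. \<forall>w\<in>lp_region P. v \<in> seg p w \<longleftrightarrow> v = a)"
proof -
  have f: "is_face (seg p q) (node_region P \<sigma>)" using e by (auto simp: edges_def is_face_def)
  define a where "a = lin 0 p q"
  define b where "b = lin 1 p q"
  define d where "d = vec n (\<lambda>i. if i < dim_vec p then 0 else p $ i)"
  have "a \<in> seg p q" by (force simp: a_def seg_lin)
  then have aQ: "a \<in> node_region P \<sigma>" using f by (auto simp: is_face_def)
  then have alp: "a \<in> lp_region P" by (simp add: node_region_def)
  have ac: "a \<in> carrier_vec n" using aQ node_region_carrier by blast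
  then have qc: "q \<in> carrier_vec n" by (simp add: a_def lin_carrier_iff)
  have bc: "b \<in> carrier_vec n" using qc by (simp add: b_def lin_carrier_iff)
  have dc: "d \<in> carrier_vec n" by (simp add: d_def)
  have eq: "seg p q = seg a b"
    unfolding seg_lin a_def b_def by (simp only: lin_normalize[OF qc, of _ p, symmetric])
  have shift: "lin t p w = lin t a (w + d)" if "w \<in> carrier_vec n" for t w
  proof (rule lin_eqI[of _ n])
    fix i assume i: "i < n"
    have "a $ i = p $ i" using lin_index_gen[OF qc i, of 0 p] by (simp add: a_def)
    then show "lin t p w $ i = lin t a (w + d) $ i"
      using lin_index_gen[OF that i] ac that dc i
      by (simp add: lin_index[of _ n]) (simp add: d_def algebra_simps)
  qed (use that ac dc in \<open>auto simp: lin_carrier_iff\<close>)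
  have "(\<forall>w\<in>carrier_vec n. seg p w = seg a w) \<or> (\<forall>v\<in>lp_region P. \<forall>w\<in>lp_region P. v \<in> seg p w \<longleftrightarrow> v = a)"
  proof (cases "d = 0\<^sub>v n")
    case True
    then show ?thesis using shift by (auto simp: seg_lin)
  next
    case d: False
    have "v \<in> seg p w \<longleftrightarrow> v = a" if v: "v \<in> lp_region P" and w: "w \<in> lp_region P" for v w
    proof
      have wc: "w \<in> carrier_vec n" using w by (simp add: lp_region_iff)
      show "v = a \<Longrightarrow> v \<in> seg p w"
        using shift[OF wc, of 0] ac wc dc by (auto simp: seg_lin intro!: exI[of _ 0])
      assume "v \<in> seg p w"
      then obtain t where t: "v = lin t a (w + d)" "0 \<le> t" using shift[OF wc] by (auto simp: seg_lin)
      show "v = a"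
      proof (rule ccontr)
        assume "v \<noteq> a"
        then have "t \<noteq> 0" using t(1) ac wc dc by auto
        have row: "row (rmat P) r \<bullet> d = 0" if r: "r < m" for r
        proof -
          let ?r = "row (rmat P) r"
          have rc: "?r \<in> carrier_vec n" using rmat by auto
          have "?r \<bullet> v = (1 - t) * (?r \<bullet> a) + t * (?r \<bullet> (w + d))"
            unfolding t(1) using affine_funD[OF affine_fun_scalar_prod[OF rc]] ac wc dc by simp
          moreover have "?r \<bullet> (w + d) = ?r \<bullet> w + ?r \<bullet> d"
            using scalar_prod_add_distrib[OF rc wc dc] .
          ultimately have "t * (?r \<bullet> d) = 0" using v w alp r by (simp add: lp_region_iff algebra_simps)
          then show ?thesis using \<open>t \<noteq> 0\<close> by simp
        qed
        have nonneg: "0 \<le> d $ i" if i: "i < n" for i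
        proof -
          have "a $ i = p $ i" using lin_index_gen[OF qc i, of 0 p] by (simp add: a_def)
          then show ?thesis using alp i by (auto simp: d_def lp_region_iff)
        qed
        show False using no_recession_direction[OF alp dc row nonneg] d by blast
      qed
    qed
    then show ?thesis by blast
  qed
  with that ac bc eq f show ?thesis by simp
qed

end

lemma while_simulation:
  assumes init: "R s s'" and b: "\<And>s s'. R s s' \<Longrightarrow> b s \<longleftrightarrow> b s'"
    and step: "\<And>s s'. R s s' \<Longrightarrow> R (f s) (f' s')" and out: "\<And>s s'. R s s' \<Longrightarrow> out s = out s'"
  shows "out (while b f s) = out (while b f' s')"
proof -
  have R: "R ((f ^^ k) s) ((f' ^^ k) s')" for k
    by (induction k) (use init step in auto)
  have *: "b ((f ^^ k) s) \<longleftrightarrow> b ((f' ^^ k) s')" for k using b[OF R] .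
  show ?thesis
  proof (cases "\<exists>k. \<not> b ((f ^^ k) s)")
    case True
    then show ?thesis using out[OF R] by (simp add: while_def while_option_def *)
  next
    case False
    then show ?thesis by (simp add: while_def while_option_def *)
  qed
qed

lemma Ints_iff_floor_ceiling: "(x :: real) \<in> \<int> \<longleftrightarrow> \<lfloor>x\<rfloor> = \<lceil>x\<rceil>"
  by (metis Ints_cases ceiling_of_int floor_of_int Ints_of_int ceiling_correct floor_correct order_antisym le_of_int_ceiling of_int_floor_le)

text \<open>
  Two similar cuts lead to the same tree. Points and LP values of the two runs differ, but are named by
  the same symbols, so that every decision is the same.
\<close>

locale similar_cuts = bounded_ip P m n for P m n +
  fixes D :: "ip set" and \<rho> :: rules and G G' :: "real vec \<Rightarrow> real"
  assumes PD: "P \<in> D" and valid: "valid_rules D \<rho>" and n1: "1 \<le> n"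
    and G: "affine_fun n G" and G': "affine_fun n G'" and sim: "similar P G G'"
begin

abbreviation "H \<equiv> cut_region n G"
abbreviation "H' \<equiv> cut_region n G'"
abbreviation "c x \<equiv> obj P \<bullet> x"

lemma node1: "finite \<sigma> \<Longrightarrow> cut_node P m n G \<sigma> (opt0 \<rho> P \<sigma>)"
  and node2: "finite \<sigma> \<Longrightarrow> cut_node P m n G' \<sigma> (opt0 \<rho> P \<sigma>)"
  using bounded_ip_axioms G G' valid PD
  by (auto simp: cut_node_def cut_node_axioms_def valid_rules_def)

lemma sign_iff: "w \<in> node_vertices P \<Longrightarrow> 0 \<le> G w \<longleftrightarrow> 0 \<le> G' w"
  using sim by (simp add: similar_def)

lemma floor_eq: "y \<in> symbols P G \<Longrightarrow> i < n \<Longrightarrow> \<lfloor>pt G y $ i\<rfloor> = \<lfloor>pt G' y $ i\<rfloor>"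
  and ceiling_eq: "y \<in> symbols P G \<Longrightarrow> i < n \<Longrightarrow> \<lceil>pt G y $ i\<rceil> = \<lceil>pt G' y $ i\<rceil>"
  using sim unfolding similar_def num_vars by blast+

lemma gap_le_iff:
  "d1 \<in> gaps P G \<Longrightarrow> d2 \<in> gaps P G \<Longrightarrow> d3 \<in> gaps P G \<Longrightarrow> d4 \<in> gaps P G \<Longrightarrow>
   gap_value P G d1 * gap_value P G d2 \<le> gap_value P G d3 * gap_value P G d4 \<longleftrightarrow>
   gap_value P G' d1 * gap_value P G' d2 \<le> gap_value P G' d3 * gap_value P G' d4"
  using sim unfolding similar_def by blast

lemma gaps_const: "Const 0 \<in> gaps P G" "Const 1 \<in> gaps P G" "Const (1 / 10 ^ 6) \<in> gaps P G"
  and gaps_diff: "y \<in> symbols P G \<Longrightarrow> y' \<in> symbols P G \<Longrightarrow> Diff y y' \<in> gaps P G"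
  unfolding gaps_def by blast+

lemma gap_le_const_iff:
  assumes "d \<in> gaps P G" "Const r \<in> gaps P G"
  shows "gap_value P G d \<le> r \<longleftrightarrow> gap_value P G' d \<le> r"
  using gap_le_iff[OF assms(1) gaps_const(2) assms(2) gaps_const(2)] by simp

lemma point_le_iff:
  assumes "y \<in> symbols P G" "y' \<in> symbols P G"
  shows "c (pt G y) \<le> c (pt G y') \<longleftrightarrow> c (pt G' y) \<le> c (pt G' y')"
  using gap_le_const_iff[OF gaps_diff[OF assms] gaps_const(1)] by simp

lemma node_vertex: "finite \<sigma> \<Longrightarrow> vertex_of w (node_region P \<sigma>) \<Longrightarrow> w \<in> node_vertices P"
  by (auto simp: node_vertices_def)

lemma candidates_eq: "finite \<sigma> \<Longrightarrow> candidates P G \<sigma> = candidates P G' \<sigma>"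
  using sign_iff node_vertex by (force simp: candidates_def not_le[symmetric])

lemma candidates_symbols: "finite \<sigma> \<Longrightarrow> candidates P G \<sigma> \<subseteq> symbols P G"
  using node_vertex by (auto simp: candidates_def symbols_def)

lemma best_symbols: "finite \<sigma> \<Longrightarrow> best P G \<sigma> \<subseteq> symbols P G"
  using candidates_symbols by (auto simp: best_def)

lemma best_eq: "finite \<sigma> \<Longrightarrow> best P G \<sigma> = best P G' \<sigma>"
  using point_le_iff candidates_symbols candidates_eq unfolding best_def by (metis (no_types, lifting) subsetD)

lemma value_cases:
  assumes "finite \<sigma>"
  shows "(node_region P \<sigma> \<inter> H = {} \<and> node_region P \<sigma> \<inter> H' = {} \<and>
      lp_value P H \<sigma> = -\<infinity> \<and> lp_value P H' \<sigma> = -\<infinity>) \<or>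
    (node_region P \<sigma> \<inter> H \<noteq> {} \<and> node_region P \<sigma> \<inter> H' \<noteq> {} \<and>
      (\<exists>y\<in>symbols P G. lp_value P H \<sigma> = ereal (c (pt G y)) \<and> lp_value P H' \<sigma> = ereal (c (pt G' y))))"
proof -
  interpret A: cut_node P m n G \<sigma> "opt0 \<rho> P \<sigma>" by (rule node1[OF assms])
  interpret B: cut_node P m n G' \<sigma> "opt0 \<rho> P \<sigma>" by (rule node2[OF assms])
  show ?thesis
  proof (cases "candidates P G \<sigma> = {}")
    case True
    then show ?thesis
      using A.feasible_iff B.feasible_iff A.value_infeasible B.value_infeasible candidates_eq[OF assms] by auto
  next
    case False
    then obtain y where y: "y \<in> best P G \<sigma>" using A.best_nonempty by blast
    then have "lp_value P H \<sigma> = ereal (c (pt G y))" "lp_value P H' \<sigma> = ereal (c (pt G' y))"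
      using A.value_best B.value_best best_eq[OF assms] by auto
    moreover have "y \<in> symbols P G" using y best_symbols[OF assms] by blast
    ultimately show ?thesis using False A.feasible_iff B.feasible_iff candidates_eq[OF assms] by auto
  qed
qed

lemma feasible_eq: "finite \<sigma> \<Longrightarrow> node_region P \<sigma> \<inter> H = {} \<longleftrightarrow> node_region P \<sigma> \<inter> H' = {}"
  using value_cases by blast

lemma value_le_iff:
  assumes "finite \<sigma>" "finite \<tau>"
  shows "lp_value P H \<sigma> \<le> lp_value P H \<tau> \<longleftrightarrow> lp_value P H' \<sigma> \<le> lp_value P H' \<tau>"
  using value_cases[OF assms(1)] value_cases[OF assms(2)] point_le_iff by auto

lemma gap_cases:
  assumes "finite \<sigma>" "finite \<tau>" "node_region P \<sigma> \<inter> H \<noteq> {}"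
  defines "g \<equiv> \<lambda>K. max (lp_value P K \<sigma> - lp_value P K \<tau>) (ereal (1 / 10 ^ 6))"
  shows "g H = \<infinity> \<and> g H' = \<infinity> \<or>
    (\<exists>d\<in>gaps P G. g H = ereal (gap_value P G d) \<and> g H' = ereal (gap_value P G' d) \<and>
      0 < gap_value P G d \<and> 0 < gap_value P G' d)"
proof -
  obtain y where y: "y \<in> symbols P G" "lp_value P H \<sigma> = ereal (c (pt G y))" "lp_value P H' \<sigma> = ereal (c (pt G' y))"
    using value_cases[OF assms(1)] assms(3) by blast
  from value_cases[OF assms(2)] show ?thesis
  proof
    assume "node_region P \<tau> \<inter> H = {} \<and> node_region P \<tau> \<inter> H' = {} \<and>
      lp_value P H \<tau> = -\<infinity> \<and> lp_value P H' \<tau> = -\<infinity>"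
    then show ?thesis using y by (simp add: g_def)
  next
    assume "node_region P \<tau> \<inter> H \<noteq> {} \<and> node_region P \<tau> \<inter> H' \<noteq> {} \<and>
      (\<exists>y\<in>symbols P G. lp_value P H \<tau> = ereal (c (pt G y)) \<and> lp_value P H' \<tau> = ereal (c (pt G' y)))"
    then obtain y' where y': "y' \<in> symbols P G" "lp_value P H \<tau> = ereal (c (pt G y'))"
      "lp_value P H' \<tau> = ereal (c (pt G' y'))" by blast
    let ?d = "Diff y y'"
    have d: "?d \<in> gaps P G" using y y' gaps_diff by blast
    have gH: "g H = ereal (max (gap_value P G ?d) (1 / 10 ^ 6))" "g H' = ereal (max (gap_value P G' ?d) (1 / 10 ^ 6))"
      unfolding g_def y y' by (simp_all add: max_def)
    show ?thesis
    proof (cases "gap_value P G ?d \<le> 1 / 10 ^ 6")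
      case True
      then have "gap_value P G' ?d \<le> 1 / 10 ^ 6" using gap_le_const_iff[OF d gaps_const(3)] by simp
      then show ?thesis using True gH gaps_const(3)
        by (intro disjI2 bexI[of _ "Const (1 / 10 ^ 6)"]) (auto simp: max_def)
    next
      case False
      then have "\<not> gap_value P G' ?d \<le> 1 / 10 ^ 6" using gap_le_const_iff[OF d gaps_const(3)] by simp
      then show ?thesis using False gH d
        by (intro disjI2 bexI[of _ ?d]) (auto simp: max_def simp del: gap_value.simps)
    qed
  qed
qed

lemma score_cases:
  assumes "finite \<sigma>" "node_region P \<sigma> \<inter> H \<noteq> {}" "\<lfloor>x $ i\<rfloor> = \<lfloor>x' $ i\<rfloor>" "\<lceil>x $ i\<rceil> = \<lceil>x' $ i\<rceil>"
  shows "score P H \<sigma> x i = \<infinity> \<and> score P H' \<sigma> x' i = \<infinity> \<or>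
    (\<exists>d1\<in>gaps P G. \<exists>d2\<in>gaps P G. score P H \<sigma> x i = ereal (gap_value P G d1 * gap_value P G d2) \<and>
      score P H' \<sigma> x' i = ereal (gap_value P G' d1 * gap_value P G' d2))"
proof -
  have f: "finite (insert (Le i \<lfloor>x' $ i\<rfloor>) \<sigma>)" "finite (insert (Ge i \<lceil>x' $ i\<rceil>) \<sigma>)" using assms by auto
  show ?thesis
    using gap_cases[OF assms(1) f(1) assms(2)] gap_cases[OF assms(1) f(2) assms(2)]
    unfolding score_def assms(3,4) by (elim disjE bexE) auto
qed

lemma score_le_iff:
  assumes "finite \<sigma>" "node_region P \<sigma> \<inter> H \<noteq> {}"
    and x: "\<And>i. i < n \<Longrightarrow> \<lfloor>x $ i\<rfloor> = \<lfloor>x' $ i\<rfloor>" "\<And>i. i < n \<Longrightarrow> \<lceil>x $ i\<rceil> = \<lceil>x' $ i\<rceil>"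
    and ij: "i < n" "j < n"
  shows "score P H \<sigma> x i \<le> score P H \<sigma> x j \<longleftrightarrow> score P H' \<sigma> x' i \<le> score P H' \<sigma> x' j"
  using score_cases[OF assms(1,2) x[OF ij(1)]] score_cases[OF assms(1,2) x[OF ij(2)]]
  by (elim disjE bexE conjE) (simp_all add: gap_le_iff)

lemma branch_var_eq:
  assumes "finite \<sigma>" "node_region P \<sigma> \<inter> H \<noteq> {}"
    and x: "\<And>i. i < n \<Longrightarrow> \<lfloor>x $ i\<rfloor> = \<lfloor>x' $ i\<rfloor>" "\<And>i. i < n \<Longrightarrow> \<lceil>x $ i\<rceil> = \<lceil>x' $ i\<rceil>"
  shows "branch_var \<rho> P H \<sigma> x = branch_var \<rho> P H' \<sigma> x'" "branch_var \<rho> P H \<sigma> x < n"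
proof -
  have "(\<lambda>i. i < n \<and> (\<forall>j<n. score P H \<sigma> x j \<le> score P H \<sigma> x i)) =
      (\<lambda>i. i < n \<and> (\<forall>j<n. score P H' \<sigma> x' j \<le> score P H' \<sigma> x' i))"
    using score_le_iff[OF assms(1,2) x] by blast
  then show "branch_var \<rho> P H \<sigma> x = branch_var \<rho> P H' \<sigma> x'"
    unfolding branch_var_def num_vars by (rule arg_cong)
  have "Max (score P H \<sigma> x ` {..<n}) \<in> score P H \<sigma> x ` {..<n}"
    using n1 by (intro Max_in) (auto simp: lessThan_empty_iff)
  then obtain k where "k < n" "score P H \<sigma> x k = Max (score P H \<sigma> x ` {..<n})" by auto
  then have "k < n \<and> (\<forall>j<n. score P H \<sigma> x j \<le> score P H \<sigma> x k)" by simp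
  from arg_min_natI[where P = "\<lambda>i. i < n \<and> (\<forall>j<n. score P H \<sigma> x j \<le> score P H \<sigma> x i)" and m = "rank \<rho>", OF this]
  show "branch_var \<rho> P H \<sigma> x < n" unfolding branch_var_def num_vars by blast
qed

text \<open>
  The best symbols agree, hence so do the edges that contain an optimal vertex, hence the edge picked
  among them, and finally the symbol of the optimum that is nearest to the end of the edge. In the
  degenerate orientation of \<open>edge_orientation\<close> the optimum is the end \<open>a\<close> for both cuts, or the same
  unspecified vector for both.
\<close>

lemma lp_opt_rounding:
  assumes fin: "finite \<sigma>" and feas: "node_region P \<sigma> \<inter> H \<noteq> {}" and i: "i < n"
  shows "\<lfloor>lp_opt \<rho> P H \<sigma> $ i\<rfloor> = \<lfloor>lp_opt \<rho> P H' \<sigma> $ i\<rfloor> \<and> \<lceil>lp_opt \<rho> P H \<sigma> $ i\<rceil> = \<lceil>lp_opt \<rho> P H' \<sigma> $ i\<rceil>"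
proof -
  interpret A: cut_node P m n G \<sigma> "opt0 \<rho> P \<sigma>" by (rule node1[OF fin])
  interpret B: cut_node P m n G' \<sigma> "opt0 \<rho> P \<sigma>" by (rule node2[OF fin])
  let ?Q = "node_region P \<sigma>"
  let ?z = "opt0 \<rho> P \<sigma>"
  have feas': "?Q \<inter> H' \<noteq> {}" using feas feasible_eq[OF fin] by blast
  have "vertex_of ?z ?Q" using A.z_optimal feas by blast
  then have zW: "?z \<in> node_vertices P" "?z \<in> carrier_vec n" using node_vertex[OF fin] node_vertices_carrier by auto
  have zH: "?z \<in> H \<longleftrightarrow> ?z \<in> H'" using sign_iff zW by (simp add: cut_region_def)
  show ?thesis
  proof (cases "?z \<in> H")
    case True
    then show ?thesis using zH by (simp add: lp_opt_def)
  next
    case False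
    let ?V = "optimal_vertices P H \<sigma>" and ?V' = "optimal_vertices P H' \<sigma>"
    let ?E = "{e \<in> edges ?Q. e \<inter> ?V \<noteq> {}}" and ?E' = "{e \<in> edges ?Q. e \<inter> ?V' \<noteq> {}}"
    have "e \<inter> ?V \<noteq> {} \<longleftrightarrow> e \<inter> ?V' \<noteq> {}" if e: "e \<in> edges ?Q" for e
    proof -
      obtain p q where pq: "p \<in> carrier_vec n" "q \<in> carrier_vec n" "e = seg p q" "is_face (seg p q) ?Q"
        using edges_face[OF e A.Q_carrier] by metis
      show ?thesis
        using A.optimal_on_face[OF pq(4,1,2)] B.optimal_on_face[OF pq(4,1,2)] best_eq[OF fin] pq(3)
        by (simp add: Int_commute)
    qed
    then have EE: "?E = ?E'" by blast
    obtain e where "e \<in> ?E" using A.optimal_edge[OF feas False] by blast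
    obtain p q where pick: "pick \<rho> P \<sigma> ?E = (p, q)" by (cases "pick \<rho> P \<sigma> ?E")
    have pick_valid: "\<forall>P\<in>D. \<forall>\<sigma> E. finite \<sigma> \<and> E \<noteq> {} \<and> E \<subseteq> edges (node_region P \<sigma>) \<longrightarrow>
        (case pick \<rho> P \<sigma> E of (p, q) \<Rightarrow> seg p q \<in> E)"
      using valid unfolding valid_rules_def by (elim conjE)
    have "finite \<sigma> \<and> ?E \<noteq> {} \<and> ?E \<subseteq> edges ?Q" using \<open>e \<in> ?E\<close> fin by blast
    then have "case pick \<rho> P \<sigma> ?E of (p, q) \<Rightarrow> seg p q \<in> ?E"
      by (rule bspec[OF pick_valid PD, THEN spec, THEN spec, THEN mp])
    then have pqE: "seg p q \<in> edges ?Q" "seg p q \<inter> ?V \<noteq> {}" using pick by auto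
    define S where "S = ?V \<inter> seg p q"
    define S' where "S' = ?V' \<inter> seg p q"
    have opt: "lp_opt \<rho> P H \<sigma> = (THE v. v \<in> S \<and> (\<forall>w\<in>S. v \<in> seg p w))"
      using False pick by (simp add: lp_opt_def S_def Let_def)
    have opt': "lp_opt \<rho> P H' \<sigma> = (THE v. v \<in> S' \<and> (\<forall>w\<in>S'. v \<in> seg p w))"
      using False zH pick EE by (simp add: lp_opt_def S'_def Let_def)
    obtain a b where ab: "a \<in> carrier_vec n" "b \<in> carrier_vec n" "seg p q = seg a b" "is_face (seg a b) ?Q"
      and orient: "(\<forall>w\<in>carrier_vec n. seg p w = seg a w) \<or>
        (\<forall>v\<in>lp_region P. \<forall>w\<in>lp_region P. v \<in> seg p w \<longleftrightarrow> v = a)"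
      by (rule edge_orientation[OF pqE(1)]) (rule that; assumption)
    have S: "S = pt G ` (best P G \<sigma> \<inter> on_edge a b)" "S' = pt G' ` (best P G \<sigma> \<inter> on_edge a b)"
      using A.optimal_on_face[OF ab(4,1,2)] B.optimal_on_face[OF ab(4,1,2)] best_eq[OF fin] ab(3)
      by (auto simp: S_def S'_def)
    have ne: "best P G \<sigma> \<inter> on_edge a b \<noteq> {}" using S(1) pqE(2) by (auto simp: S_def)
    have SQ: "S \<subseteq> ?Q" "S' \<subseteq> ?Q" by (auto simp: S_def S'_def optimal_vertices_def vertex_of_def)
    then have Sc: "S \<subseteq> carrier_vec n" "S' \<subseteq> carrier_vec n" "S \<subseteq> lp_region P" "S' \<subseteq> lp_region P"
      using A.Q_carrier by (auto simp: node_region_def)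
    from orient show ?thesis
    proof
      assume o: "\<forall>w\<in>carrier_vec n. seg p w = seg a w"
      have "(\<forall>w\<in>S. v \<in> seg p w) \<longleftrightarrow> (\<forall>w\<in>S. v \<in> seg a w)" "(\<forall>w\<in>S'. v \<in> seg p w) \<longleftrightarrow> (\<forall>w\<in>S'. v \<in> seg a w)" for v
        using o Sc by blast+
      then have "lp_opt \<rho> P H \<sigma> = pt G (nearest_symbol a b (best P G \<sigma>))" "lp_opt \<rho> P H' \<sigma> = pt G' (nearest_symbol a b (best P G \<sigma>))"
        "nearest_symbol a b (best P G \<sigma>) \<in> best P G \<sigma>"
        using A.nearest_on_face[OF ab(4,1,2) ne] B.nearest_on_face[OF ab(4,1,2)] ne best_eq[OF fin]
        unfolding opt opt' S_def S'_def ab(3) by simp_all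
      moreover from this have "nearest_symbol a b (best P G \<sigma>) \<in> symbols P G" using subsetD[OF best_symbols[OF fin]] by blast
      ultimately show ?thesis using floor_eq[OF _ i] ceiling_eq[OF _ i] by simp
    next
      assume o: "\<forall>v\<in>lp_region P. \<forall>w\<in>lp_region P. v \<in> seg p w \<longleftrightarrow> v = a"
      have va: "vertex_of a ?Q" using face_ends[OF ab(4) A.Q_carrier ab(1,2)] by blast
      have "(a, a) \<in> best P G \<sigma> \<Longrightarrow> a \<in> S \<and> a \<in> S'" unfolding S by (force simp: on_edge_def)
      moreover have "(a, a) \<in> best P G \<sigma>" if "a \<in> S"
      proof -
        have "a \<in> H" "lp_value P H \<sigma> = ereal (c (pt G (a, a)))"
          using that by (auto simp: S_def optimal_vertices_def vertex_of_def)
        moreover from this have "(a, a) \<in> candidates P G \<sigma>" using va by (simp add: candidates_def cut_region_def)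
        ultimately show ?thesis using A.best_optimal[OF A.value_attained[OF feas]] by blast
      qed
      moreover have "(a, a) \<in> best P G' \<sigma>" if "a \<in> S'"
      proof -
        have "a \<in> H'" "lp_value P H' \<sigma> = ereal (c (pt G' (a, a)))"
          using that by (auto simp: S'_def optimal_vertices_def vertex_of_def)
        moreover from this have "(a, a) \<in> candidates P G' \<sigma>" using va by (simp add: candidates_def cut_region_def)
        ultimately show ?thesis using B.best_optimal[OF B.value_attained[OF feas']] by blast
      qed
      ultimately have aS: "a \<in> S \<longleftrightarrow> a \<in> S'" using best_eq[OF fin] by blast
      have S_iff: "(v \<in> T \<and> (\<forall>w\<in>T. v \<in> seg p w)) \<longleftrightarrow> v = a \<and> a \<in> T"
        if "T \<noteq> {}" "T \<subseteq> lp_region P" for v T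
      proof -
        have "v \<in> seg p w \<longleftrightarrow> v = a" if "v \<in> T" "w \<in> T" for v w
          using bspec[OF bspec[OF o]] subsetD[OF \<open>T \<subseteq> lp_region P\<close>] that by simp
        then show ?thesis by auto
      qed
      have "S \<noteq> {}" "S' \<noteq> {}" using ne S by auto
      then have "(v \<in> S \<and> (\<forall>w\<in>S. v \<in> seg p w)) \<longleftrightarrow> v = a \<and> a \<in> S"
        "(v \<in> S' \<and> (\<forall>w\<in>S'. v \<in> seg p w)) \<longleftrightarrow> v = a \<and> a \<in> S'" for v
        using S_iff Sc(3,4) by simp_all
      then show ?thesis unfolding opt opt' aS by simp
    qed
  qed
qed

text \<open>
  The incumbents of the two runs are LP values of a common set of branching constraints, which makes
  them comparable with the values of other nodes.
\<close>

definition related :: "state \<Rightarrow> state \<Rightarrow> bool" where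
  "related s s' \<longleftrightarrow> tree s = tree s' \<and> leaves s = leaves s' \<and>
     (incumbent s = -\<infinity> \<and> incumbent s' = -\<infinity> \<or>
      (\<exists>\<sigma>. finite \<sigma> \<and> incumbent s = lp_value P H \<sigma> \<and> incumbent s' = lp_value P H' \<sigma>))"

lemma incumbent_max:
  assumes "related s s'" "finite \<sigma>"
  shows "max (incumbent s) (lp_value P H \<sigma>) = -\<infinity> \<and> max (incumbent s') (lp_value P H' \<sigma>) = -\<infinity> \<or>
    (\<exists>\<tau>. finite \<tau> \<and> max (incumbent s) (lp_value P H \<sigma>) = lp_value P H \<tau> \<and>
      max (incumbent s') (lp_value P H' \<sigma>) = lp_value P H' \<tau>)"
  using assms value_le_iff[OF _ assms(2)] unfolding related_def max_def by auto

lemma prune_iff: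
  assumes "related s s'" "finite \<sigma>"
  shows "lp_value P H \<sigma> \<le> incumbent s \<longleftrightarrow> lp_value P H' \<sigma> \<le> incumbent s'"
  using assms value_le_iff[OF assms(2)] value_cases[OF assms(2)] unfolding related_def by auto

lemma step_related:
  assumes r: "related s s'"
  shows "related (bc_step \<rho> \<kappa> P H s) (bc_step \<rho> \<kappa> P H' s')"
proof -
  define \<nu> where "\<nu> = select \<rho> P (tree s) (leaves s)
    {(\<mu>, \<nu>). \<mu> \<in> tree s \<and> \<nu> \<in> tree s \<and> lp_value P H (set \<mu>) \<le> lp_value P H (set \<nu>)}"
  have \<nu>': "\<nu> = select \<rho> P (tree s') (leaves s')
    {(\<mu>, \<nu>). \<mu> \<in> tree s' \<and> \<nu> \<in> tree s' \<and> lp_value P H' (set \<mu>) \<le> lp_value P H' (set \<nu>)}"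
    using r value_le_iff by (simp add: \<nu>_def related_def)
  define \<sigma> where "\<sigma> = set \<nu>"
  have fin: "finite \<sigma>" by (simp add: \<sigma>_def)
  define x where "x = lp_opt \<rho> P H \<sigma>"
  define x' where "x' = lp_opt \<rho> P H' \<sigma>"
  have t: "tree s' = tree s" "leaves s' = leaves s" using r by (auto simp: related_def)
  define i where "i = branch_var \<rho> P H \<sigma> x"
  define i' where "i' = branch_var \<rho> P H' \<sigma> x'"
  have step: "bc_step \<rho> \<kappa> P H s =
     (if node_region P \<sigma> \<inter> H = {} then s\<lparr>leaves := leaves s - {\<nu>}\<rparr>
      else if \<forall>i<n. x $ i \<in> \<int> then s\<lparr>leaves := leaves s - {\<nu>}, incumbent := max (incumbent s) (lp_value P H \<sigma>)\<rparr>
      else if lp_value P H \<sigma> \<le> incumbent s then s\<lparr>leaves := leaves s - {\<nu>}\<rparr>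
      else if card (tree s) + 2 > \<kappa> then s\<lparr>leaves := {}\<rparr>
      else s\<lparr>leaves := leaves s - {\<nu>} \<union> {Le i \<lfloor>x $ i\<rfloor> # \<nu>, Ge i \<lceil>x $ i\<rceil> # \<nu>},
             tree := tree s \<union> {Le i \<lfloor>x $ i\<rfloor> # \<nu>, Ge i \<lceil>x $ i\<rceil> # \<nu>}\<rparr>)"
    unfolding bc_step_def Let_def num_vars \<nu>_def[symmetric] \<sigma>_def[symmetric] x_def[symmetric] i_def[symmetric]
    by (intro if_cong refl) simp_all
  have step': "bc_step \<rho> \<kappa> P H' s' =
     (if node_region P \<sigma> \<inter> H' = {} then s'\<lparr>leaves := leaves s - {\<nu>}\<rparr>
      else if \<forall>i<n. x' $ i \<in> \<int> then s'\<lparr>leaves := leaves s - {\<nu>}, incumbent := max (incumbent s') (lp_value P H' \<sigma>)\<rparr>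
      else if lp_value P H' \<sigma> \<le> incumbent s' then s'\<lparr>leaves := leaves s - {\<nu>}\<rparr>
      else if card (tree s) + 2 > \<kappa> then s'\<lparr>leaves := {}\<rparr>
      else s'\<lparr>leaves := leaves s - {\<nu>} \<union> {Le i' \<lfloor>x' $ i'\<rfloor> # \<nu>, Ge i' \<lceil>x' $ i'\<rceil> # \<nu>},
             tree := tree s \<union> {Le i' \<lfloor>x' $ i'\<rfloor> # \<nu>, Ge i' \<lceil>x' $ i'\<rceil> # \<nu>}\<rparr>)"
    unfolding bc_step_def Let_def num_vars \<nu>'[symmetric] \<sigma>_def[symmetric] x'_def[symmetric] i'_def[symmetric]
    by (intro if_cong refl) (simp_all add: t)
  show ?thesis
  proof (cases "node_region P \<sigma> \<inter> H = {}")
    case True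
    then show ?thesis using r feasible_eq[OF fin] unfolding step step' by (auto simp: related_def)
  next
    case feas: False
    then have feas': "node_region P \<sigma> \<inter> H' \<noteq> {}" using feasible_eq[OF fin] by blast
    have fl: "\<And>i. i < n \<Longrightarrow> \<lfloor>x $ i\<rfloor> = \<lfloor>x' $ i\<rfloor>" and ce: "\<And>i. i < n \<Longrightarrow> \<lceil>x $ i\<rceil> = \<lceil>x' $ i\<rceil>"
      using lp_opt_rounding[OF fin feas] by (auto simp: x_def x'_def)
    have int: "(\<forall>i<n. x $ i \<in> \<int>) \<longleftrightarrow> (\<forall>i<n. x' $ i \<in> \<int>)" using fl ce by (auto simp: Ints_iff_floor_ceiling)
    have ii: "i' = i" "i < n" using branch_var_eq[OF fin feas fl ce] by (auto simp: i_def i'_def)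
    then have kids: "\<lfloor>x' $ i\<rfloor> = \<lfloor>x $ i\<rfloor>" "\<lceil>x' $ i\<rceil> = \<lceil>x $ i\<rceil>" using fl ce by auto
    have inc: "incumbent s = -\<infinity> \<and> incumbent s' = -\<infinity> \<or>
        (\<exists>\<sigma>. finite \<sigma> \<and> incumbent s = lp_value P H \<sigma> \<and> incumbent s' = lp_value P H' \<sigma>)"
      using r by (simp add: related_def)
    show ?thesis
    proof (cases "\<forall>i<n. x $ i \<in> \<int>")
      case True
      have "bc_step \<rho> \<kappa> P H s =
          s\<lparr>leaves := leaves s - {\<nu>}, incumbent := max (incumbent s) (lp_value P H \<sigma>)\<rparr>"
        unfolding step if_not_P[OF feas] if_P[OF True] ..
      moreover have "bc_step \<rho> \<kappa> P H' s' =
          s'\<lparr>leaves := leaves s - {\<nu>}, incumbent := max (incumbent s') (lp_value P H' \<sigma>)\<rparr>"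
        unfolding step' if_not_P[OF feas'] if_P[OF int[THEN iffD1, OF True]] ..
      ultimately show ?thesis using incumbent_max[OF r fin] t by (simp add: related_def)
    next
      case False
      with int have nint: "\<not> (\<forall>i<n. x' $ i \<in> \<int>)" by blast
      show ?thesis
      proof (cases "lp_value P H \<sigma> \<le> incumbent s")
        case True
        then have "lp_value P H' \<sigma> \<le> incumbent s'" using prune_iff[OF r fin] by blast
        then show ?thesis unfolding step step' if_not_P[OF feas] if_not_P[OF feas'] if_not_P[OF False] if_not_P[OF nint]
          using True inc t by (simp add: related_def)
      next
        case gt: False
        then have gt': "\<not> lp_value P H' \<sigma> \<le> incumbent s'" using prune_iff[OF r fin] by blast
        show ?thesis unfolding step step' if_not_P[OF feas] if_not_P[OF feas'] if_not_P[OF False] if_not_P[OF nint]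
            if_not_P[OF gt] if_not_P[OF gt'] kids ii(1)
          using inc t by (cases "card (tree s) + 2 > \<kappa>") (simp_all add: related_def)
      qed
    qed
  qed
qed

lemma bc_tree_eq: "bc_tree \<rho> \<kappa> P H = bc_tree \<rho> \<kappa> P H'"
  unfolding bc_tree_def
proof (rule while_simulation[where R = related])
  fix s s' assume "related s s'"
  then show "leaves s \<noteq> {} \<longleftrightarrow> leaves s' \<noteq> {}" "tree s = tree s'"
    "related (bc_step \<rho> \<kappa> P H s) (bc_step \<rho> \<kappa> P H' s')"
    using step_related by (auto simp: related_def)
qed (simp add: related_def)

end

section \<open>Gomory cuts as polynomials in the multipliers\<close>

text \<open>
  The cut inequality multiplied by \<open>1 - f0 > 0\<close>, with the roundings \<open>k\<close>, \<open>k0\<close> and the set \<open>I\<close> of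
  coefficients that do not exceed \<open>f0\<close> as parameters. For fixed parameters it is a quadratic polynomial
  in \<open>u\<close>.
\<close>

definition gmi_form :: "ip \<Rightarrow> (nat \<Rightarrow> int) \<Rightarrow> int \<Rightarrow> nat set \<Rightarrow> real vec \<Rightarrow> real vec \<Rightarrow> real" where
  "gmi_form P k k0 I u v =
     (let f = (\<lambda>i. u \<bullet> col (rmat P) i - real_of_int (k i)); f0 = u \<bullet> rrhs P - real_of_int k0 in
      (\<Sum>i<num_vars P. (if i \<in> I then f i * (1 - f0) else f0 * (1 - f i)) * v $ i) - f0 * (1 - f0))"

definition gmi_fun :: "ip \<Rightarrow> real vec \<Rightarrow> real vec \<Rightarrow> real" where
  "gmi_fun P u = gmi_form P (\<lambda>i. \<lfloor>u \<bullet> col (rmat P) i\<rfloor>) \<lfloor>u \<bullet> rrhs P\<rfloor>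
     {i. frac (u \<bullet> col (rmat P) i) \<le> frac (u \<bullet> rrhs P)} u"

lemma gmi_cut_eq: "gmi_cut P u = cut_region (num_vars P) (gmi_fun P u)"
proof -
  define n where "n = num_vars P"
  define f where "f = (\<lambda>i. frac (u \<bullet> col (rmat P) i))"
  define f0 where "f0 = frac (u \<bullet> rrhs P)"
  have f0: "0 < 1 - f0" using frac_lt_1[of "u \<bullet> rrhs P"] by (simp add: f0_def)
  have "(\<Sum>i | i < n \<and> f i \<le> f0. f i * v $ i) + f0 / (1 - f0) * (\<Sum>i | i < n \<and> f i > f0. (1 - f i) * v $ i) \<ge> f0
      \<longleftrightarrow> 0 \<le> gmi_fun P u v" (is "?l \<ge> f0 \<longleftrightarrow> _") for v
  proof -
    let ?A = "\<Sum>i | i < n \<and> f i \<le> f0. f i * v $ i" and ?B = "\<Sum>i | i < n \<and> f i > f0. (1 - f i) * v $ i"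
    have "gmi_fun P u v = (\<Sum>i<n. (if f i \<le> f0 then f i * (1 - f0) else f0 * (1 - f i)) * v $ i) - f0 * (1 - f0)"
      by (simp add: gmi_fun_def gmi_form_def Let_def n_def f_def f0_def frac_def cong: if_cong)
    also have "(\<Sum>i<n. (if f i \<le> f0 then f i * (1 - f0) else f0 * (1 - f i)) * v $ i) =
        (\<Sum>i<n. if f i \<le> f0 then f i * (1 - f0) * v $ i else f0 * (1 - f i) * v $ i)"
      by (intro sum.cong) auto
    also have "\<dots> = (\<Sum>i\<in>{..<n} \<inter> {i. f i \<le> f0}. f i * (1 - f0) * v $ i) +
        (\<Sum>i\<in>{..<n} \<inter> - {i. f i \<le> f0}. f0 * (1 - f i) * v $ i)"
      by (rule sum.If_cases) simp
    also have "{..<n} \<inter> {i. f i \<le> f0} = {i. i < n \<and> f i \<le> f0}" by auto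
    also have "{..<n} \<inter> - {i. f i \<le> f0} = {i. i < n \<and> f i > f0}" by auto
    also have "(\<Sum>i | i < n \<and> f i \<le> f0. f i * (1 - f0) * v $ i) = (1 - f0) * ?A"
      by (simp add: sum_distrib_left mult_ac)
    also have "(\<Sum>i | i < n \<and> f i > f0. f0 * (1 - f i) * v $ i) = f0 * ?B"
      by (simp add: sum_distrib_left mult_ac)
    finally have eq: "gmi_fun P u v = (1 - f0) * ?A + f0 * ?B - f0 * (1 - f0)" .
    also have "\<dots> = (1 - f0) * (?l - f0)" using f0 by (simp add: field_simps)
    finally show ?thesis using f0 by (simp add: zero_le_mult_iff)
  qed
  then show ?thesis
    unfolding gmi_cut_def cut_region_def Let_def f_def[symmetric] f0_def[symmetric] n_def[symmetric]
    by (auto simp: f_def)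
qed

lemma affine_fun_gmi_form: "affine_fun (num_vars P) (gmi_form P k k0 I u)"
proof -
  define n where "n = num_vars P"
  define f where "f = (\<lambda>i. u \<bullet> col (rmat P) i - real_of_int (k i))"
  define f0 where "f0 = u \<bullet> rrhs P - real_of_int k0"
  define C where "C = (\<lambda>i. if i \<in> I then f i * (1 - f0) else f0 * (1 - f i))"
  have C: "gmi_form P k k0 I u = (\<lambda>v. (\<Sum>i<n. C i * v $ i) - f0 * (1 - f0))"
    unfolding gmi_form_def Let_def n_def C_def f_def f0_def by (rule ext) (rule refl)
  have "(\<Sum>i<n. C i * lin t p q $ i) = (1 - t) * (\<Sum>i<n. C i * p $ i) + t * (\<Sum>i<n. C i * q $ i)"
    if "p \<in> carrier_vec n" "q \<in> carrier_vec n" for p q t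
    unfolding sum_distrib_left sum.distrib[symmetric]
    using that by (intro sum.cong) (auto simp: algebra_simps)
  then show ?thesis unfolding affine_fun_def C n_def[symmetric] by (simp add: algebra_simps)
qed

lemma polyfun_scalar_prod:
  assumes "v \<in> carrier_vec m"
  shows "polyfun m 1 (\<lambda>x. vec m x \<bullet> v)"
proof -
  have "(\<lambda>x. vec m x \<bullet> v) = (\<lambda>x. \<Sum>r<m. v $ r * x r)"
    using assms by (auto simp: scalar_prod_def atLeast0LessThan mult.commute intro!: sum.cong)
  then show ?thesis by (auto intro!: polyfun_sum polyfun_scale polyfun_var)
qed

context bounded_ip
begin

lemma polyfun_gmi_form: "polyfun m 2 (\<lambda>x. gmi_form P k k0 I (vec m x) v)"
proof -
  have col: "polyfun m 1 (\<lambda>x. vec m x \<bullet> col (rmat P) i - real_of_int (k i))" if "i < n" for i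
    using rmat by (intro polyfun_diff polyfun_const polyfun_scalar_prod) auto
  have f0: "polyfun m 1 (\<lambda>x. vec m x \<bullet> rrhs P - real_of_int k0)"
    using rrhs by (intro polyfun_diff polyfun_const polyfun_scalar_prod) auto
  note f1 = polyfun_diff[OF polyfun_const[of m 1 1]]
  have "polyfun m 2 (\<lambda>x. (if i \<in> I
      then (vec m x \<bullet> col (rmat P) i - real_of_int (k i)) * (1 - (vec m x \<bullet> rrhs P - real_of_int k0))
      else (vec m x \<bullet> rrhs P - real_of_int k0) * (1 - (vec m x \<bullet> col (rmat P) i - real_of_int (k i)))) * v $ i)"
    if i: "i < n" for i
    using polyfun_scale[OF polyfun_mult[OF col[OF i] f1[OF f0], unfolded one_add_one], of "v $ i"]
      polyfun_scale[OF polyfun_mult[OF f0 f1[OF col[OF i]], unfolded one_add_one], of "v $ i"]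
    by (cases "i \<in> I") (simp_all add: mult.commute)
  moreover have "polyfun m 2 (\<lambda>x. (vec m x \<bullet> rrhs P - real_of_int k0) * (1 - (vec m x \<bullet> rrhs P - real_of_int k0)))"
    using polyfun_mult[OF f0 f1[OF f0], unfolded one_add_one] .
  ultimately show ?thesis
    unfolding gmi_form_def Let_def num_vars by (intro polyfun_diff polyfun_sum) auto
qed

end

section \<open>Sign conditions that determine the tree\<close>

lemma sgn_eqD:
  fixes x y :: real
  assumes "sgn x = sgn y"
  shows "0 \<le> x \<longleftrightarrow> 0 \<le> y" "x < 0 \<longleftrightarrow> y < 0" "x \<le> 0 \<longleftrightarrow> y \<le> 0"
  using assms by (auto simp: sgn_real_def split: if_splits)

text \<open>
  Comparisons with finitely many integers determine the integral part of a bounded number.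
\<close>

lemma floor_eq_of_signs:
  fixes v v' :: real
  assumes "\<And>k. k \<in> {lo..hi} \<Longrightarrow> sgn (v - real_of_int k) = sgn (v' - real_of_int k)"
    and "real_of_int lo \<le> v" "v < real_of_int hi"
  shows "\<lfloor>v'\<rfloor> = \<lfloor>v\<rfloor>"
proof -
  have k: "\<lfloor>v\<rfloor> \<in> {lo..hi}" "\<lfloor>v\<rfloor> + 1 \<in> {lo..hi}" using assms(2,3) by (auto simp: le_floor_iff) linarith+
  have "sgn (v - \<lfloor>v\<rfloor>) = sgn (v' - \<lfloor>v\<rfloor>)" "sgn (v - (\<lfloor>v\<rfloor> + 1)) = sgn (v' - (\<lfloor>v\<rfloor> + 1))"
    using assms(1)[OF k(1)] assms(1)[OF k(2)] by simp_all
  moreover have "v - \<lfloor>v\<rfloor> \<ge> 0" "v - (\<lfloor>v\<rfloor> + 1) < 0" by linarith+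
  ultimately have "v' - \<lfloor>v\<rfloor> \<ge> 0" "v' - (\<lfloor>v\<rfloor> + 1) < 0" using sgn_eqD by blast+
  then show ?thesis by linarith
qed

lemma rounding_eq_of_signs:
  fixes v v' :: real
  assumes s: "\<And>k. k \<in> {0..int \<tau>} \<Longrightarrow> sgn (v - real_of_int k) = sgn (v' - real_of_int k)"
    and v: "0 \<le> v" "v \<le> real \<tau>" "0 \<le> v'" "v' \<le> real \<tau>"
  shows "\<lfloor>v\<rfloor> = \<lfloor>v'\<rfloor> \<and> \<lceil>v\<rceil> = \<lceil>v'\<rceil>"
proof -
  have le: "real_of_int k \<le> v \<longleftrightarrow> real_of_int k \<le> v'" and ge: "v \<le> real_of_int k \<longleftrightarrow> v' \<le> real_of_int k" for k
  proof -
    have "(real_of_int k \<le> v \<longleftrightarrow> real_of_int k \<le> v') \<and> (v \<le> real_of_int k \<longleftrightarrow> v' \<le> real_of_int k)"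
    proof (cases "k \<in> {0..int \<tau>}")
      case True
      then show ?thesis using sgn_eqD(1,3)[OF s[OF True]] by simp
    next
      case False
      then consider "real_of_int k < 0" | "real \<tau> < real_of_int k" by fastforce
      then show ?thesis using v by cases auto
    qed
    then show "real_of_int k \<le> v \<longleftrightarrow> real_of_int k \<le> v'" "v \<le> real_of_int k \<longleftrightarrow> v' \<le> real_of_int k" by auto
  qed
  have "\<lfloor>v\<rfloor> = \<lfloor>v'\<rfloor>" using le by (metis le_floor_iff order_antisym order_refl)
  moreover have "\<lceil>v\<rceil> = \<lceil>v'\<rceil>" using ge by (metis ceiling_le_iff order_antisym order_refl)
  ultimately show ?thesis ..
qed

context bounded_ip
begin

context
  fixes g :: "(nat \<Rightarrow> real) \<Rightarrow> real vec \<Rightarrow> real"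
begin

text \<open>
  Values of affine functionals and of gaps at symbolic points are written as fractions of polynomials
  in \<open>x\<close>, where \<open>g x v\<close> is the value of the cut at \<open>v\<close>. The denominators are positive whenever the symbol
  is meaningful, so that comparisons become polynomial inequalities.
\<close>

fun point_num :: "(real vec \<Rightarrow> real) \<Rightarrow> real vec \<times> real vec \<Rightarrow> (nat \<Rightarrow> real) \<Rightarrow> real" where
  "point_num \<phi> (p, q) x = (if p = q then \<phi> p else \<phi> p * g x q - \<phi> q * g x p)"

fun point_den :: "real vec \<times> real vec \<Rightarrow> (nat \<Rightarrow> real) \<Rightarrow> real" where
  "point_den (p, q) x = (if p = q then 1 else g x q - g x p)"

fun gap_num :: "gap \<Rightarrow> (nat \<Rightarrow> real) \<Rightarrow> real" where
  "gap_num (Const r) x = r"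
| "gap_num (Diff y y') x =
     point_num (\<lambda>v. obj P \<bullet> v) y x * point_den y' x - point_num (\<lambda>v. obj P \<bullet> v) y' x * point_den y x"

fun gap_den :: "gap \<Rightarrow> (nat \<Rightarrow> real) \<Rightarrow> real" where
  "gap_den (Const r) x = 1"
| "gap_den (Diff y y') x = point_den y x * point_den y' x"

definition all_gaps :: "gap set" where
  "all_gaps = {Const 0, Const 1, Const (1 / 10 ^ 6)} \<union>
     (\<lambda>(y, y'). Diff y y') ` ((node_vertices P \<times> node_vertices P) \<times> (node_vertices P \<times> node_vertices P))"

definition tree_conditions :: "nat \<Rightarrow> ((nat \<Rightarrow> real) \<Rightarrow> real) set" where
  "tree_conditions \<tau> =
     (\<lambda>w x. g x w) ` node_vertices P \<union>
     (\<lambda>(y, i, k) x. point_num (\<lambda>v. v $ i - real_of_int k) y x) `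
       ((node_vertices P \<times> node_vertices P) \<times> {..<n} \<times> {0..int \<tau>}) \<union>
     (\<lambda>(d1, d2, d3, d4) x. gap_num d1 x * gap_num d2 x * (gap_den d3 x * gap_den d4 x) -
        gap_num d3 x * gap_num d4 x * (gap_den d1 x * gap_den d2 x)) `
       (all_gaps \<times> all_gaps \<times> all_gaps \<times> all_gaps)"

lemma polyfun_tree_conditions:
  assumes g: "\<And>w. polyfun m 2 (\<lambda>x. g x w)" and f: "f \<in> tree_conditions \<tau>"
  shows "polyfun m 16 f"
proof -
  have pn: "polyfun m 2 (point_num \<phi> y)" for \<phi> y
  proof (cases y)
    case (Pair p q)
    have "polyfun m 2 (\<lambda>x. \<phi> p * g x q - \<phi> q * g x p)" using g by (intro polyfun_diff polyfun_scale)
    moreover have "point_num \<phi> y = (\<lambda>x. if p = q then \<phi> p else \<phi> p * g x q - \<phi> q * g x p)"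
      unfolding Pair by (rule ext) simp
    ultimately show ?thesis using polyfun_const[of m 2 "\<phi> p"] by (cases "p = q") simp_all
  qed
  have pd: "polyfun m 2 (point_den y)" for y
  proof (cases y)
    case (Pair p q)
    have "polyfun m 2 (\<lambda>x. g x q - g x p)" using g by (intro polyfun_diff)
    moreover have "point_den y = (\<lambda>x. if p = q then 1 else g x q - g x p)"
      unfolding Pair by (rule ext) simp
    ultimately show ?thesis using polyfun_const[of m 2 1] by (cases "p = q") simp_all
  qed
  have gn: "polyfun m 4 (gap_num d)" for d
  proof (cases d)
    case (Diff y y')
    have "polyfun m (2 + 2) (\<lambda>x. point_num (\<lambda>v. obj P \<bullet> v) y x * point_den y' x - point_num (\<lambda>v. obj P \<bullet> v) y' x * point_den y x)"
      by (intro polyfun_diff polyfun_mult pn pd)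
    moreover have "gap_num d = (\<lambda>x. point_num (\<lambda>v. obj P \<bullet> v) y x * point_den y' x - point_num (\<lambda>v. obj P \<bullet> v) y' x * point_den y x)"
      unfolding Diff by (rule ext) simp
    ultimately show ?thesis by simp
  next
    case (Const r)
    have "gap_num d = (\<lambda>x. r)" unfolding Const by (rule ext) simp
    then show ?thesis by (simp add: polyfun_const)
  qed
  have gd: "polyfun m 4 (gap_den d)" for d
  proof (cases d)
    case (Diff y y')
    have "polyfun m (2 + 2) (\<lambda>x. point_den y x * point_den y' x)" by (intro polyfun_mult pd)
    moreover have "gap_den d = (\<lambda>x. point_den y x * point_den y' x)"
      unfolding Diff by (rule ext) simp
    ultimately show ?thesis by simp
  next
    case (Const r)
    have "gap_den d = (\<lambda>x. 1)" unfolding Const by (rule ext) simp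
    then show ?thesis by (simp add: polyfun_const)
  qed
  have "polyfun m (4 + 4 + (4 + 4)) (\<lambda>x. gap_num d1 x * gap_num d2 x * (gap_den d3 x * gap_den d4 x) -
        gap_num d3 x * gap_num d4 x * (gap_den d1 x * gap_den d2 x))" for d1 d2 d3 d4
    by (intro polyfun_diff polyfun_mult gn gd)
  moreover have "polyfun m 16 (point_num \<phi> y)" "polyfun m 16 (\<lambda>x. g x w)" for \<phi> y w
    using polyfun_mono[OF pn, of 16] polyfun_mono[OF g, of 16] by simp_all
  ultimately show ?thesis using f by (auto simp: tree_conditions_def)
qed

text \<open>
  Each clause of similarity is the sign of a polynomial: vertices are cut off according to the sign of
  \<open>g\<close>, roundings of crossing points follow from comparisons with the integers up to \<open>\<tau>\<close>, and
  comparisons of products of gaps become polynomial after multiplication with the denominators.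
\<close>

lemma similar_if_signs_agree:
  assumes rad: "lp_radius P \<le> int \<tau>" and aff: "affine_fun n (g x)" "affine_fun n (g x')"
    and signs: "\<And>f. f \<in> tree_conditions \<tau> \<Longrightarrow> sgn (f x) = sgn (f x')"
  shows "similar P (g x) (g x')"
proof -
  let ?W = "node_vertices P"
  have vertex_sgn: "sgn (g x w) = sgn (g x' w)" if "w \<in> ?W" for w
    using that by (intro signs) (auto simp: tree_conditions_def)
  have sym: "symbols P (g x) = symbols P (g x')"
    unfolding symbols_def using vertex_sgn by (fastforce simp: sgn_real_def split: if_splits)
  have pos: "0 < point_den y z" "y \<in> ?W \<times> ?W" "\<And>\<phi>. affine_fun n \<phi> \<Longrightarrow> \<phi> (pt (g z) y) = point_num \<phi> y z / point_den y z"
    "pt (g z) y \<in> lp_region P"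
    if y: "y \<in> symbols P (g z)" and a: "affine_fun n (g z)" for y z
  proof -
    obtain p q where pq: "y = (p, q)" "p \<in> ?W" "q \<in> ?W" "p = q \<or> g z p < 0 \<and> 0 \<le> g z q"
      using y by (auto simp: symbols_def)
    have c: "p \<in> carrier_vec n" "q \<in> carrier_vec n" using pq node_vertices_carrier by auto
    show "0 < point_den y z" using pq by auto
    show "y \<in> ?W \<times> ?W" using pq by auto
    show "\<phi> (pt (g z) y) = point_num \<phi> y z / point_den y z" if "affine_fun n \<phi>" for \<phi>
      using pq affine_cross[OF that c, of "g z"] by (cases "p = q") (auto simp del: pt.simps simp: pt.simps[of _ q q])
    show "pt (g z) y \<in> lp_region P"
    proof (cases "p = q")
      case True
      then show ?thesis using pq node_vertices_lp by simp
    next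
      case False
      interpret polytope n "node_constraints P {}" "node_region P {}" by (rule polytope_node_region) simp
      have "lp_region P = node_region P {}" by (simp add: node_region_def)
      then show ?thesis using False pq node_vertices_lp cross_param[of "g z" p q] Q_convex[of p q]
        by (auto simp del: pt.simps)
    qed
  qed
  have rounding: "\<lfloor>pt (g x) y $ i\<rfloor> = \<lfloor>pt (g x') y $ i\<rfloor> \<and> \<lceil>pt (g x) y $ i\<rceil> = \<lceil>pt (g x') y $ i\<rceil>"
    if y: "y \<in> symbols P (g x)" and i: "i < n" for y i
  proof (rule rounding_eq_of_signs)
    have y': "y \<in> symbols P (g x')" using y sym by simp
    note p = pos[OF y aff(1)] and p' = pos[OF y' aff(2)]
    show "0 \<le> pt (g x) y $ i" "pt (g x) y $ i \<le> real \<tau>" "0 \<le> pt (g x') y $ i" "pt (g x') y $ i \<le> real \<tau>"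
      using lp_region_coord_le[OF rad p(4) i] lp_region_coord_le[OF rad p'(4) i] by auto
    fix k assume k: "k \<in> {0..int \<tau>}"
    have af: "affine_fun n (\<lambda>v. v $ i - real_of_int k)"
      by (intro affine_fun_diff affine_fun_const affine_fun_index)
    have "sgn (point_num (\<lambda>v. v $ i - real_of_int k) y x) = sgn (point_num (\<lambda>v. v $ i - real_of_int k) y x')"
      using p(2) i k by (intro signs) (auto simp: tree_conditions_def simp del: point_num.simps intro!: image_eqI[of _ _ "(y, i, k)"])
    then show "sgn (pt (g x) y $ i - real_of_int k) = sgn (pt (g x') y $ i - real_of_int k)"
      using p(1) p'(1) p(3)[OF af] p'(3)[OF af] by (simp add: sgn_divide)
  qed
  have gap: "0 < gap_den d z" "gap_value P (g z) d = gap_num d z / gap_den d z" "d \<in> all_gaps"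
    if d: "d \<in> gaps P (g z)" and a: "affine_fun n (g z)" for d z
  proof -
    have "0 < gap_den d z \<and> gap_value P (g z) d = gap_num d z / gap_den d z \<and> d \<in> all_gaps"
    proof (cases d)
      case (Const r)
      then show ?thesis using d by (auto simp: gaps_def all_gaps_def)
    next
      case (Diff y y')
      then have y: "y \<in> symbols P (g z)" "y' \<in> symbols P (g z)" using d by (auto simp: gaps_def)
      note p = pos[OF y(1) a] and p' = pos[OF y(2) a]
      have "obj P \<bullet> pt (g z) y = point_num (\<lambda>v. obj P \<bullet> v) y z / point_den y z"
        "obj P \<bullet> pt (g z) y' = point_num (\<lambda>v. obj P \<bullet> v) y' z / point_den y' z"
        using p(3) p'(3) affine_fun_scalar_prod[OF obj] by blast+
      moreover have "d \<in> all_gaps" using p(2) p'(2) Diff unfolding all_gaps_def by force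
      ultimately show ?thesis using p(1) p'(1) Diff
        by (simp add: diff_frac_eq less_imp_neq[symmetric] del: pt.simps point_num.simps point_den.simps)
    qed
    then show "0 < gap_den d z" "gap_value P (g z) d = gap_num d z / gap_den d z" "d \<in> all_gaps" by auto
  qed
  have products: "gap_value P (g x) d1 * gap_value P (g x) d2 \<le> gap_value P (g x) d3 * gap_value P (g x) d4 \<longleftrightarrow>
      gap_value P (g x') d1 * gap_value P (g x') d2 \<le> gap_value P (g x') d3 * gap_value P (g x') d4"
    if d: "d1 \<in> gaps P (g x)" "d2 \<in> gaps P (g x)" "d3 \<in> gaps P (g x)" "d4 \<in> gaps P (g x)" for d1 d2 d3 d4
  proof -
    define F where "F = (\<lambda>z. gap_num d1 z * gap_num d2 z * (gap_den d3 z * gap_den d4 z) -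
        gap_num d3 z * gap_num d4 z * (gap_den d1 z * gap_den d2 z))"
    have "F \<in> tree_conditions \<tau>"
    proof -
      have "(d1, d2, d3, d4) \<in> all_gaps \<times> all_gaps \<times> all_gaps \<times> all_gaps" using d gap(3) aff by blast
      then show ?thesis unfolding tree_conditions_def F_def
        by (intro UnI2 image_eqI[of _ _ "(d1, d2, d3, d4)"]) simp_all
    qed
    then have "sgn (F x) = sgn (F x')" by (rule signs)
    then have "F x \<le> 0 \<longleftrightarrow> F x' \<le> 0" by (rule sgn_eqD)
    moreover have "gap_value P (g z) d1 * gap_value P (g z) d2 \<le> gap_value P (g z) d3 * gap_value P (g z) d4 \<longleftrightarrow> F z \<le> 0"
      if a: "affine_fun n (g z)" and "gaps P (g x) = gaps P (g z)" for z
    proof -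
      note d' = d[unfolded that(2)]
      note g1 = gap[OF d'(1) a] and g2 = gap[OF d'(2) a] and g3 = gap[OF d'(3) a] and g4 = gap[OF d'(4) a]
      have "0 < gap_den d1 z * gap_den d2 z" "0 < gap_den d3 z * gap_den d4 z" using g1 g2 g3 g4 by auto
      moreover have "r / s \<le> r' / s' \<longleftrightarrow> r * s' - r' * s \<le> 0" if "0 < s" "0 < s'" for r s r' s' :: real
        using that by (simp add: divide_simps)
      ultimately show ?thesis unfolding g1(2) g2(2) g3(2) g4(2) F_def times_divide_times_eq by blast
    qed
    moreover have "gaps P (g x) = gaps P (g x')" using sym by (simp add: gaps_def)
    ultimately show ?thesis using aff by simp
  qed
  show ?thesis unfolding similar_def num_vars
    using sgn_eqD(1)[OF vertex_sgn] rounding products by blast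
qed

text \<open>
  There are \<open>w = (\<tau> + 2) ^ n\<close> vertices at most, hence \<open>2 * w ^ 4\<close> gaps, and a comparison of products
  involves four of them. This term dominates.
\<close>

lemma card_tree_conditions_le:
  assumes "lp_radius P \<le> int \<tau>" "1 \<le> n"
  shows "finite (tree_conditions \<tau>)" "card (tree_conditions \<tau>) \<le> 18 * n * (\<tau> + 2) ^ (16 * n)"
proof -
  let ?W = "node_vertices P"
  define w where "w = (\<tau> + 2) ^ n"
  have fW: "finite ?W" and cW: "card ?W \<le> w" using card_node_vertices_le[OF assms(1)] by (auto simp: w_def)
  have w: "\<tau> + 2 \<le> w" unfolding w_def using assms(2) self_le_power[of "\<tau> + 2" n] by simp
  have fG: "finite all_gaps" unfolding all_gaps_def using fW by auto
  have "card all_gaps \<le> card {Const 0, Const 1, Const (1 / 10 ^ 6)} + card ((?W \<times> ?W) \<times> (?W \<times> ?W))"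
    unfolding all_gaps_def by (rule order_trans[OF card_Un_le add_mono[OF order_refl card_image_le]]) (use fW in auto)
  also have "\<dots> \<le> 3 + w ^ 4"
  proof (rule add_mono)
    show "card {Const 0, Const 1, Const (1 / 10 ^ 6)} \<le> 3" by (rule order_trans[OF card_insert_le_m1]) auto
    have "card ((?W \<times> ?W) \<times> (?W \<times> ?W)) = card ?W ^ 4"
      by (simp add: card_cartesian_product power4_eq_xxxx mult.assoc)
    then show "card ((?W \<times> ?W) \<times> (?W \<times> ?W)) \<le> w ^ 4" using cW by (simp add: power_mono)
  qed
  also have "\<dots> \<le> 2 * w ^ 4"
  proof -
    have "(2::nat) ^ 4 \<le> w ^ 4" using w by (intro power_mono) auto
    then show ?thesis by simp
  qed
  finally have cG: "card all_gaps \<le> 2 * w ^ 4" .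
  define A where "A = (\<lambda>w x. g x w) ` ?W"
  define B where "B = (\<lambda>(y, i, k) x. point_num (\<lambda>v. v $ i - real_of_int k) y x) `
       ((?W \<times> ?W) \<times> {..<n} \<times> {0..int \<tau>})"
  define C where "C = (\<lambda>(d1, d2, d3, d4) x. gap_num d1 x * gap_num d2 x * (gap_den d3 x * gap_den d4 x) -
        gap_num d3 x * gap_num d4 x * (gap_den d1 x * gap_den d2 x)) `
       (all_gaps \<times> all_gaps \<times> all_gaps \<times> all_gaps)"
  have T: "tree_conditions \<tau> = A \<union> B \<union> C" by (simp add: tree_conditions_def A_def B_def C_def)
  have fin: "finite A" "finite B" "finite C" unfolding A_def B_def C_def using fW fG by auto
  then show "finite (tree_conditions \<tau>)" by (simp add: T)
  have "w \<ge> 1" using w by simp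
  have cA: "card A \<le> n * w ^ 16"
  proof -
    have "card A \<le> w" unfolding A_def using card_image_le[OF fW] cW order_trans by blast
    also have "\<dots> \<le> w ^ 16" using \<open>w \<ge> 1\<close> self_le_power[of w 16] by simp
    also have "\<dots> \<le> n * w ^ 16" using assms(2) by simp
    finally show ?thesis .
  qed
  have cB: "card B \<le> n * w ^ 16"
  proof -
    have "card B \<le> card ((?W \<times> ?W) \<times> {..<n} \<times> {0..int \<tau>})" unfolding B_def using fW by (intro card_image_le) auto
    also have "\<dots> = card ?W * card ?W * (n * (\<tau> + 1))"
      by (simp add: card_cartesian_product nat_add_distrib algebra_simps)
    also have "\<dots> \<le> w * w * (n * w)" using cW w by (intro mult_mono) auto
    also have "\<dots> = n * w ^ 3" by (simp add: power3_eq_cube)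
    also have "\<dots> \<le> n * w ^ 16" using \<open>w \<ge> 1\<close> by (intro mult_left_mono power_increasing) auto
    finally show ?thesis .
  qed
  have cC: "card C \<le> 16 * (n * w ^ 16)"
  proof -
    have "card C \<le> card (all_gaps \<times> all_gaps \<times> all_gaps \<times> all_gaps)"
      unfolding C_def using fG by (intro card_image_le) auto
    also have "\<dots> = card all_gaps ^ 4" by (simp add: card_cartesian_product power4_eq_xxxx mult.assoc)
    also have "\<dots> \<le> (2 * w ^ 4) ^ 4" using cG by (intro power_mono) auto
    also have "\<dots> = 16 * w ^ 16" by (simp add: power_mult_distrib flip: power_mult)
    also have "\<dots> \<le> 16 * (n * w ^ 16)" using assms(2) by simp
    finally show ?thesis .
  qed
  have "card (tree_conditions \<tau>) \<le> card A + card B + card C"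
    unfolding T by (rule order_trans[OF card_Un_le add_mono[OF card_Un_le order_refl]])
  also have "\<dots> \<le> 18 * n * w ^ 16" using cA cB cC by simp
  also have "w ^ 16 = (\<tau> + 2) ^ (16 * n)" by (simp add: w_def mult.commute flip: power_mult)
  finally show "card (tree_conditions \<tau>) \<le> 18 * n * (\<tau> + 2) ^ (16 * n)" by simp
qed

end

end

section \<open>Shattered sets of integer programs\<close>

text \<open>
  The relevant polynomials of the second kind depend on the sign pattern of those of the first kind, so
  the two bounds multiply. With the roundings as further indices of a single family, the number of
  polynomials would be exponential in \<open>n\<close> with base \<open>a * b * U\<close>, which would cost a factor \<open>n\<close> in front of
  \<open>ln (a * b * U)\<close>.
\<close>

lemma card_two_level_patterns_le:
  fixes X :: "(nat \<Rightarrow> real) set"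
  assumes X: "finite X" and J: "finite J" and pJ: "\<And>f. f \<in> J \<Longrightarrow> polyfun m 1 f"
    and J': "\<And>x. x \<in> X \<Longrightarrow> finite (J' x) \<and> card (J' x) \<le> M"
    and pJ': "\<And>x f. x \<in> X \<Longrightarrow> f \<in> J' x \<Longrightarrow> polyfun m d f"
    and dist: "\<And>x0 x y. x0 \<in> X \<Longrightarrow> x \<in> X \<Longrightarrow> y \<in> X \<Longrightarrow> (\<And>f. f \<in> J \<Longrightarrow> sgn (f x0) = sgn (f x)) \<Longrightarrow>
      (\<And>f. f \<in> J \<Longrightarrow> sgn (f x0) = sgn (f y)) \<Longrightarrow> (\<And>f. f \<in> J' x0 \<Longrightarrow> sgn (f x) = sgn (f y)) \<Longrightarrow> x = y"
  shows "card X \<le> (4 * card J + 1) ^ m * (4 * M * d + 1) ^ m"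
proof -
  define pat where "pat = (\<lambda>x. \<lambda>f\<in>J. sgn (f x))"
  have patD: "sgn (f x) = sgn (f y)" if "pat x = pat y" "f \<in> J" for x y f
    using fun_cong[OF that(1), of f] that(2) by (simp add: pat_def)
  obtain R where R: "R \<subseteq> X" "inj_on pat R" "pat ` X = pat ` R"
    using subset_image_inj[of "pat ` X" pat X] by auto
  have "card R \<le> (4 * card J * 1 + 1) ^ m"
  proof (rule card_sign_patterns_le[where p = "\<lambda>f. f"])
    show "finite R" using R X finite_subset by blast
    fix x y assume "x \<in> R" "y \<in> R" "\<And>f. f \<in> J \<Longrightarrow> sgn (f x) = sgn (f y)"
    then show "x = y" using R(2) by (auto simp: inj_on_def pat_def restrict_def fun_eq_iff)
  qed (use J pJ in auto)
  then have patX: "card (pat ` X) \<le> (4 * card J + 1) ^ m" using R card_image by fastforce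
  have fibre: "card {x \<in> X. pat x = c} \<le> (4 * M * d + 1) ^ m" if c: "c \<in> pat ` X" for c
  proof -
    obtain x0 where x0: "x0 \<in> X" "c = pat x0" using c by blast
    have "card {x \<in> X. pat x = c} \<le> (4 * card (J' x0) * d + 1) ^ m"
    proof (rule card_sign_patterns_le[where p = "\<lambda>f. f"])
      fix x y assume xy: "x \<in> {x \<in> X. pat x = c}" "y \<in> {x \<in> X. pat x = c}"
        and s: "\<And>f. f \<in> J' x0 \<Longrightarrow> sgn (f x) = sgn (f y)"
      then show "x = y" using x0 patD[of x0 x] patD[of x0 y] by (intro dist[OF x0(1)]) auto
    qed (use X J' pJ' x0 in auto)
    also have "\<dots> \<le> (4 * M * d + 1) ^ m" using J'[OF x0(1)] by (intro power_mono) auto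
    finally show ?thesis .
  qed
  have "card X = (\<Sum>c\<in>pat ` X. card {x \<in> X. pat x = c})"
    using sum.image_gen[OF X, of "\<lambda>_. 1 :: nat" pat] by simp
  also have "\<dots> \<le> card (pat ` X) * (4 * M * d + 1) ^ m"
    using sum_mono[OF fibre] by (metis (no_types, lifting) sum_bounded_above of_nat_id fibre)
  also have "\<dots> \<le> (4 * card J + 1) ^ m * (4 * M * d + 1) ^ m" using patX by (intro mult_right_mono) auto
  finally show ?thesis .
qed

lemma gmi_form_cong:
  assumes "\<And>i. i < num_vars P \<Longrightarrow> k i = k' i" "\<And>i. i < num_vars P \<Longrightarrow> i \<in> I \<longleftrightarrow> i \<in> I'"
  shows "gmi_form P k k0 I u = gmi_form P k' k0 I' u"
  unfolding gmi_form_def Let_def using assms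
  by (intro ext arg_cong2[of _ _ _ _ "(-)"] sum.cong) auto

context bounded_ip
begin

text \<open>
  These signs fix the integral parts of all multiplied coefficients; those in the last line also fix how
  the fractional parts of the coefficients compare to that of the right-hand side.
\<close>

definition floor_conditions :: "int \<Rightarrow> ((nat \<Rightarrow> real) \<Rightarrow> real) set" where
  "floor_conditions K =
     (\<lambda>(i, k) x. vec m x \<bullet> col (rmat P) i - real_of_int k) ` ({..<n} \<times> {- 2 * K..2 * K}) \<union>
     (\<lambda>k x. vec m x \<bullet> rrhs P - real_of_int k) ` {- 2 * K..2 * K} \<union>
     (\<lambda>(i, k) x. vec m x \<bullet> col (rmat P) i - vec m x \<bullet> rrhs P - real_of_int k) ` ({..<n} \<times> {- 2 * K..2 * K})"

lemma polyfun_floor_conditions: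
  assumes "f \<in> floor_conditions K"
  shows "polyfun m 1 f"
proof -
  have "polyfun m 1 (\<lambda>x. vec m x \<bullet> col (rmat P) i)" if "i < n" for i
    using rmat by (intro polyfun_scalar_prod) auto
  moreover have "polyfun m 1 (\<lambda>x. vec m x \<bullet> rrhs P)" by (rule polyfun_scalar_prod[OF rrhs])
  moreover note assms
  ultimately show ?thesis
    unfolding floor_conditions_def
    by (auto simp del: One_nat_def intro!: polyfun_diff polyfun_const)
qed

lemma card_floor_conditions_le:
  assumes "1 \<le> n" "0 \<le> K"
  shows "finite (floor_conditions K)" "card (floor_conditions K) \<le> 3 * n * nat (4 * K + 1)"
proof -
  let ?I = "{- 2 * K..2 * K}"
  define A where "A = (\<lambda>(i, k) x. vec m x \<bullet> col (rmat P) i - real_of_int k) ` ({..<n} \<times> ?I)"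
  define B where "B = (\<lambda>k x. vec m x \<bullet> rrhs P - real_of_int k) ` ?I"
  define C where "C = (\<lambda>(i, k) x. vec m x \<bullet> col (rmat P) i - vec m x \<bullet> rrhs P - real_of_int k) ` ({..<n} \<times> ?I)"
  have T: "floor_conditions K = A \<union> B \<union> C" by (simp add: floor_conditions_def A_def B_def C_def)
  show "finite (floor_conditions K)" unfolding T A_def B_def C_def by auto
  have I: "card ?I = nat (4 * K + 1)" by simp
  have "card A \<le> card ({..<n} \<times> ?I)" unfolding A_def by (rule card_image_le) simp
  moreover have "card B \<le> card ?I" unfolding B_def by (rule card_image_le) simp
  moreover have "card C \<le> card ({..<n} \<times> ?I)" unfolding C_def by (rule card_image_le) simp
  moreover have "card ({..<n} \<times> ?I) = n * nat (4 * K + 1)" unfolding card_cartesian_product I by simp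
  moreover have "nat (4 * K + 1) \<le> n * nat (4 * K + 1)" using assms by simp
  moreover have "card (floor_conditions K) \<le> card A + card B + card C"
    unfolding T by (rule order_trans[OF card_Un_le add_mono[OF card_Un_le order_refl]])
  ultimately show "card (floor_conditions K) \<le> 3 * n * nat (4 * K + 1)" unfolding I by linarith
qed

text \<open>
  The cut with the multipliers \<open>x\<close>, written with the roundings that belong to \<open>x0\<close>.
\<close>

definition class_form :: "(nat \<Rightarrow> real) \<Rightarrow> (nat \<Rightarrow> real) \<Rightarrow> real vec \<Rightarrow> real" where
  "class_form x0 x = gmi_form P (\<lambda>i. \<lfloor>vec m x0 \<bullet> col (rmat P) i\<rfloor>) \<lfloor>vec m x0 \<bullet> rrhs P\<rfloor>
     {i. frac (vec m x0 \<bullet> col (rmat P) i) \<le> frac (vec m x0 \<bullet> rrhs P)} (vec m x)"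

lemma class_form_eq:
  assumes signs: "\<And>f. f \<in> floor_conditions K \<Longrightarrow> sgn (f x0) = sgn (f x)"
    and bound: "\<And>i. i < n \<Longrightarrow> \<bar>vec m x0 \<bullet> col (rmat P) i\<bar> \<le> real_of_int K - 1"
      "\<bar>vec m x0 \<bullet> rrhs P\<bar> \<le> real_of_int K - 1"
  shows "gmi_fun P (vec m x) = class_form x0 x"
proof -
  define \<alpha> where "\<alpha> = (\<lambda>x i. vec m x \<bullet> col (rmat P) i)"
  define \<beta> where "\<beta> = (\<lambda>x. vec m x \<bullet> rrhs P)"
  have K: "0 \<le> K" using bound(2) by linarith
  have fa: "\<lfloor>\<alpha> x i\<rfloor> = \<lfloor>\<alpha> x0 i\<rfloor>" if i: "i < n" for i
  proof (rule floor_eq_of_signs[where lo = "- 2 * K" and hi = "2 * K"])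
    show "sgn (\<alpha> x0 i - real_of_int k) = sgn (\<alpha> x i - real_of_int k)" if "k \<in> {- 2 * K..2 * K}" for k
      using signs[of "\<lambda>x. \<alpha> x i - real_of_int k"] i that unfolding \<alpha>_def floor_conditions_def by force
    show "real_of_int (- 2 * K) \<le> \<alpha> x0 i" "\<alpha> x0 i < real_of_int (2 * K)"
      using bound(1)[OF i] K by (simp_all add: \<alpha>_def)
  qed
  have fb: "\<lfloor>\<beta> x\<rfloor> = \<lfloor>\<beta> x0\<rfloor>"
  proof (rule floor_eq_of_signs[where lo = "- 2 * K" and hi = "2 * K"])
    show "sgn (\<beta> x0 - real_of_int k) = sgn (\<beta> x - real_of_int k)" if "k \<in> {- 2 * K..2 * K}" for k
      using signs[of "\<lambda>x. \<beta> x - real_of_int k"] that unfolding \<beta>_def floor_conditions_def by force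
    show "real_of_int (- 2 * K) \<le> \<beta> x0" "\<beta> x0 < real_of_int (2 * K)"
      using bound(2) K by (simp_all add: \<beta>_def)
  qed
  have fr: "frac (\<alpha> x i) \<le> frac (\<beta> x) \<longleftrightarrow> frac (\<alpha> x0 i) \<le> frac (\<beta> x0)" if i: "i < n" for i
  proof -
    define k where "k = \<lfloor>\<alpha> x0 i\<rfloor> - \<lfloor>\<beta> x0\<rfloor>"
    have "\<bar>\<alpha> x0 i\<bar> \<le> real_of_int K - 1" "\<bar>\<beta> x0\<bar> \<le> real_of_int K - 1"
      using bound(1)[OF i] bound(2) by (simp_all add: \<alpha>_def \<beta>_def)
    then have "k \<in> {- 2 * K..2 * K}" unfolding k_def by (auto, linarith+)
    then have "sgn (\<alpha> x0 i - \<beta> x0 - real_of_int k) = sgn (\<alpha> x i - \<beta> x - real_of_int k)"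
      using signs[of "\<lambda>x. \<alpha> x i - \<beta> x - real_of_int k"] i unfolding \<alpha>_def \<beta>_def floor_conditions_def by force
    then have "\<alpha> x0 i - \<beta> x0 - real_of_int k \<le> 0 \<longleftrightarrow> \<alpha> x i - \<beta> x - real_of_int k \<le> 0" by (rule sgn_eqD)
    then show ?thesis unfolding frac_def fa[OF i] fb by (simp add: k_def algebra_simps)
  qed
  have "gmi_form P (\<lambda>i. \<lfloor>\<alpha> x i\<rfloor>) \<lfloor>\<beta> x\<rfloor> {i. frac (\<alpha> x i) \<le> frac (\<beta> x)} (vec m x) =
      gmi_form P (\<lambda>i. \<lfloor>\<alpha> x0 i\<rfloor>) \<lfloor>\<beta> x0\<rfloor> {i. frac (\<alpha> x0 i) \<le> frac (\<beta> x0)} (vec m x)"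
    unfolding fb by (rule gmi_form_cong) (simp_all add: fa fr)
  then show ?thesis by (simp add: gmi_fun_def class_form_def \<alpha>_def \<beta>_def)
qed

lemma tree_size_eq:
  assumes PD: "P \<in> D" and valid: "valid_rules D \<rho>" and n1: "1 \<le> n"
    and sim: "similar P (gmi_fun P u) (gmi_fun P u')"
  shows "gmi_tree_size \<rho> \<kappa> u P = gmi_tree_size \<rho> \<kappa> u' P"
proof -
  have "affine_fun n (gmi_fun P u)" for u
    using affine_fun_gmi_form[of P] unfolding gmi_fun_def num_vars by blast
  then interpret similar_cuts P m n D \<rho> "gmi_fun P u" "gmi_fun P u'"
    using PD valid n1 sim by unfold_locales auto
  show ?thesis using bc_tree_eq[of \<kappa>] by (simp add: gmi_tree_size_def gmi_cut_eq)
qed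

text \<open>
  With right-hand side \<open>0\<close> the number \<open>f0\<close> is \<open>0\<close>, and the cut removes no nonnegative point. So this program
  cannot be shattered, and shattered programs force \<open>1 \<le> b\<close>.
\<close>

lemma tree_size_const_if_rhs_zero:
  assumes "P \<in> D" "valid_rules D \<rho>" "1 \<le> n" and r0: "l1_norm (rhs P) = 0"
    and u: "u \<in> carrier_vec m" "u' \<in> carrier_vec m"
  shows "gmi_tree_size \<rho> \<kappa> u P = gmi_tree_size \<rho> \<kappa> u' P"
proof (rule tree_size_eq[OF assms(1-3)])
  have "rhs P $ r = 0" if "r < m" for r
  proof -
    have "(\<Sum>i<m. \<bar>rhs P $ i\<bar>) = 0" using r0 rhs by (simp add: l1_norm_def)
    then show ?thesis using that by (subst (asm) sum_nonneg_eq_0_iff) auto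
  qed
  then have b0: "u \<bullet> rrhs P = 0" for u
    using rhs by (simp add: scalar_prod_def rrhs_def)
  have nonneg: "0 \<le> gmi_fun P u w" if w: "w \<in> node_vertices P" for u w
  proof -
    have "0 \<le> w $ i" if "i < n" for i using node_vertices_lp[OF w] that by (simp add: lp_region_iff)
    then show ?thesis
      unfolding gmi_fun_def gmi_form_def Let_def b0 num_vars
      by (auto intro!: sum_nonneg simp: frac_def[symmetric])
  qed
  have sym: "fst y = snd y \<and> fst y \<in> node_vertices P" if "y \<in> symbols P (gmi_fun P u)" for y u
    using that nonneg by (fastforce simp: symbols_def not_le[symmetric])
  have pt: "pt (gmi_fun P u') y = pt (gmi_fun P u) y" if "y \<in> symbols P (gmi_fun P u)" for y
    using sym[OF that] by (cases y) simp
  have val: "gap_value P (gmi_fun P u') d = gap_value P (gmi_fun P u) d" if "d \<in> gaps P (gmi_fun P u)" for d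
    using that pt by (auto simp: gaps_def simp del: pt.simps)
  show "similar P (gmi_fun P u) (gmi_fun P u')"
    unfolding similar_def using nonneg by (simp add: val pt del: pt.simps)
qed

end

lemma dot_le_l1_norm:
  assumes "w \<in> carrier_vec m" "\<And>r. r < m \<Longrightarrow> \<bar>x r\<bar> \<le> U"
  shows "\<bar>vec m x \<bullet> map_vec real_of_int w\<bar> \<le> U * real_of_int (l1_norm w)"
proof -
  have "\<bar>vec m x \<bullet> map_vec real_of_int w\<bar> = \<bar>\<Sum>r<m. x r * real_of_int (w $ r)\<bar>"
    using assms(1) by (simp add: scalar_prod_def atLeast0LessThan)
  also have "\<dots> \<le> (\<Sum>r<m. \<bar>x r * real_of_int (w $ r)\<bar>)" by (rule sum_abs)
  also have "\<dots> \<le> (\<Sum>r<m. U * real_of_int \<bar>w $ r\<bar>)"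
    using assms(2) by (intro sum_mono) (auto simp: abs_mult intro!: mult_right_mono)
  also have "\<dots> = U * real_of_int (l1_norm w)" using assms(1) by (simp add: l1_norm_def sum_distrib_left)
  finally show ?thesis .
qed

lemma l1_norm_nonneg: "0 \<le> l1_norm v"
  by (simp add: l1_norm_def sum_nonneg)

lemma l1_norm_col_le:
  assumes "j < dim_col A"
  shows "l1_norm (col A j) \<le> mat_l1_norm A"
proof -
  have "{l1_norm (col A j) | j. j < dim_col A} = (\<lambda>j. l1_norm (col A j)) ` {..<dim_col A}" by auto
  then show ?thesis unfolding mat_l1_norm_def using assms by (intro Max_ge) auto
qed

text \<open>
  A zero column would make the feasible region unbounded.
\<close>

lemma mat_l1_norm_ge_1:
  assumes "bounded_ip P m n" "lp_region P \<noteq> {}" "1 \<le> n"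
  shows "1 \<le> mat_l1_norm (cmat P)"
proof (rule ccontr)
  interpret bounded_ip P m n by fact
  assume "\<not> 1 \<le> mat_l1_norm (cmat P)"
  moreover have "l1_norm (col (cmat P) 0) \<le> mat_l1_norm (cmat P)" using cmat assms(3) by (intro l1_norm_col_le) auto
  ultimately have "l1_norm (col (cmat P) 0) = 0" using l1_norm_nonneg[of "col (cmat P) 0"] by linarith
  then have "(\<Sum>r<m. \<bar>col (cmat P) 0 $ r\<bar>) = 0" using cmat by (simp add: l1_norm_def)
  then have zero: "cmat P $$ (r, 0) = 0" if "r < m" for r
    using that cmat assms(3) by (subst (asm) sum_nonneg_eq_0_iff) auto
  obtain a where a: "a \<in> lp_region P" using assms(2) by blast
  have "unit_vec n 0 = (0\<^sub>v n :: real vec)"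
  proof (rule no_recession_direction[OF a])
    fix r assume "r < m"
    then show "row (rmat P) r \<bullet> unit_vec n 0 = 0"
      using zero cmat assms(3) by (simp add: rmat_def scalar_prod_right_unit)
  qed (use assms(3) in auto)
  then have "unit_vec n 0 $ 0 = (0\<^sub>v n :: real vec) $ 0" by simp
  then show False using assms(3) by simp
qed

lemma ips_bounded_ip: "P \<in> ips m n a b \<Longrightarrow> bounded_ip P m n"
  by (simp add: ips_def bounded_ip_def)

text \<open>
  The \<open>2 ^ N\<close> multipliers that realize all patterns on \<open>N\<close> programs have different two-level sign
  patterns. There are \<open>O(N n a b U)\<close> linear conditions for the roundings and \<open>O(N n (\<tau> + 2) ^ (16 n))\<close>
  conditions of degree \<open>16\<close> for the trees.
\<close>

lemma shattered_size_le:
  fixes N m n \<tau> \<kappa> :: nat and a b U :: real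
  assumes n: "1 \<le> n" and pos: "0 < a" "0 < b" "1 \<le> a * b * U" and D: "D \<subseteq> ips m n a b"
    and rad: "\<forall>P\<in>D. lp_radius P \<le> int \<tau>" and valid: "valid_rules D \<rho>"
    and N: "1 \<le> N" and y: "\<And>t. t < N \<Longrightarrow> y t \<in> D"
    and shatter: "\<And>s :: nat \<Rightarrow> bool. \<exists>u\<in>carrier_vec m. (\<forall>i<m. -U \<le> u $ i \<and> u $ i \<le> U) \<and>
      (\<forall>t<N. real (gmi_tree_size \<rho> \<kappa> u (y t)) \<ge> r t \<longleftrightarrow> s t)"
  shows "2 ^ N \<le> (157 * real N * real n * (a * b * U)) ^ m *
    (1153 * real N * real n * real (\<tau> + 2) ^ (16 * n)) ^ m"
proof -
  have ip: "bounded_ip (y t) m n" if "t < N" for t using y[OF that] D ips_bounded_ip by blast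
  have U: "0 < U"
  proof -
    have "0 < a * b" "0 < a * b * U" using pos by auto
    then show ?thesis by (rule zero_less_mult_pos[rotated])
  qed
  have y0: "y 0 \<in> ips m n a b" using y[of 0] N D by auto
  have a1: "1 \<le> a"
  proof -
    have "1 \<le> mat_l1_norm (cmat (y 0))"
      using mat_l1_norm_ge_1[OF ips_bounded_ip[OF y0] _ n] y0 by (simp add: ips_def)
    then have "1 \<le> real_of_int (mat_l1_norm (cmat (y 0)))" by simp
    then show ?thesis using y0 by (simp add: ips_def)
  qed
  have b1: "1 \<le> b"
  proof -
    interpret bounded_ip "y 0" m n using ip N by simp
    have "0 < N" using N by simp
    obtain u where u: "u \<in> carrier_vec m" "real (gmi_tree_size \<rho> \<kappa> u (y 0)) \<ge> r 0"
      using shatter[of "\<lambda>_. True"] \<open>0 < N\<close> by blast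
    obtain u' where u': "u' \<in> carrier_vec m" "\<not> real (gmi_tree_size \<rho> \<kappa> u' (y 0)) \<ge> r 0"
      using shatter[of "\<lambda>_. False"] \<open>0 < N\<close> by blast
    have "l1_norm (rhs (y 0)) \<noteq> 0"
    proof
      assume "l1_norm (rhs (y 0)) = 0"
      from tree_size_const_if_rhs_zero[OF y[OF \<open>0 < N\<close>] valid n this u(1) u'(1)] u(2) u'(2)
      show False by simp
    qed
    then have "1 \<le> l1_norm (rhs (y 0))" using l1_norm_nonneg[of "rhs (y 0)"] by linarith
    then have "1 \<le> real_of_int (l1_norm (rhs (y 0)))" by simp
    then show ?thesis using y0 by (simp add: ips_def)
  qed
  have "a * U \<le> a * U * b" "b * U \<le> b * U * a"
    using mult_left_mono[OF b1, of "a * U"] mult_left_mono[OF a1, of "b * U"] pos U by simp_all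
  then have abU: "a * U \<le> a * b * U" "b * U \<le> a * b * U" by (simp_all add: mult_ac)
  (* As 1 <= a and 1 <= b, all multiplied coefficients are at most a * b * U in absolute value. *)
  define K where "K = \<lceil>a * b * U\<rceil> + 1"
  have K: "a * b * U \<le> real_of_int K - 1" "real_of_int K \<le> 3 * (a * b * U)" "0 \<le> K"
    using pos(3) unfolding K_def by linarith+
  obtain W where W: "\<And>s. W s \<in> carrier_vec m" "\<And>s i. i < m \<Longrightarrow> -U \<le> W s $ i \<and> W s $ i \<le> U"
    "\<And>s t. t < N \<Longrightarrow> real (gmi_tree_size \<rho> \<kappa> (W s) (y t)) \<ge> r t \<longleftrightarrow> s t"
    using shatter by metis
  define w where "w = (\<lambda>S i. if i < m then W (\<lambda>t. t \<in> S) $ i else 0)"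
  define X where "X = w ` Pow {..<N}"
  have vecw: "vec m (w S) = W (\<lambda>t. t \<in> S)" for S
    using W(1)[of "\<lambda>t. t \<in> S"] by (intro eq_vecI) (auto simp: w_def)
  have boundX: "\<bar>x i\<bar> \<le> U" if "x \<in> X" "i < m" for x i
    using that W(2) by (auto simp: X_def w_def abs_le_iff minus_le_iff)
  have separated: "\<exists>t<N. gmi_tree_size \<rho> \<kappa> (vec m (w S)) (y t) \<noteq> gmi_tree_size \<rho> \<kappa> (vec m (w S')) (y t)"
    if S: "S \<subseteq> {..<N}" "S' \<subseteq> {..<N}" "S \<noteq> S'" for S S'
  proof -
    have "\<exists>t. (t \<in> S) \<noteq> (t \<in> S')" using S(3) by (simp add: set_eq_iff)
    then obtain t where "(t \<in> S) \<noteq> (t \<in> S')" by blast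
    moreover from this have "t < N" using subsetD[OF S(1), of t] subsetD[OF S(2), of t] by auto
    ultimately have t: "t < N" "t \<in> S \<longleftrightarrow> t \<notin> S'" by auto
    note W(3)[OF t(1), of "\<lambda>t. t \<in> S"] W(3)[OF t(1), of "\<lambda>t. t \<in> S'"]
    then have "gmi_tree_size \<rho> \<kappa> (W (\<lambda>t. t \<in> S)) (y t) \<noteq> gmi_tree_size \<rho> \<kappa> (W (\<lambda>t. t \<in> S')) (y t)"
      using t(2) by auto
    then show ?thesis unfolding vecw using t(1) by blast
  qed
  have inj: "inj_on w (Pow {..<N})"
  proof (rule inj_onI, rule ccontr)
    fix S S' assume *: "S \<in> Pow {..<N}" "S' \<in> Pow {..<N}" "w S = w S'" "S \<noteq> S'"
    show False using separated[OF _ _ *(4)] *(1-3) by simp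
  qed
  have cX: "card X = 2 ^ N" unfolding X_def card_image[OF inj] by (simp add: card_Pow)
  have fX: "finite X" by (simp add: X_def)
  define J0 where "J0 = (\<lambda>t. bounded_ip.floor_conditions (y t) m n K)"
  define J1 where "J1 = (\<lambda>x0 t. bounded_ip.tree_conditions (y t) n (bounded_ip.class_form (y t) m x0) \<tau>)"
  define J where "J = (\<Union>t<N. J0 t)"
  define J' where "J' = (\<lambda>x0. \<Union>t<N. J1 x0 t)"
  have fin: "finite J" "card J \<le> N * (3 * n * nat (4 * K + 1))"
  proof -
    have f: "finite (J0 t) \<and> card (J0 t) \<le> 3 * n * nat (4 * K + 1)" if "t \<in> {..<N}" for t
      using bounded_ip.card_floor_conditions_le[OF ip n K(3)] that by (auto simp: J0_def)
    then show "finite J" unfolding J_def by blast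
    have "card J \<le> (\<Sum>t<N. card (J0 t))" unfolding J_def by (rule card_UN_le) simp
    also have "\<dots> \<le> (\<Sum>t<N. 3 * n * nat (4 * K + 1))" using f by (intro sum_mono) blast
    finally show "card J \<le> N * (3 * n * nat (4 * K + 1))" by simp
  qed
  have fin': "finite (J' x0)" "card (J' x0) \<le> N * (18 * n * (\<tau> + 2) ^ (16 * n))" for x0
  proof -
    have f: "finite (J1 x0 t) \<and> card (J1 x0 t) \<le> 18 * n * (\<tau> + 2) ^ (16 * n)" if "t \<in> {..<N}" for t
      using bounded_ip.card_tree_conditions_le[OF ip _ n] rad y that by (auto simp: J1_def)
    then show "finite (J' x0)" unfolding J'_def by blast
    have "card (J' x0) \<le> (\<Sum>t<N. card (J1 x0 t))" unfolding J'_def by (rule card_UN_le) simp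
    also have "\<dots> \<le> (\<Sum>t<N. 18 * n * (\<tau> + 2) ^ (16 * n))" using f by (intro sum_mono) blast
    finally show "card (J' x0) \<le> N * (18 * n * (\<tau> + 2) ^ (16 * n))" by simp
  qed
  (* The constants: 4 * K + 1 <= 13 * (a * b * U), so the first factor has 4 * 3 * 13 + 1 = 157,
     and the second one 4 * 18 * 16 + 1 = 1153. *)
  have "card X \<le> (4 * card J + 1) ^ m * (4 * (N * (18 * n * (\<tau> + 2) ^ (16 * n))) * 16 + 1) ^ m"
  proof (rule card_two_level_patterns_le[where J' = J'])
    show "polyfun m 1 f" if "f \<in> J" for f
      using that bounded_ip.polyfun_floor_conditions[OF ip] by (auto simp: J_def J0_def)
    show "polyfun m 16 f" if "x0 \<in> X" and f: "f \<in> J' x0" for x0 f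
    proof -
      obtain t where t: "t < N" "f \<in> bounded_ip.tree_conditions (y t) n (bounded_ip.class_form (y t) m x0) \<tau>"
        using f by (auto simp: J'_def J1_def)
      interpret bounded_ip "y t" m n by (rule ip[OF t(1)])
      show ?thesis by (rule polyfun_tree_conditions[OF _ t(2)]) (simp add: class_form_def polyfun_gmi_form)
    qed
    fix x0 x x' assume X: "x0 \<in> X" "x \<in> X" "x' \<in> X"
      and s: "\<And>f. f \<in> J \<Longrightarrow> sgn (f x0) = sgn (f x)" "\<And>f. f \<in> J \<Longrightarrow> sgn (f x0) = sgn (f x')"
      and s': "\<And>f. f \<in> J' x0 \<Longrightarrow> sgn (f x) = sgn (f x')"
    have "gmi_tree_size \<rho> \<kappa> (vec m x) (y t) = gmi_tree_size \<rho> \<kappa> (vec m x') (y t)" if t: "t < N" for t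
    proof -
      interpret bounded_ip "y t" m n by (rule ip[OF t])
      have yt: "y t \<in> ips m n a b" using y[OF t] D by blast
      have bound: "\<bar>vec m x0 \<bullet> col (rmat (y t)) i\<bar> \<le> real_of_int K - 1" if i: "i < n" for i
      proof -
        have c: "col (rmat (y t)) i = map_vec real_of_int (col (cmat (y t)) i)"
          using cmat i by (simp add: rmat_def)
        have "\<bar>vec m x0 \<bullet> col (rmat (y t)) i\<bar> \<le> U * real_of_int (l1_norm (col (cmat (y t)) i))"
          unfolding c using boundX[OF X(1)] cmat i by (intro dot_le_l1_norm) auto
        also have "\<dots> \<le> U * a"
        proof -
          have "l1_norm (col (cmat (y t)) i) \<le> mat_l1_norm (cmat (y t))" using cmat i by (intro l1_norm_col_le) auto
          then have "real_of_int (l1_norm (col (cmat (y t)) i)) \<le> real_of_int (mat_l1_norm (cmat (y t)))" by simp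
          also have "\<dots> \<le> a" using yt by (simp add: ips_def)
          finally show ?thesis using U by simp
        qed
        finally show ?thesis using abU(1) K(1) by (simp add: mult.commute)
      qed
      have bound0: "\<bar>vec m x0 \<bullet> rrhs (y t)\<bar> \<le> real_of_int K - 1"
      proof -
        have "\<bar>vec m x0 \<bullet> rrhs (y t)\<bar> \<le> U * real_of_int (l1_norm (rhs (y t)))"
          unfolding rrhs_def using boundX[OF X(1)] rhs by (intro dot_le_l1_norm) auto
        also have "\<dots> \<le> U * b" using yt U by (simp add: ips_def)
        finally show ?thesis using abU(2) K(1) by (simp add: mult.commute)
      qed
      have fl: "f \<in> J" if "f \<in> floor_conditions K" for f using that t by (auto simp: J_def J0_def)
      have eq: "gmi_fun (y t) (vec m x) = class_form x0 x" "gmi_fun (y t) (vec m x') = class_form x0 x'"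
        using class_form_eq[OF _ bound bound0] s fl by blast+
      have "affine_fun n (class_form x0 z)" for z
        using affine_fun_gmi_form[of "y t"] unfolding class_form_def num_vars by blast
      moreover have "sgn (f x) = sgn (f x')" if "f \<in> tree_conditions (class_form x0) \<tau>" for f
        using that t by (intro s') (auto simp: J'_def J1_def)
      moreover have "lp_radius (y t) \<le> int \<tau>" using rad y[OF t] by blast
      ultimately have "similar (y t) (class_form x0 x) (class_form x0 x')"
        by (intro similar_if_signs_agree) auto
      then show ?thesis using tree_size_eq[OF y[OF t] valid n] eq by simp
    qed
    then have same: "\<not> (\<exists>t<N. gmi_tree_size \<rho> \<kappa> (vec m x) (y t) \<noteq> gmi_tree_size \<rho> \<kappa> (vec m x') (y t))" by simp
    obtain S S' where S: "S \<subseteq> {..<N}" "S' \<subseteq> {..<N}" "x = w S" "x' = w S'"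
      using X(2,3) unfolding X_def by blast
    show "x = x'"
    proof (cases "S = S'")
      case False
      from separated[OF S(1,2) this] same show ?thesis unfolding S(3,4) by contradiction
    qed (simp add: S(3,4))
  qed (use fin fin' fX in auto)
  then have "real (2 ^ N) \<le> real ((4 * card J + 1) ^ m * (4 * (N * (18 * n * (\<tau> + 2) ^ (16 * n))) * 16 + 1) ^ m)"
    unfolding cX of_nat_le_iff .
  also have "\<dots> = (4 * real (card J) + 1) ^ m * (1152 * real N * real n * real (\<tau> + 2) ^ (16 * n) + 1) ^ m"
    by (simp add: ac_simps)
  also have "\<dots> \<le> (157 * real N * real n * (a * b * U)) ^ m * (1153 * real N * real n * real (\<tau> + 2) ^ (16 * n)) ^ m"
  proof (intro mult_mono power_mono)
    have Nn: "1 \<le> real N * real n" using N n by (simp add: mult_ge1_I)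
    have "real (card J) \<le> real (N * (3 * n * nat (4 * K + 1)))" using fin(2) by (simp only: of_nat_le_iff)
    also have "\<dots> = real N * real n * (3 * (4 * real_of_int K + 1))" using K(3) by simp
    also have "\<dots> \<le> real N * real n * (39 * (a * b * U))" using K(2) pos(3) by (intro mult_left_mono) auto
    finally have "4 * real (card J) \<le> 156 * (real N * real n * (a * b * U))" by argo
    moreover have "1 \<le> real N * real n * (a * b * U)" using mult_mono[OF Nn pos(3)] Nn by simp
    ultimately have "4 * real (card J) + 1 \<le> 157 * (real N * real n * (a * b * U))" by linarith
    then show "4 * real (card J) + 1 \<le> 157 * real N * real n * (a * b * U)" by (simp only: mult.assoc)
    have "1 \<le> real (\<tau> + 2) ^ (16 * n)" by simp
    then have "1 \<le> real N * real n * real (\<tau> + 2) ^ (16 * n)" using mult_mono[OF Nn, of 1 "real (\<tau> + 2) ^ (16 * n)"] Nn by simp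
    then show "1152 * real N * real n * real (\<tau> + 2) ^ (16 * n) + 1 \<le> 1153 * real N * real n * real (\<tau> + 2) ^ (16 * n)" by simp
  qed (use pos in auto)
  finally show ?thesis by simp
qed

text \<open>
  Taking logarithms leaves \<open>2 m ln N\<close> on the right, which is split by
  \<open>ln N \<le> N / (8 m) + ln (8 m)\<close>; the first summand is absorbed on the left. The constants are
  absorbed by \<open>n\<^sup>3 ln (m + n) \<ge> 1 / 2\<close>.
\<close>

lemma dimension_estimate:
  fixes N m n \<tau> :: nat and s :: real
  assumes m: "1 \<le> m" and n: "1 \<le> n" and \<tau>: "1 \<le> \<tau>" and s: "1 \<le> s" and N: "1 \<le> N"
    and le: "2 ^ N \<le> (157 * real N * real n * s) ^ m * (1153 * real N * real n * real (\<tau> + 2) ^ (16 * n)) ^ m"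
  shows "real N \<le> 472 * (real m * ln s + real m * real n ^ 3 * ln (real (m + n)) + real m * real n ^ 3 * ln (real \<tau>))"
proof -
  define L where "L = ln (real (m + n))"
  define c where "c = real n ^ 3"
  have c1: "1 \<le> c" "real n \<le> c" using n self_le_power[of "real n" 3] by (auto simp: c_def)
  have ln2: "1 / 2 \<le> ln (2::real)" using ln_le_minus_one[of "1 / 2 :: real"] by (simp add: ln_div)
  have ln2_le: "ln (2::real) \<le> 1" using ln_le_minus_one[of "2::real"] by simp
  have L: "ln 2 \<le> L" "ln (real n) \<le> L" "ln (real m) \<le> L" using m n by (auto simp: L_def)
  have L2: "1 / 2 \<le> L" using ln2 L(1) by simp
  have l0: "0 \<le> ln s" "0 \<le> ln (real \<tau>)" using s \<tau> by auto
  have ln3: "ln (3::real) \<le> 2"  using ln_le_minus_one[of "3::real"] by simp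
  have lnt: "ln (real (\<tau> + 2)) \<le> ln (real \<tau>) + 2"
  proof -
    have "ln (real (\<tau> + 2)) \<le> ln (3 * real \<tau>)" using \<tau> by simp
    also have "\<dots> = ln 3 + ln (real \<tau>)" using \<tau> by (simp add: ln_mult)
    finally show ?thesis using ln3 by simp
  qed
  have pos: "0 < real N" "0 < real n" "0 < s" "0 < real m" using N n s m by auto
  have e2: "ln (157::real) \<le> 8" "ln (1153::real) \<le> 11"
  proof -
    have two: "ln ((2::real) ^ k) \<le> real k" for k using ln2_le by (simp add: ln_realpow mult_left_le)
    have "ln (157::real) \<le> ln (2 ^ 8)" by simp
    also have "\<dots> \<le> 8" using two[of 8] by simp
    finally show "ln (157::real) \<le> 8" .
    have "ln (1153::real) \<le> ln (2 ^ 11)" by simp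
    also have "\<dots> \<le> 11" using two[of 11] by simp
    finally show "ln (1153::real) \<le> 11" .
  qed
  have "real N * ln 2 = ln (2 ^ N :: real)" by (simp add: ln_realpow)
  also have "\<dots> \<le> ln ((157 * real N * real n * s) ^ m * (1153 * real N * real n * real (\<tau> + 2) ^ (16 * n)) ^ m)"
    using le by (subst ln_le_cancel_iff) (use pos in auto)
  also have "\<dots> = real m * (ln 157 + ln (real N) + ln (real n) + ln s) +
      real m * (ln 1153 + ln (real N) + ln (real n) + real (16 * n) * ln (real (\<tau> + 2)))"
    using pos by (simp add: ln_mult ln_realpow del: of_nat_add)
  also have "\<dots> \<le> real m * (8 + ln (real N) + L + ln s) + real m * (11 + ln (real N) + L + 16 * real n * (ln (real \<tau>) + 2))"
    using e2 L mult_left_mono[OF lnt, of "real n"] by (intro add_mono mult_left_mono) auto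
  also have "\<dots> = real m * (2 * ln (real N)) + real m * (19 + 2 * L + ln s + 16 * (real n * (ln (real \<tau>) + 2)))"
    by (simp add: algebra_simps)
  also have "real m * (2 * ln (real N)) \<le> real N / 4 + real m * (6 + 2 * L)"
  proof -
    have "ln (real N / (8 * real m)) \<le> real N / (8 * real m) - 1" using pos by (intro ln_le_minus_one) simp
    moreover have "ln (real N / (8 * real m)) = ln (real N) - (ln 8 + ln (real m))"
      using pos by (simp add: ln_div ln_mult)
    moreover have "ln (8::real) \<le> 3"
    proof -
      have "ln (8::real) = ln (2 ^ 3)" by simp
      also have "\<dots> = 3 * ln 2" by (subst ln_realpow) auto
      finally show ?thesis using ln2_le by simp
    qed
    ultimately have "ln (real N) \<le> real N / (8 * real m) + 3 + L" using L(3) by linarith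
    then have "real m * (2 * ln (real N)) \<le> real m * (2 * (real N / (8 * real m) + 3 + L))"
      using pos by (intro mult_left_mono) auto
    also have "\<dots> = real N / 4 + real m * (6 + 2 * L)" using pos by (simp add: field_simps)
    finally show ?thesis .
  qed
  finally have "real N * ln 2 - real N / 4 \<le> real m * (25 + 4 * L + ln s + 16 * (real n * (ln (real \<tau>) + 2)))"
    by (simp add: algebra_simps)
  moreover have "real N * (1 / 2) \<le> real N * ln 2" using ln2 by (intro mult_left_mono) auto
  ultimately have "real N / 4 \<le> real m * (25 + 4 * L + ln s + 16 * (real n * (ln (real \<tau>) + 2)))" by simp
  also have "\<dots> \<le> real m * (118 * (ln s + c * L + c * ln (real \<tau>)))"
  proof (intro mult_left_mono)
    have collect: "25 + 4 * p + q + 16 * v \<le> 118 * (q + w + z)"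
      if "p \<le> w" "1 / 2 \<le> w" "k \<le> 2 * w" "v \<le> z + 2 * k" "0 \<le> z" "0 \<le> q" for p q v w z k :: real
      using that by argo
    have "L \<le> c * L" "1 / 2 \<le> c * L" using c1 L2 mult_right_mono[OF c1(1), of L] by linarith+
    moreover have "c \<le> 2 * (c * L)" using c1 mult_left_mono[OF L2, of c] by simp
    moreover have "real n * (ln (real \<tau>) + 2) \<le> c * (ln (real \<tau>) + 2)" using c1 l0 by (intro mult_right_mono) auto
    then have "real n * (ln (real \<tau>) + 2) \<le> c * ln (real \<tau>) + 2 * c" by (simp add: distrib_left)
    moreover have "0 \<le> c * ln (real \<tau>)" using c1 l0 by simp
    ultimately show "25 + 4 * L + ln s + 16 * (real n * (ln (real \<tau>) + 2)) \<le> 118 * (ln s + c * L + c * ln (real \<tau>))"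
      using collect l0(1) by blast
  qed simp
  finally show ?thesis by (simp add: L_def c_def algebra_simps)
qed

lemma pdim_le:
  assumes "\<And>N y r. 1 \<le> N \<Longrightarrow> (\<And>i. i < N \<Longrightarrow> y i \<in> D) \<Longrightarrow>
      (\<And>\<sigma> :: nat \<Rightarrow> bool. \<exists>g\<in>G. \<forall>i<N. g (y i) \<ge> (r i :: real) \<longleftrightarrow> \<sigma> i) \<Longrightarrow> real N \<le> B"
    and "0 \<le> B"
  shows "ereal_of_enat (pdim D G) \<le> ereal B"
proof -
  have "pdim D G \<le> enat (nat \<lfloor>B\<rfloor>)"
    unfolding pdim_def
  proof (rule Sup_least)
    fix k assume "k \<in> {enat N | N. \<exists>y r. (\<forall>i<N. y i \<in> D) \<and>
      (\<forall>\<sigma> :: nat \<Rightarrow> bool. \<exists>g\<in>G. \<forall>i<N. g (y i) \<ge> (r i :: real) \<longleftrightarrow> \<sigma> i)}"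
    then obtain N y r where N: "k = enat N" "\<And>i. i < N \<Longrightarrow> y i \<in> D"
      "\<And>\<sigma> :: nat \<Rightarrow> bool. \<exists>g\<in>G. \<forall>i<N. g (y i) \<ge> (r i :: real) \<longleftrightarrow> \<sigma> i" by blast
    have "real N \<le> B"
    proof (cases "N = 0")
      case False
      then show ?thesis by (intro assms(1)[OF _ N(2,3)]) auto
    qed (use assms(2) in simp)
    then show "k \<le> enat (nat \<lfloor>B\<rfloor>)" using N(1) by (simp add: le_nat_floor)
  qed
  then have "ereal_of_enat (pdim D G) \<le> ereal_of_enat (enat (nat \<lfloor>B\<rfloor>))" by (simp only: ereal_of_enat_le_iff)
  also have "\<dots> \<le> ereal B" using assms(2) by (simp add: of_nat_floor)
  finally show ?thesis .
qed

theorem theorem5p5: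
  shows "\<exists>C :: real. \<forall>(m :: nat) (n :: nat) (U :: real) (a :: real) (b :: real) (\<tau> :: nat) (\<kappa> :: nat)
      (D :: ip set) (\<rho> :: rules).
    1 \<le> m \<longrightarrow> 1 \<le> n \<longrightarrow> 0 < a \<longrightarrow> 0 < b \<longrightarrow> 1 \<le> a * b * U \<longrightarrow> 1 \<le> \<tau> \<longrightarrow> 1 \<le> \<kappa> \<longrightarrow>
    D \<subseteq> ips m n a b \<longrightarrow> (\<forall>P\<in>D. lp_radius P \<le> int \<tau>) \<longrightarrow> valid_rules D \<rho> \<longrightarrow>
    ereal_of_enat (pdim D {(\<lambda>P. real (gmi_tree_size \<rho> \<kappa> u P)) | u.
        u \<in> carrier_vec m \<and> (\<forall>i<m. -U \<le> u $ i \<and> u $ i \<le> U)})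
      \<le> ereal (C * (real m * ln (a * b * U) + real m * real n ^ 3 * ln (real (m + n))
                    + real m * real n ^ 3 * ln (real \<tau>)))"
proof (intro exI[of _ 472] allI impI)
  fix m n \<tau> \<kappa> :: nat and U a b :: real and D :: "ip set" and \<rho> :: rules
  assume *: "1 \<le> m" "1 \<le> n" "0 < a" "0 < b" "1 \<le> a * b * U" "1 \<le> \<tau>"
    "D \<subseteq> ips m n a b" "\<forall>P\<in>D. lp_radius P \<le> int \<tau>" "valid_rules D \<rho>"
  let ?B = "472 * (real m * ln (a * b * U) + real m * real n ^ 3 * ln (real (m + n)) + real m * real n ^ 3 * ln (real \<tau>))"
  let ?G = "{(\<lambda>P. real (gmi_tree_size \<rho> \<kappa> u P)) | u. u \<in> carrier_vec m \<and> (\<forall>i<m. -U \<le> u $ i \<and> u $ i \<le> U)}"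
  show "ereal_of_enat (pdim D ?G) \<le> ereal ?B"
  proof (rule pdim_le)
    show "0 \<le> ?B" using * by (intro mult_nonneg_nonneg add_nonneg_nonneg) auto
    fix N and y :: "nat \<Rightarrow> ip" and r :: "nat \<Rightarrow> real"
    assume N: "1 \<le> N" and y: "\<And>i. i < N \<Longrightarrow> y i \<in> D"
      and sh: "\<And>\<sigma> :: nat \<Rightarrow> bool. \<exists>g\<in>?G. \<forall>i<N. g (y i) \<ge> r i \<longleftrightarrow> \<sigma> i"
    have "\<exists>u\<in>carrier_vec m. (\<forall>i<m. -U \<le> u $ i \<and> u $ i \<le> U) \<and>
        (\<forall>t<N. real (gmi_tree_size \<rho> \<kappa> u (y t)) \<ge> r t \<longleftrightarrow> s t)" for s
      using sh[of s] by blast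
    from shattered_size_le[OF *(2-5,7-9) N y this]
    show "real N \<le> ?B" by (intro dimension_estimate *(1,2,5,6) N)
  qed
qed

end
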